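(* Assume either ($h\ge0$ and $0<\beta<\beta_0$) or ($h=0$ and $0<\beta<\beta_c$). Put $$\hat U(0)=-3U(0)+2U(1),\qquad \hat U(1)=3U(0)-4U(1)+U(2),\qquad \hat U(2)=U(0)-2U(1)+U(2).$$ Then there is a constant $K$ independent of $N$ such that for every $N$ there exist symmetric $m\times m$ matrices $\mathfrak R^{(0)},\mathfrak R^{(1)},\mathfrak R^{(2)}$ with $$\mathrm{sym}\big((I-\beta^2\Gamma\Delta^2\Lambda)\hat U(2)\big)=\tfrac1N\Gamma\Lambda^{-1}+\mathfrak R^{(2)},$$ $$\mathrm{sym}\big((I-\beta^2\Gamma'\Delta^2\Lambda)\hat U(1)\big)=\tfrac1N\Gamma'\Lambda^{-1}+\mathfrak R^{(1)},$$ $$\mathrm{sym}\big((I-\beta^2\Gamma'\Delta^2\Lambda)\hat U(0)\big)=\beta^2\,\mathrm{sym}\big(\Gamma''\Delta^2\Lambda\,\hat U(1)\big)+\tfrac1N\Gamma''\Lambda^{-1}+\mathfrak R^{(0)},$$ and for each $i=0,1,2$, $$\max_{1\le p,r\le m}|\mathfrak R^{(i)}_{p,r}|\le K\Big(N^{-3/2}+\sum_{s=1}^m\nu\big(|R^{(s)}_{12}-q_s|^3\big)\Big).$$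
   Context: Multi-species SK model. $m\ge2$; $\Delta^2=(\Delta^2_{s,t})_{s,t=1}^m$ is a symmetric invertible nonzero real matrix with non-negative entries (not necessarily positive-definite). For each $N$, $\{1,\dots,N\}$ is partitioned into disjoint species $I_1,\dots,I_m$ with $|I_s|=\lambda_sN$, where the ratios $\lambda_s\in(0,1)$ are fixed; $\Lambda=\mathrm{diag}(\lambda_1,\dots,\lambda_m)$. The disorder $(g_{ij})_{1\le i<j\le N}$ consists of independent centered Gaussians with $\mathbb E g_{ij}^2=\Delta^2_{s,t}$ when $i\in I_s$, $j\in I_t$. For $\sigma\in\{-1,1\}^N$, $H_N(\sigma)=\frac{\beta}{\sqrt N}\sum_{i<j}g_{ij}\sigma_i\sigma_j+h\sum_i\sigma_i$, $Z_N=\sum_\sigma e^{H_N(\sigma)}$, and the Gibbs measure is $G_N(\sigma)=e^{H_N(\sigma)}/Z_N$. $\langle\cdot\rangle$ is the average over i.i.d. replicas $\sigma^1,\sigma^2,\dots$ from $G_N$ and $\nu(\cdot)=\mathbb E\langle\cdot\rangle$. Overlap vectors: $\mathbf R_{\ell\ell'}=(R^{(1)}_{\ell\ell'},\dots,R^{(m)}_{\ell\ell'})^{\top}$, $R^{(s)}_{\ell\ell'}=\frac1{|I_s|}\sum_{i\in I_s}\sigma_i^\ell\sigma_i^{\ell'}$. $\beta_c=\rho(\Delta^2\Lambda)^{-1/2}$ ($\rho$ the spectral radius), $\beta_0=\beta_c/\sqrt{4\alpha}$, $\alpha=1+\mathbf 1\{\Delta^2\text{ is indefinite}\}$. $\mathbf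 q\in[0,1]^m$ is the unique solution (unique since $\beta<\beta_c$) of $q_s=\mathbb E\tanh^2(\beta\eta\sqrt{(\Delta^2\Lambda\mathbf q)_s}+h)$, $s=1,\dots,m$, $\eta\sim N(0,1)$; $\hat q_s=\mathbb E\tanh^4(\beta\eta\sqrt{(\Delta^2\Lambda\mathbf q)_s}+h)$; $\overline{\mathbf R}_{\ell\ell'}=\mathbf R_{\ell\ell'}-\mathbf q$. $\Gamma,\Gamma',\Gamma''$ are the diagonal matrices with $s$-th diagonal entries $\gamma_s=1-2q_s+\hat q_s$, $\gamma'_s=1-4q_s+3\hat q_s$, $\gamma''_s=2q_s+q_s^2-3\hat q_s$. $U(0)=\nu(\overline{\mathbf R}_{12}\overline{\mathbf R}_{34}^{\top})$, $U(1)=\nu(\overline{\mathbf R}_{12}\overline{\mathbf R}_{13}^{\top})$, $U(2)=\nu(\overline{\mathbf R}_{12}\overline{\mathbf R}_{12}^{\top})$ (depending on $N$). $\mathrm{sym}(A)=(A+A^{\top})/2$. *)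

theory Defs
  imports "HOL-Analysis.Analysis" "HOL-Probability.Probability"
begin

section \<open>Matrices\<close>

definition diag :: "real ^ 'm \<Rightarrow> real ^ 'm ^ 'm" where
  "diag v = (\<chi> s t. if s = t then v $ s else 0)"

definition sym_part :: "real ^ 'm ^ 'm \<Rightarrow> real ^ 'm ^ 'm" where
  "sym_part A = (1 / 2) *\<^sub>R (A + transpose A)"

definition indefinite :: "real ^ 'm ^ 'm \<Rightarrow> bool" where
  "indefinite A \<longleftrightarrow> (\<exists>x. x \<bullet> (A *v x) > 0) \<and> (\<exists>x. x \<bullet> (A *v x) < 0)"

definition complex_spectrum :: "real ^ 'm ^ 'm \<Rightarrow> complex set" where
  "complex_spectrum A =
     {z. \<exists>v :: complex ^ 'm. v \<noteq> 0 \<and> (\<chi> s t. complex_of_real (A $ s $ t)) *v v = z *s v}"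

definition spectral_radius :: "real ^ 'm ^ 'm \<Rightarrow> real" where
  "spectral_radius A = Max (cmod ` complex_spectrum A)"


section \<open>The model\<close>

text \<open>The species are the elements of the finite type \<open>'m\<close>; \<open>lam\<close> is the vector of
  their ratios and \<open>D\<close> is the variance matrix, written $\Delta^2$ in the literature (it is
  not the square of a matrix).\<close>

definition species_partition :: "real ^ 'm \<Rightarrow> nat \<Rightarrow> ('m \<Rightarrow> nat set) \<Rightarrow> bool" where
  "species_partition lam N I \<longleftrightarrow>
     (\<Union>s. I s) = {1..N} \<and> disjoint_family I \<and> (\<forall>s. real (card (I s)) = lam $ s * real N)"

text \<open>The centered Gaussian law is obtained by scaling the standard one, so that variance \<open>0\<close>
  (a vanishing entry of \<open>D\<close>) gives the point mass at \<open>0\<close>.\<close>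

definition centered_gaussian :: "'w measure \<Rightarrow> ('w \<Rightarrow> real) \<Rightarrow> real \<Rightarrow> bool" where
  "centered_gaussian M X v \<longleftrightarrow>
     X \<in> borel_measurable M \<and>
     distr M borel X = distr std_normal_distribution borel (\<lambda>x. sqrt v * x)"

definition sk_disorder ::
  "real ^ 'm ^ 'm \<Rightarrow> nat \<Rightarrow> ('m \<Rightarrow> nat set) \<Rightarrow> 'w measure \<Rightarrow> (nat \<Rightarrow> nat \<Rightarrow> 'w \<Rightarrow> real) \<Rightarrow> bool"
where
  "sk_disorder D N I M g \<longleftrightarrow>
     prob_space M \<and>
     prob_space.indep_vars M (\<lambda>_. borel) (\<lambda>(i, j). g i j) {(i, j). 1 \<le> i \<and> i < j \<and> j \<le> N} \<and>
     (\<forall>s t. \<forall>i\<in>I s. \<forall>j\<in>I t. i < j \<longrightarrow> centered_gaussian M (g i j) (D $ s $ t))"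

definition configs :: "nat \<Rightarrow> (nat \<Rightarrow> real) set" where
  "configs N = {1..N} \<rightarrow>\<^sub>E {-1, 1}"

definition hamiltonian :: "real \<Rightarrow> real \<Rightarrow> nat \<Rightarrow> (nat \<Rightarrow> nat \<Rightarrow> real) \<Rightarrow> (nat \<Rightarrow> real) \<Rightarrow> real" where
  "hamiltonian \<beta> h N g \<sigma> =
     \<beta> / sqrt (real N) * (\<Sum>(i, j) | 1 \<le> i \<and> i < j \<and> j \<le> N. g i j * \<sigma> i * \<sigma> j)
     + h * (\<Sum>i=1..N. \<sigma> i)"

definition partition_function :: "real \<Rightarrow> real \<Rightarrow> nat \<Rightarrow> (nat \<Rightarrow> nat \<Rightarrow> real) \<Rightarrow> real" where
  "partition_function \<beta> h N g = (\<Sum>\<sigma>\<in>configs N. exp (hamiltonian \<beta> h N g \<sigma>))"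

definition gibbs :: "real \<Rightarrow> real \<Rightarrow> nat \<Rightarrow> (nat \<Rightarrow> nat \<Rightarrow> real) \<Rightarrow> (nat \<Rightarrow> real) \<Rightarrow> real" where
  "gibbs \<beta> h N g \<sigma> = exp (hamiltonian \<beta> h N g \<sigma>) / partition_function \<beta> h N g"

text \<open>The average over \<open>n\<close> independent replicas \<open>\<tau> 1, \<dots>, \<tau> n\<close> drawn from the Gibbs measure,
  for fixed disorder, and its expectation \<open>nu\<close> over the disorder. For a function of
  \<open>\<tau> 1, \<dots>, \<tau> k\<close> the value does not depend on the choice of \<open>n \<ge> k\<close>.\<close>

definition gibbs_avg ::
  "real \<Rightarrow> real \<Rightarrow> nat \<Rightarrow> (nat \<Rightarrow> nat \<Rightarrow> real) \<Rightarrow> nat \<Rightarrow> ((nat \<Rightarrow> nat \<Rightarrow> real) \<Rightarrow> real) \<Rightarrow> real"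
where
  "gibbs_avg \<beta> h N g n f =
     (\<Sum>\<tau> \<in> {1..n} \<rightarrow>\<^sub>E configs N. (\<Prod>l=1..n. gibbs \<beta> h N g (\<tau> l)) * f \<tau>)"

definition nu ::
  "real \<Rightarrow> real \<Rightarrow> nat \<Rightarrow> 'w measure \<Rightarrow> (nat \<Rightarrow> nat \<Rightarrow> 'w \<Rightarrow> real) \<Rightarrow>
   nat \<Rightarrow> ((nat \<Rightarrow> nat \<Rightarrow> real) \<Rightarrow> real) \<Rightarrow> real"
where
  "nu \<beta> h N M g n f = (\<integral>\<omega>. gibbs_avg \<beta> h N (\<lambda>i j. g i j \<omega>) n f \<partial>M)"

definition overlap ::
  "('m \<Rightarrow> nat set) \<Rightarrow> (nat \<Rightarrow> nat \<Rightarrow> real) \<Rightarrow> nat \<Rightarrow> nat \<Rightarrow> real ^ 'm"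
where
  "overlap I \<tau> l l' = (\<chi> s. (\<Sum>i\<in>I s. \<tau> l i * \<tau> l' i) / real (card (I s)))"

text \<open>\<open>overlap_cov \<beta> h N M g I q n (a, b) (c, d)\<close> is the matrix
  $\nu\bigl((\mathbf R_{ab} - \mathbf q)(\mathbf R_{cd} - \mathbf q)^{\top}\bigr)$,
  computed with \<open>n\<close> replicas.\<close>

definition overlap_cov ::
  "real \<Rightarrow> real \<Rightarrow> nat \<Rightarrow> 'w measure \<Rightarrow> (nat \<Rightarrow> nat \<Rightarrow> 'w \<Rightarrow> real) \<Rightarrow> ('m \<Rightarrow> nat set) \<Rightarrow>
   real ^ 'm \<Rightarrow> nat \<Rightarrow> nat \<times> nat \<Rightarrow> nat \<times> nat \<Rightarrow> real ^ 'm ^ 'm"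
where
  "overlap_cov \<beta> h N M g I q n = (\<lambda>(a, b) (c, d). \<chi> p r.
     nu \<beta> h N M g n (\<lambda>\<tau>. (overlap I \<tau> a b - q) $ p * (overlap I \<tau> c d - q) $ r))"


section \<open>Critical temperatures and the replica-symmetric overlap\<close>

definition beta_c :: "real ^ 'm ^ 'm \<Rightarrow> real ^ 'm \<Rightarrow> real" where
  "beta_c D lam = spectral_radius (D ** diag lam) powr (- 1 / 2)"

definition beta_0 :: "real ^ 'm ^ 'm \<Rightarrow> real ^ 'm \<Rightarrow> real" where
  "beta_0 D lam = beta_c D lam / sqrt (4 * (1 + of_bool (indefinite D)))"

definition tanh_moment ::
  "nat \<Rightarrow> real \<Rightarrow> real \<Rightarrow> real ^ 'm ^ 'm \<Rightarrow> real ^ 'm \<Rightarrow> real ^ 'm \<Rightarrow> real ^ 'm"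
where
  "tanh_moment k \<beta> h D lam q =
     (\<chi> s. \<integral>x. tanh (\<beta> * x * sqrt (((D ** diag lam) *v q) $ s) + h) ^ k
            \<partial>std_normal_distribution)"

definition rs_solution ::
  "real \<Rightarrow> real \<Rightarrow> real ^ 'm ^ 'm \<Rightarrow> real ^ 'm \<Rightarrow> real ^ 'm \<Rightarrow> bool"
where
  "rs_solution \<beta> h D lam q \<longleftrightarrow>
     (\<forall>s. 0 \<le> q $ s \<and> q $ s \<le> 1) \<and> q = tanh_moment 2 \<beta> h D lam q"

end

theory Submission
  imports Defs
begin

text \<open>
  The identities are a cavity expansion to second order. Write $R^{(r)}_{ab} - q_r$ as
  \<open>overlap_dev r\<close> and fix a site $i$ of species $p$, with spins
  $\varepsilon_a = \sigma^a_i$ in the replicas. The covariance of $R^{(p)}_{12}$ and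
  $R^{(r)}_{ab}$ is the average over $i$ of
  $\nu((\varepsilon_1\varepsilon_2 - q_p)(R^{(r)}_{ab} - q_r))$, and each of these terms is compared
  with a model in which the spin $i$ does not interact with the others.

  The comparison is an interpolation. The couplings of the site are multiplied by $\sin\theta$
  while an independent Gaussian field of variance $\beta^2(\Delta^2\Lambda q)_p$, multiplied by
  $\cos\theta$, acts on the spin; $\theta = \pi/2$ is the model and $\theta = 0$ the decoupled
  system. All Gaussian Hamiltonians are treated at once in the locale \<open>gaussian_gibbs\<close>: by
  Gaussian integration by parts (\<open>DERIV_quenched\<close>), differentiating an average adds two replicas
  and multiplies the observable by a combination of the quantities
  $\varepsilon_l\varepsilon_{l'}Q_{ll'}$ over pairs of distinct replicas, where $Q_{ll'}$ is the
  overlap field of the other spins minus its predicted value $(\Delta^2\Lambda q)_p$. So every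
  derivative costs one factor of size $|R - q| + 1/N$, and averages of non-negative functions are
  comparable along the path (\<open>path_le_endpoint\<close>). Since the observable already contains one such
  factor, the second-order remainder is bounded by third moments (\<open>path_second_order\<close>).

  In the decoupled system spin and rest factorise, and the spins of $j$ distinct replicas average to
  $E\tanh^j$ of the field (\<open>quenched_spins\<close>). As $q$ solves the replica-symmetric equation, the
  zeroth-order term vanishes. The first-order terms have the coefficients $1 - q^2$, $q - q^2$ and
  $\hat q - q^2$, according to the number of replicas that the pair $l, l'$ shares with the pair $1, 2$, times
  averages $\nu((R_{ab} - q)\,(\Delta^2\Lambda(R_{ll'} - q))_p)$ (\<open>cavity_site\<close>).
  The term $1/N$ comes from the site's own contribution to $R^{(r)}_{ab}$ when $r = p$.

  Collecting terms for $(a,b) = (1,2), (1,3), (3,4)$ gives a linear system for $U(2), U(1), U(0)$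
  (\<open>cov_expansions\<close>). The combinations $\hat U(i)$ bring it into triangular form, with the
  entries $\gamma, \gamma', \gamma''$ (\<open>combined_expansions\<close>), and symmetrising does not increase the
  error.
\<close>

section \<open>Averages over replicas\<close>

text \<open>Replicas are numbered from \<open>1\<close>; index ranges \<open>{1..n}\<close> are to keep that form under
  simplification.\<close>

declare One_nat_def [simp del]

definition replica_avg ::
  "'s set \<Rightarrow> ('s \<Rightarrow> real) \<Rightarrow> nat \<Rightarrow> ((nat \<Rightarrow> 's) \<Rightarrow> real) \<Rightarrow> real"
where
  "replica_avg S H n f =
     (\<Sum>\<tau> \<in> {1..n} \<rightarrow>\<^sub>E S. (\<Prod>l=1..n. exp (H (\<tau> l)) / (\<Sum>\<sigma>\<in>S. exp (H \<sigma>))) * f \<tau>)"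

text \<open>Being a function of the first \<open>n\<close> replicas is expressed by agreement, so that the same
  observable can be averaged over any larger number of replicas.\<close>

definition uses_replicas :: "nat \<Rightarrow> ((nat \<Rightarrow> 's) \<Rightarrow> real) \<Rightarrow> bool" where
  "uses_replicas n f \<longleftrightarrow> (\<forall>\<tau> \<tau>'. (\<forall>l\<in>{1..n}. \<tau> l = \<tau>' l) \<longrightarrow> f \<tau> = f \<tau>')"

lemma uses_replicas_mono: "uses_replicas n f \<Longrightarrow> n \<le> n' \<Longrightarrow> uses_replicas n' f"
  unfolding uses_replicas_def by (meson atLeastAtMost_iff le_trans)

lemma uses_replicasD: "uses_replicas n f \<Longrightarrow> (\<And>l. 1 \<le> l \<Longrightarrow> l \<le> n \<Longrightarrow> \<tau> l = \<tau>' l) \<Longrightarrow> f \<tau> = f \<tau>'"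
  unfolding uses_replicas_def by auto

lemma uses_replicas_const: "uses_replicas n (\<lambda>_. c)"
  by (simp add: uses_replicas_def)

lemma uses_replicas_at: "1 \<le> l \<Longrightarrow> l \<le> n \<Longrightarrow> uses_replicas n (\<lambda>\<tau>. F (\<tau> l))"
  by (simp add: uses_replicas_def)

lemma uses_replicas_at2:
  "1 \<le> l \<Longrightarrow> l \<le> n \<Longrightarrow> 1 \<le> k \<Longrightarrow> k \<le> n \<Longrightarrow> uses_replicas n (\<lambda>\<tau>. F (\<tau> l) (\<tau> k))"
  by (simp add: uses_replicas_def)

lemma uses_replicas_mult:
  "uses_replicas n f \<Longrightarrow> uses_replicas n g \<Longrightarrow> uses_replicas n (\<lambda>\<tau>. f \<tau> * g \<tau>)"
  unfolding uses_replicas_def by metis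

lemma uses_replicas_diff:
  "uses_replicas n f \<Longrightarrow> uses_replicas n g \<Longrightarrow> uses_replicas n (\<lambda>\<tau>. f \<tau> - g \<tau>)"
  unfolding uses_replicas_def by metis

lemma uses_replicas_sum:
  "(\<And>j. j \<in> J \<Longrightarrow> uses_replicas n (f j)) \<Longrightarrow> uses_replicas n (\<lambda>\<tau>. \<Sum>j\<in>J. f j \<tau>)"
  unfolding uses_replicas_def by (metis (mono_tags, lifting) sum.cong)

lemma sum_PiE_Suc:
  fixes F :: "(nat \<Rightarrow> 's) \<Rightarrow> real"
  shows "(\<Sum>\<tau> \<in> {1..Suc n} \<rightarrow>\<^sub>E S. F \<tau>) = (\<Sum>\<tau> \<in> {1..n} \<rightarrow>\<^sub>E S. \<Sum>\<sigma>\<in>S. F (\<tau>(Suc n := \<sigma>)))"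
proof -
  have "{1..Suc n} = insert (Suc n) {1..n}" by auto
  then have "(\<Sum>\<tau> \<in> {1..Suc n} \<rightarrow>\<^sub>E S. F \<tau>) = (\<Sum>\<tau> \<in> insert (Suc n) {1..n} \<rightarrow>\<^sub>E S. F \<tau>)" by simp
  also have "\<dots> = (\<Sum>p \<in> S \<times> ({1..n} \<rightarrow>\<^sub>E S). F ((snd p)(Suc n := fst p)))"
    unfolding PiE_insert_eq
    using inj_combinator[of "Suc n" "{1..n}" "\<lambda>_. S"]
    by (subst sum.reindex) (auto simp: case_prod_unfold)
  also have "\<dots> = (\<Sum>\<sigma>\<in>S. \<Sum>\<tau> \<in> {1..n} \<rightarrow>\<^sub>E S. F (\<tau>(Suc n := \<sigma>)))"
    by (simp add: sum.cartesian_product case_prod_unfold)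
  also have "\<dots> = (\<Sum>\<tau> \<in> {1..n} \<rightarrow>\<^sub>E S. \<Sum>\<sigma>\<in>S. F (\<tau>(Suc n := \<sigma>)))"
    by (rule sum.swap)
  finally show ?thesis .
qed

lemma replica_avg_split_last:
  "replica_avg S H (Suc n) f =
     replica_avg S H n (\<lambda>\<tau>. \<Sum>\<sigma>\<in>S. exp (H \<sigma>) / (\<Sum>\<sigma>\<in>S. exp (H \<sigma>)) * f (\<tau>(Suc n := \<sigma>)))"
proof -
  have *: "(\<Prod>l=1..Suc n. g ((\<tau>(Suc n := \<sigma>)) l)) = (\<Prod>l=1..n. g (\<tau> l)) * g \<sigma>"
    for g :: "'a \<Rightarrow> real" and \<tau> \<sigma>
    by (simp add: prod.nat_ivl_Suc')
  show ?thesis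
    unfolding replica_avg_def sum_PiE_Suc
    using *[of "\<lambda>\<sigma>. exp (H \<sigma>) / (\<Sum>\<sigma>\<in>S. exp (H \<sigma>))"]
    by (simp add: sum_distrib_left mult.assoc)
qed

lemma replica_avg_cong:
  "(\<And>\<tau>. \<tau> \<in> {1..n} \<rightarrow>\<^sub>E S \<Longrightarrow> f \<tau> = g \<tau>) \<Longrightarrow> replica_avg S H n f = replica_avg S H n g"
  unfolding replica_avg_def by (intro sum.cong) auto

lemma replica_avg_add: "replica_avg S H n (\<lambda>\<tau>. f \<tau> + g \<tau>) = replica_avg S H n f + replica_avg S H n g"
  unfolding replica_avg_def by (simp add: algebra_simps sum.distrib)

lemma replica_avg_diff: "replica_avg S H n (\<lambda>\<tau>. f \<tau> - g \<tau>) = replica_avg S H n f - replica_avg S H n g"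
  unfolding replica_avg_def by (simp add: algebra_simps sum_subtractf)

lemma replica_avg_cmult: "replica_avg S H n (\<lambda>\<tau>. c * f \<tau>) = c * replica_avg S H n f"
  unfolding replica_avg_def by (simp add: sum_distrib_left mult_ac)

lemma replica_avg_sum:
  "replica_avg S H n (\<lambda>\<tau>. \<Sum>j\<in>J. f j \<tau>) = (\<Sum>j\<in>J. replica_avg S H n (f j))"
  unfolding replica_avg_def by (subst sum.swap) (simp add: sum_distrib_left)

lemma replica_avg_mono:
  assumes "\<And>\<tau>. \<tau> \<in> {1..n} \<rightarrow>\<^sub>E S \<Longrightarrow> f \<tau> \<le> g \<tau>"
  shows "replica_avg S H n f \<le> replica_avg S H n g"
  unfolding replica_avg_def
  by (intro sum_mono mult_left_mono assms prod_nonneg ballI divide_nonneg_nonneg sum_nonneg) auto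

lemma replica_avg_abs_le: "\<bar>replica_avg S H n f\<bar> \<le> replica_avg S H n (\<lambda>\<tau>. \<bar>f \<tau>\<bar>)"
  using replica_avg_mono[of n S f "\<lambda>\<tau>. \<bar>f \<tau>\<bar>" H] replica_avg_mono[of n S "\<lambda>\<tau>. - f \<tau>" "\<lambda>\<tau>. \<bar>f \<tau>\<bar>" H]
    replica_avg_cmult[of S H n "-1" f] by (simp add: abs_le_iff)

locale finite_configs =
  fixes S :: "'s set"
  assumes finite_S: "finite S" and nonempty_S: "S \<noteq> {}"
begin

lemma partition_pos: "0 < (\<Sum>\<sigma>\<in>S. exp (H \<sigma> :: real))"
  by (intro sum_pos finite_S nonempty_S) auto

lemma gibbs_weights_sum: "(\<Sum>\<sigma>\<in>S. exp (H \<sigma>) / (\<Sum>\<sigma>\<in>S. exp (H \<sigma> :: real))) = 1"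
  using partition_pos[of H] by (simp add: sum_divide_distrib[symmetric])

lemma replica_avg_Suc:
  assumes "uses_replicas n f"
  shows "replica_avg S H (Suc n) f = replica_avg S H n f"
proof -
  have "f (\<tau>(Suc n := \<sigma>)) = f \<tau>" for \<tau> \<sigma> by (rule uses_replicasD[OF assms]) auto
  then show ?thesis
    unfolding replica_avg_split_last by (simp only: sum_distrib_right[symmetric] gibbs_weights_sum mult_1_left)
qed

lemma replica_avg_more:
  assumes "uses_replicas n f" "n \<le> n'"
  shows "replica_avg S H n' f = replica_avg S H n f"
  using \<open>n \<le> n'\<close>
proof (induction rule: dec_induct)
  case (step k)
  then show ?case using replica_avg_Suc[of k f H] uses_replicas_mono[OF assms(1), of k] by simp
qed simp

lemma replica_avg_const: "replica_avg S H n (\<lambda>_. c) = c"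
proof -
  have "replica_avg S H n (\<lambda>_. c) = replica_avg S H 0 (\<lambda>_. c)"
    by (rule replica_avg_more) (auto simp: uses_replicas_def)
  then show ?thesis by (simp add: replica_avg_def)
qed

lemma replica_avg_bounded:
  assumes "\<And>\<tau>. \<tau> \<in> {1..n} \<rightarrow>\<^sub>E S \<Longrightarrow> \<bar>f \<tau>\<bar> \<le> C"
  shows "\<bar>replica_avg S H n f\<bar> \<le> C"
  using replica_avg_abs_le[of S H n f] replica_avg_mono[of n S "\<lambda>\<tau>. \<bar>f \<tau>\<bar>" "\<lambda>_. C" H]
    replica_avg_const[of H n C] assms by fastforce

lemma finite_replicas: "finite ({1..n :: nat} \<rightarrow>\<^sub>E S)"
  by (intro finite_PiE finite_S) auto

lemma replica_avg_permute:
  assumes p: "p permutes {1..n}"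
  shows "replica_avg S H n (\<lambda>\<tau>. f (\<tau> \<circ> p)) = replica_avg S H n f"
proof -
  let ?w = "\<lambda>\<sigma>. exp (H \<sigma>) / (\<Sum>\<sigma>\<in>S. exp (H \<sigma>))"
  have pin: "p l \<in> {1..n} \<longleftrightarrow> l \<in> {1..n}" for l using permutes_in_image[OF p] .
  have ip: "inv p permutes {1..n}" using permutes_inv[OF p] .
  have pin': "inv p l \<in> {1..n} \<longleftrightarrow> l \<in> {1..n}" for l using permutes_in_image[OF ip] .
  have pd: "(\<Prod>l=1..n. g (p l)) = (\<Prod>l=1..n. g l)" for g :: "nat \<Rightarrow> real"
    using prod.permute[OF p, of g] by (simp add: comp_def)
  have pdw: "(\<Prod>l=1..n. ?w (\<tau> (p l))) = (\<Prod>l=1..n. ?w (\<tau> l))" for \<tau>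
    by (rule pd)
  have clo: "\<tau> \<circ> r \<in> {1..n} \<rightarrow>\<^sub>E S" if "\<tau> \<in> {1..n} \<rightarrow>\<^sub>E S" "r permutes {1..n}" for \<tau> r
    using that permutes_in_image[OF that(2)] permutes_not_in[OF that(2)]
    by (auto simp: PiE_iff extensional_def)
  show ?thesis unfolding replica_avg_def
    by (rule sum.reindex_bij_witness[where i="\<lambda>\<tau>. \<tau> \<circ> inv p" and j="\<lambda>\<tau>. \<tau> \<circ> p"])
      (simp_all add: clo p ip comp_assoc permutes_inv_o[OF p] pdw)
qed

text \<open>Replicas are exchangeable. It is enough to rename injectively the replicas that occur in the
  observable, because an injection of \<open>{1..k}\<close> into \<open>{1..n}\<close> extends to a permutation.\<close>

lemma replica_avg_rename:
  assumes f: "uses_replicas k f" and h: "inj_on h {1..k}" "h ` {1..k} \<subseteq> {1..n}" and kn: "k \<le> n"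
  shows "replica_avg S H n (\<lambda>\<tau>. f (\<lambda>l. \<tau> (h l))) = replica_avg S H n f"
proof -
  have "card ({1..n} - {1..k}) = card ({1..n} - h ` {1..k})"
    using h kn by (simp add: card_Diff_subset card_image)
  then obtain g where g: "bij_betw g ({1..n} - {1..k}) ({1..n} - h ` {1..k})"
    using finite_same_card_bij by (metis finite_Diff finite_atLeastAtMost)
  define p where "p l = (if l \<in> {1..k} then h l else if l \<in> {1..n} then g l else l)" for l
  have "bij_betw p ({1..k} \<union> ({1..n} - {1..k})) (h ` {1..k} \<union> ({1..n} - h ` {1..k}))"
  proof (rule bij_betw_combine)
    show "bij_betw p {1..k} (h ` {1..k})"
      using inj_on_imp_bij_betw[OF h(1)] by (subst bij_betw_cong[of _ p h]) (auto simp: p_def)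
    show "bij_betw p ({1..n} - {1..k}) ({1..n} - h ` {1..k})"
      using g by (subst bij_betw_cong[of _ p g]) (auto simp: p_def)
  qed auto
  moreover have "{1..k} \<union> ({1..n} - {1..k}) = {1..n}" "h ` {1..k} \<union> ({1..n} - h ` {1..k}) = {1..n}"
    using h kn by auto
  ultimately have p: "p permutes {1..n}"
    using kn by (intro bij_imp_permutes) (auto simp: p_def)
  have "f (\<lambda>l. \<tau> (h l)) = f (\<tau> \<circ> p)" for \<tau>
    by (rule uses_replicasD[OF f]) (auto simp: p_def)
  then show ?thesis using replica_avg_permute[OF p] by simp
qed

text \<open>Differentiating a Gibbs average along a family of Hamiltonians adds one replica: each of
  the \<open>n\<close> weights contributes the derivative of its own energy, and each normalisation subtracts
  the thermal average of that derivative, which is evaluated on the new replica.\<close>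

definition new_replica :: "nat \<Rightarrow> ('s \<Rightarrow> real) \<Rightarrow> (nat \<Rightarrow> 's) \<Rightarrow> real" where
  "new_replica n u \<tau> = (\<Sum>l=1..n. u (\<tau> l)) - real n * u (\<tau> (Suc n))"

lemma DERIV_replica_avg:
  assumes f: "uses_replicas n f"
    and H: "\<And>\<sigma>. \<sigma> \<in> S \<Longrightarrow> ((\<lambda>s. H s \<sigma>) has_real_derivative u \<sigma>) (at s)"
  shows "((\<lambda>s. replica_avg S (H s) n f) has_real_derivative
          replica_avg S (H s) (Suc n) (\<lambda>\<tau>. f \<tau> * new_replica n u \<tau>)) (at s)"
proof -
  let ?Z = "\<lambda>s. \<Sum>\<sigma>\<in>S. exp (H s \<sigma>)"
  define m where "m = (\<Sum>\<sigma>\<in>S. exp (H s \<sigma>) / ?Z s * u \<sigma>)"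
  have Z: "0 < ?Z s" for s by (rule partition_pos)
  \<comment> \<open>As a single exponential, the weight of a replica configuration is differentiated by the chain rule.\<close>
  have w: "(\<Prod>l=1..n. exp (H s (\<tau> l)) / ?Z s) = exp ((\<Sum>l=1..n. H s (\<tau> l)) - real n * ln (?Z s))" for s \<tau>
  proof -
    have "exp (H s (\<tau> l)) / ?Z s = exp (H s (\<tau> l) - ln (?Z s))" for l
      using Z[of s] by (simp add: exp_diff)
    then show ?thesis by (simp add: exp_sum[symmetric] sum_subtractf)
  qed
  have m: "(\<Sum>\<sigma>\<in>S. exp (H s \<sigma>) * u \<sigma>) / ?Z s = m"
    by (simp add: m_def sum_divide_distrib)
  have dZ: "(?Z has_real_derivative (\<Sum>\<sigma>\<in>S. exp (H s \<sigma>) * u \<sigma>)) (at s)"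
    by (intro DERIV_sum) (auto intro!: derivative_eq_intros H)
  have d: "((\<lambda>s. (\<Prod>l=1..n. exp (H s (\<tau> l)) / ?Z s)) has_real_derivative
       (\<Prod>l=1..n. exp (H s (\<tau> l)) / ?Z s) * ((\<Sum>l=1..n. u (\<tau> l)) - real n * m)) (at s)"
    if "\<tau> \<in> {1..n} \<rightarrow>\<^sub>E S" for \<tau>
  proof -
    have "((\<lambda>s. (\<Sum>l=1..n. H s (\<tau> l)) - real n * ln (?Z s)) has_real_derivative
        (\<Sum>l=1..n. u (\<tau> l)) - real n * m) (at s)"
      using that by (auto intro!: derivative_eq_intros dZ H Z simp: m PiE_iff)
    then show ?thesis unfolding w by (rule DERIV_fun_exp)
  qed
  have "((\<lambda>s. replica_avg S (H s) n f) has_real_derivative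
      replica_avg S (H s) n (\<lambda>\<tau>. f \<tau> * ((\<Sum>l=1..n. u (\<tau> l)) - real n * m))) (at s)"
    unfolding replica_avg_def
    by (intro DERIV_sum) (auto intro!: derivative_eq_intros d)
  moreover have "replica_avg S (H s) (Suc n) (\<lambda>\<tau>. f \<tau> * new_replica n u \<tau>)
      = replica_avg S (H s) n (\<lambda>\<tau>. f \<tau> * ((\<Sum>l=1..n. u (\<tau> l)) - real n * m))"
  proof -
    have lin: "(\<Sum>\<sigma>\<in>S. w \<sigma> * (F * (A - c * u \<sigma>))) = F * (A * (\<Sum>\<sigma>\<in>S. w \<sigma>) - c * (\<Sum>\<sigma>\<in>S. w \<sigma> * u \<sigma>))"
      for w F A c by (simp add: algebra_simps sum_subtractf sum_distrib_left)
    have "f (\<tau>(Suc n := \<sigma>)) = f \<tau>" for \<tau> \<sigma> by (rule uses_replicasD[OF f]) auto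
    moreover have "(\<Sum>l=1..n. u ((\<tau>(Suc n := \<sigma>)) l)) = (\<Sum>l=1..n. u (\<tau> l))" for \<tau> \<sigma>
      by (intro sum.cong) auto
    ultimately have *: "(\<Sum>\<sigma>\<in>S. exp (H s \<sigma>) / ?Z s * (f (\<tau>(Suc n := \<sigma>)) * new_replica n u (\<tau>(Suc n := \<sigma>))))
       = f \<tau> * ((\<Sum>l=1..n. u (\<tau> l)) * (\<Sum>\<sigma>\<in>S. exp (H s \<sigma>) / ?Z s) - real n * m)" for \<tau>
      unfolding m_def new_replica_def by (simp only: lin fun_upd_same)
    then show ?thesis
      unfolding replica_avg_split_last gibbs_weights_sum by simp
  qed
  ultimately show ?thesis by simp
qed

lemma uses_replicas_new_replica:
  assumes "uses_replicas n f"
  shows "uses_replicas (Suc n) (\<lambda>\<tau>. f \<tau> * new_replica n u \<tau>)"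
proof -
  have "uses_replicas (Suc n) f" using assms by (rule uses_replicas_mono) simp
  then show ?thesis
    unfolding new_replica_def
    by (intro uses_replicas_mult uses_replicas_diff uses_replicas_sum
        uses_replicas_at[where F=u] uses_replicas_const) auto
qed

end

section \<open>Gaussian integration by parts\<close>

lemma prob_space_std_normal: "prob_space std_normal_distribution"
  by (rule prob_space_normal_density) simp

lemma integrable_std_normal_id: "integrable std_normal_distribution (\<lambda>x. \<bar>x\<bar>)"
  using integrable_std_normal_moment_abs[of 1] by (subst integrable_density) auto

lemma std_normal_density_tendsto_0:
  "(std_normal_density \<longlongrightarrow> 0) at_top" "(std_normal_density \<longlongrightarrow> 0) at_bot"
proof -
  have "filterlim (\<lambda>x::real. 1 / 2 * x\<^sup>2) at_top at_top"
    by (intro filterlim_tendsto_pos_mult_at_top[OF tendsto_const] filterlim_pow_at_top filterlim_ident) auto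
  then have "((\<lambda>x::real. exp (- (1 / 2 * x\<^sup>2))) \<longlongrightarrow> 0) at_top"
    by (rule filterlim_compose[OF exp_at_bot filterlim_compose[OF filterlim_uminus_at_bot_at_top]])
  then have *: "((\<lambda>x::real. exp (- (x\<^sup>2 / 2))) \<longlongrightarrow> 0) at_top"
    by simp
  have "((\<lambda>x::real. 1 / sqrt (2 * pi) * exp (- (x\<^sup>2 / 2))) \<longlongrightarrow> 0) at_top"
    by (rule tendsto_mult_right_zero[OF *])
  then show top: "(std_normal_density \<longlongrightarrow> 0) at_top"
    by (simp add: std_normal_density_def[abs_def])
  have "((\<lambda>x. std_normal_density (- x)) \<longlongrightarrow> 0) at_bot"
    by (rule filterlim_compose[OF top filterlim_uminus_at_top_at_bot])
  then show "(std_normal_density \<longlongrightarrow> 0) at_bot"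
    by (simp add: std_normal_density_def[abs_def])
qed

text \<open>The density satisfies $\varphi'(x) = -x\varphi(x)$, so the difference of the two integrands is
  the derivative of $\varphi F$, which vanishes at $\pm\infty$.\<close>

lemma std_normal_ibp:
  fixes F F' :: "real \<Rightarrow> real"
  assumes F: "\<And>x. (F has_real_derivative F' x) (at x)" and F': "\<And>x. isCont F' x"
    and B: "\<And>x. \<bar>F x\<bar> \<le> B" "\<And>x. \<bar>F' x\<bar> \<le> B"
  shows "(\<integral>x. x * F x \<partial>std_normal_distribution) = (\<integral>x. F' x \<partial>std_normal_distribution)"
proof -
  interpret prob_space std_normal_distribution by (rule prob_space_std_normal)
  have cF: "isCont F x" for x using F by (rule DERIV_isCont)
  have [measurable]: "F \<in> borel_measurable borel" "F' \<in> borel_measurable borel"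
    using cF F' by (auto intro!: borel_measurable_continuous_onI continuous_at_imp_continuous_on)
  have i1: "integrable std_normal_distribution F'"
    by (rule integrable_const_bound[where B=B]) (use B in auto)
  have i2: "integrable std_normal_distribution (\<lambda>x. x * F x)"
  proof (rule Bochner_Integration.integrable_bound)
    show "integrable std_normal_distribution (\<lambda>x. B * \<bar>x\<bar>)"
      by (intro integrable_mult_right integrable_std_normal_id)
    show "AE x in std_normal_distribution. norm (x * F x) \<le> norm (B * \<bar>x\<bar>)"
    proof (rule AE_I2)
      fix x show "norm (x * F x) \<le> norm (B * \<bar>x\<bar>)"
        using mult_left_mono[OF B(1)[of x], of "\<bar>x\<bar>"] abs_ge_zero[of "F x"] B(1)[of x]
        by (simp add: abs_mult mult.commute)
    qed
  qed simp
  have l1: "integrable lborel (\<lambda>x. std_normal_density x * F' x)"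
    using i1 by (subst (asm) integrable_density) auto
  have l2: "integrable lborel (\<lambda>x. std_normal_density x * (x * F x))"
    using i2 by (subst (asm) integrable_density) auto
  let ?g = "\<lambda>x. std_normal_density x * F' x - std_normal_density x * (x * F x)"
  have d: "(std_normal_density has_real_derivative - x * std_normal_density x) (at x)" for x
  proof -
    have "((\<lambda>x. 1 / sqrt (2 * pi) * exp (- x\<^sup>2 / 2)) has_real_derivative
        1 / sqrt (2 * pi) * (exp (- x\<^sup>2 / 2) * (- x))) (at x)"
      by (intro DERIV_cmult) (auto intro!: derivative_eq_intros)
    then show ?thesis by (simp add: std_normal_density_def[abs_def] mult_ac)
  qed
  have lim0: "((\<lambda>x. std_normal_density x * F x) \<longlongrightarrow> 0) G" if "(std_normal_density \<longlongrightarrow> 0) G" for G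
  proof (rule tendsto_0_le[OF that, where K=B])
    show "\<forall>\<^sub>F x in G. norm (std_normal_density x * F x) \<le> norm (std_normal_density x) * B"
      using B(1) by (intro always_eventually allI) (simp add: abs_mult mult_left_mono)
  qed
  have "(LBINT x=-\<infinity>..\<infinity>. ?g x) = 0 - 0"
  proof (rule interval_integral_FTC_integrable[where F="\<lambda>x. std_normal_density x * F x"])
    show "((\<lambda>x. std_normal_density x * F x) has_vector_derivative ?g x) (at x)" for x
      unfolding has_real_derivative_iff_has_vector_derivative[symmetric]
      by (auto intro!: derivative_eq_intros d F simp: algebra_simps)
    show "isCont ?g x" for x
      by (intro continuous_intros F' cF) (auto intro: DERIV_isCont d)
    show "set_integrable lborel (einterval (-\<infinity>) \<infinity>) ?g"
      using l1 l2 by (simp add: set_integrable_def)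
    show "(((\<lambda>x. std_normal_density x * F x) \<circ> real_of_ereal) \<longlongrightarrow> 0) (at_right (- \<infinity>))"
      by (simp add: ereal_tendsto_simps lim0 std_normal_density_tendsto_0)
    show "(((\<lambda>x. std_normal_density x * F x) \<circ> real_of_ereal) \<longlongrightarrow> 0) (at_left \<infinity>)"
      by (simp add: ereal_tendsto_simps lim0 std_normal_density_tendsto_0)
  qed simp
  then have "(\<integral>x. ?g x \<partial>lborel) = 0"
    by (simp add: interval_lebesgue_integral_def set_lebesgue_integral_def)
  then show ?thesis
    using l1 l2 by (simp add: integral_density)
qed

abbreviation std_gaussians :: "'e set \<Rightarrow> ('e \<Rightarrow> real) measure" where
  "std_gaussians E \<equiv> Pi\<^sub>M E (\<lambda>_. std_normal_distribution)"

lemma product_prob_space_std_normal: "product_prob_space (\<lambda>_. std_normal_distribution)"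
  by (intro product_prob_spaceI prob_space_std_normal)

lemma prob_space_std_gaussians: "prob_space (std_gaussians E)"
  by (intro prob_space_PiM prob_space_std_normal)

lemma measurable_std_gaussians_component [measurable]:
  "e \<in> E \<Longrightarrow> (\<lambda>x. x e) \<in> borel_measurable (std_gaussians E)"
  using measurable_component_singleton[of e E "\<lambda>_. std_normal_distribution"]
  by (simp add: measurable_def)

lemma integral_std_gaussians_split:
  fixes F :: "('e \<Rightarrow> real) \<Rightarrow> real"
  assumes "finite E" "e \<in> E" "integrable (std_gaussians E) F"
  shows "(\<integral>x. F x \<partial>std_gaussians E)
       = (\<integral>x. (\<integral>y. F (x(e := y)) \<partial>std_normal_distribution) \<partial>std_gaussians (E - {e}))"
proof -
  interpret product_prob_space "\<lambda>_. std_normal_distribution" E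
    by (rule product_prob_space_std_normal)
  show ?thesis
    using product_integral_insert[of "E - {e}" e F] assms by (simp add: insert_absorb)
qed

lemma integrable_std_gaussians_component:
  assumes "e \<in> E"
  shows "integrable (std_gaussians E) (\<lambda>x. \<bar>x e\<bar>)"
proof -
  interpret product_prob_space "\<lambda>_. std_normal_distribution" E
    by (rule product_prob_space_std_normal)
  have "integrable (distr (std_gaussians E) std_normal_distribution (\<lambda>x. x e)) (\<lambda>x. \<bar>x\<bar>)"
    unfolding PiM_component[OF assms] by (rule integrable_std_normal_id)
  then show ?thesis
    using assms by (subst (asm) integrable_distr_eq) auto
qed

lemma integrable_std_gaussians_linear:
  fixes F :: "('e \<Rightarrow> real) \<Rightarrow> real"
  assumes "e \<in> E" and [measurable]: "F \<in> borel_measurable (std_gaussians E)" and B: "\<And>x. \<bar>F x\<bar> \<le> B"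
  shows "integrable (std_gaussians E) (\<lambda>x. x e * F x)"
proof (rule Bochner_Integration.integrable_bound)
  show "integrable (std_gaussians E) (\<lambda>x. B * \<bar>x e\<bar>)"
    by (intro integrable_mult_right integrable_std_gaussians_component assms)
  show "AE x in std_gaussians E. norm (x e * F x) \<le> norm (B * \<bar>x e\<bar>)"
  proof (rule AE_I2)
    fix x :: "'e \<Rightarrow> real"
    show "norm (x e * F x) \<le> norm (B * \<bar>x e\<bar>)"
      using mult_left_mono[OF B[of x], of "\<bar>x e\<bar>"] abs_ge_zero[of "F x"] B[of x]
      by (simp add: abs_mult mult.commute)
  qed
qed (use assms(1) in simp)

lemma integrable_std_gaussians_bounded:
  fixes F :: "('e \<Rightarrow> real) \<Rightarrow> real"
  assumes "F \<in> borel_measurable (std_gaussians E)" "\<And>x. \<bar>F x\<bar> \<le> B"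
  shows "integrable (std_gaussians E) F"
proof -
  interpret prob_space "std_gaussians E" by (rule prob_space_std_gaussians)
  show ?thesis
    by (rule integrable_const_bound[where B=B]) (simp_all add: assms)
qed

text \<open>Fubini in the coordinate \<open>e\<close> reduces this to one variable.\<close>

lemma std_gaussians_ibp:
  fixes F F' :: "('e \<Rightarrow> real) \<Rightarrow> real"
  assumes E: "finite E" "e \<in> E"
    and m: "F \<in> borel_measurable (std_gaussians E)" "F' \<in> borel_measurable (std_gaussians E)"
    and B: "\<And>x. \<bar>F x\<bar> \<le> B" "\<And>x. \<bar>F' x\<bar> \<le> B"
    and d: "\<And>x y. ((\<lambda>y. F (x(e := y))) has_real_derivative F' (x(e := y))) (at y)"
    and c: "\<And>x y. isCont (\<lambda>y. F' (x(e := y))) y"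
  shows "(\<integral>x. x e * F x \<partial>std_gaussians E) = (\<integral>x. F' x \<partial>std_gaussians E)"
proof -
  have ibp: "(\<integral>y. y * F (x(e := y)) \<partial>std_normal_distribution)
      = (\<integral>y. F' (x(e := y)) \<partial>std_normal_distribution)" for x
    by (rule std_normal_ibp[where B=B]) (rule d c B)+
  have "(\<integral>x. x e * F x \<partial>std_gaussians E)
      = (\<integral>x. (\<integral>y. y * F (x(e := y)) \<partial>std_normal_distribution) \<partial>std_gaussians (E - {e}))"
    by (subst integral_std_gaussians_split[OF E integrable_std_gaussians_linear[OF E(2) m(1) B(1)]]) simp
  also have "\<dots> = (\<integral>x. (\<integral>y. F' (x(e := y)) \<partial>std_normal_distribution) \<partial>std_gaussians (E - {e}))"
    by (simp only: ibp)
  also have "\<dots> = (\<integral>x. F' x \<partial>std_gaussians E)"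
    by (rule integral_std_gaussians_split[OF E integrable_std_gaussians_bounded[OF m(2) B(2)], symmetric])
  finally show ?thesis .
qed

text \<open>The mean value theorem bounds the difference quotients by the dominating function of the
  derivatives.\<close>

lemma DERIV_integral_dominated:
  fixes f f' :: "real \<Rightarrow> 'w \<Rightarrow> real"
  assumes f: "\<And>s. integrable M (f s)" and f': "f' s \<in> borel_measurable M"
    and d: "\<And>s w. ((\<lambda>s. f s w) has_real_derivative f' s w) (at s)"
    and g: "integrable M g" "\<And>s w. \<bar>f' s w\<bar> \<le> g w"
  shows "((\<lambda>s. \<integral>w. f s w \<partial>M) has_real_derivative (\<integral>w. f' s w \<partial>M)) (at s)"
  unfolding DERIV_def tendsto_at_iff_sequentially
proof (intro allI impI)
  fix X :: "nat \<Rightarrow> real" assume X0: "\<forall>i. X i \<in> UNIV - {0}" and X: "X \<longlonglongrightarrow> 0"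
  have mf: "f s \<in> borel_measurable M" for s using f by (rule borel_measurable_integrable)
  have "(\<lambda>i. \<integral>w. (f (s + X i) w - f s w) / X i \<partial>M) \<longlonglongrightarrow> (\<integral>w. f' s w \<partial>M)"
  proof (rule integral_dominated_convergence[where w=g])
    show "AE w in M. (\<lambda>i. (f (s + X i) w - f s w) / X i) \<longlonglongrightarrow> f' s w"
    proof (rule AE_I2)
      fix w
      show "(\<lambda>i. (f (s + X i) w - f s w) / X i) \<longlonglongrightarrow> f' s w"
        using d[where s=s and w=w] X0 X unfolding DERIV_def tendsto_at_iff_sequentially
        by (auto simp: comp_def)
    qed
    show "AE w in M. norm ((f (s + X i) w - f s w) / X i) \<le> g w" for i
    proof (rule AE_I2)
      fix w
      have "norm (f (s + X i) w - f s w) \<le> g w * norm (s + X i - s)"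
        using d g(2) by (intro field_differentiable_bound[where S=UNIV and f'="\<lambda>s. f' s w"]) 
          (auto intro: has_field_derivative_at_within)
      then show "norm ((f (s + X i) w - f s w) / X i) \<le> g w"
        using X0 by (auto simp: divide_le_eq abs_mult)
    qed
    show "(\<lambda>w. (f (s + X i) w - f s w) / X i) \<in> borel_measurable M" for i
      by (intro borel_measurable_divide borel_measurable_diff borel_measurable_const mf)
  qed (fact f' g(1))+
  moreover have "(\<integral>w. (f (s + X i) w - f s w) / X i \<partial>M) = ((\<integral>w. f (s + X i) w \<partial>M) - (\<integral>w. f s w \<partial>M)) / X i" for i
    using f by simp
  ultimately show "((\<lambda>h. ((\<integral>w. f (s + h) w \<partial>M) - (\<integral>w. f s w \<partial>M)) / h) \<circ> X) \<longlonglongrightarrow> (\<integral>w. f' s w \<partial>M)"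
    by (simp only: comp_def)
qed

section \<open>Interpolation between Gaussian Hamiltonians\<close>

lemma (in finite_configs) replica_avg_abs_le_sum:
  "\<bar>replica_avg S H n f\<bar> \<le> (\<Sum>\<tau>\<in>{1..n} \<rightarrow>\<^sub>E S. \<bar>f \<tau>\<bar>)"
proof (rule replica_avg_bounded)
  fix \<tau> assume "\<tau> \<in> {1..n} \<rightarrow>\<^sub>E S"
  from member_le_sum[OF this _ finite_replicas, of "\<lambda>\<tau>. \<bar>f \<tau>\<bar>"]
  show "\<bar>f \<tau>\<bar> \<le> (\<Sum>\<tau>\<in>{1..n} \<rightarrow>\<^sub>E S. \<bar>f \<tau>\<bar>)" by simp
qed

text \<open>The sign pattern of \<open>new_replica\<close>, extended by \<open>0\<close>: each old replica counts once, the new one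
  \<open>- n\<close> times.\<close>

definition replica_coeff :: "nat \<Rightarrow> nat \<Rightarrow> real" where
  "replica_coeff n l = (if l \<le> n then 1 else if l = Suc n then - real n else 0)"

text \<open>Two successive additions of a replica. The diagonal is left out because it cancels, as shown
  in \<open>new_replica_twice\<close>.\<close>

definition pair_coeff :: "nat \<Rightarrow> nat \<Rightarrow> nat \<Rightarrow> real" where
  "pair_coeff n l l' = (if l = l' then 0 else replica_coeff n l * replica_coeff (Suc n) l')"

definition pair_interaction :: "nat \<Rightarrow> ('s \<Rightarrow> 's \<Rightarrow> real) \<Rightarrow> (nat \<Rightarrow> 's) \<Rightarrow> real" where
  "pair_interaction n V \<tau> = (\<Sum>l=1..n+2. \<Sum>l'=1..n+2. pair_coeff n l l' * V (\<tau> l) (\<tau> l'))"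

lemma abs_pair_coeff_le: "\<bar>pair_coeff n l l'\<bar> \<le> (real n + 2)\<^sup>2"
proof -
  have r: "\<bar>replica_coeff m j\<bar> \<le> real n + 2" if "m \<le> Suc n" for m j
    using that by (auto simp: replica_coeff_def)
  have "\<bar>replica_coeff n l * replica_coeff (Suc n) l'\<bar> \<le> (real n + 2) * (real n + 2)"
    unfolding abs_mult by (intro mult_mono r) auto
  then show ?thesis by (auto simp: pair_coeff_def power2_eq_square)
qed

context finite_configs
begin

lemma new_replica_coeff:
  "new_replica n u \<tau> = (\<Sum>l=1..Suc n. replica_coeff n l * u (\<tau> l))"
  by (simp add: new_replica_def replica_coeff_def)

lemma new_replica_coeff2:
  "new_replica n u \<tau> = (\<Sum>l=1..n+2. replica_coeff n l * u (\<tau> l))"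
  by (simp add: new_replica_coeff replica_coeff_def)

lemma new_replica_lincomb:
  "new_replica n (\<lambda>\<sigma>. \<Sum>e\<in>E. a e * u e \<sigma>) \<tau> = (\<Sum>e\<in>E. a e * new_replica n (u e) \<tau>)"
  unfolding new_replica_coeff sum_distrib_left
  by (subst sum.swap) (simp only: mult.left_commute)

lemma new_replica_cmult: "new_replica n (\<lambda>\<sigma>. b * u \<sigma>) \<tau> = b * new_replica n u \<tau>"
  unfolding new_replica_coeff sum_distrib_left by (simp only: mult.left_commute)

text \<open>Adding two replicas in succession for an observable of constant square leaves no diagonal
  terms: the \<open>n\<close> terms of the old replicas are cancelled by the one of the first new replica.\<close>

lemma new_replica_twice:
  assumes "\<And>l. 1 \<le> l \<Longrightarrow> l \<le> n + 2 \<Longrightarrow> (u (\<tau> l))\<^sup>2 = 1"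
  shows "new_replica n u \<tau> * new_replica (Suc n) u \<tau> = pair_interaction n (\<lambda>\<sigma> \<sigma>'. u \<sigma> * u \<sigma>') \<tau>"
proof -
  let ?b = replica_coeff
  have "(\<Sum>l=1..n+2. ?b n l * ?b (Suc n) l * (u (\<tau> l))\<^sup>2) = (\<Sum>l=1..n+2. ?b n l * ?b (Suc n) l)"
    using assms by (intro sum.cong) auto
  also have "\<dots> = 0" by (simp add: replica_coeff_def)
  finally have diag: "(\<Sum>l=1..n+2. ?b n l * ?b (Suc n) l * (u (\<tau> l))\<^sup>2) = 0" .
  have "new_replica n u \<tau> * new_replica (Suc n) u \<tau> =
      (\<Sum>l=1..n+2. ?b n l * u (\<tau> l)) * (\<Sum>l=1..n+2. ?b (Suc n) l * u (\<tau> l))"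
    unfolding new_replica_coeff2[of n] new_replica_coeff[of "Suc n"] by simp
  also have "\<dots> = (\<Sum>l=1..n+2. \<Sum>l'=1..n+2. ?b n l * ?b (Suc n) l' * (u (\<tau> l) * u (\<tau> l')))"
    by (simp only: sum_product mult_ac)
  also have "\<dots> = (\<Sum>l=1..n+2. (\<Sum>l'=1..n+2. pair_coeff n l l' * (u (\<tau> l) * u (\<tau> l')))
                       + ?b n l * ?b (Suc n) l * (u (\<tau> l))\<^sup>2)"
  proof (intro sum.cong refl)
    fix l assume l: "l \<in> {1..n+2}"
    have "(\<Sum>l'=1..n+2. ?b n l * ?b (Suc n) l' * (u (\<tau> l) * u (\<tau> l')))
       = (\<Sum>l'=1..n+2. pair_coeff n l l' * (u (\<tau> l) * u (\<tau> l'))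
           + (if l' = l then ?b n l * ?b (Suc n) l * (u (\<tau> l))\<^sup>2 else 0))"
      by (intro sum.cong) (auto simp: pair_coeff_def power2_eq_square)
    then show "(\<Sum>l'=1..n+2. ?b n l * ?b (Suc n) l' * (u (\<tau> l) * u (\<tau> l')))
        = (\<Sum>l'=1..n+2. pair_coeff n l l' * (u (\<tau> l) * u (\<tau> l'))) + ?b n l * ?b (Suc n) l * (u (\<tau> l))\<^sup>2"
      using l by (simp add: sum.distrib)
  qed
  also have "\<dots> = pair_interaction n (\<lambda>\<sigma> \<sigma>'. u \<sigma> * u \<sigma>') \<tau>"
    unfolding sum.distrib diag pair_interaction_def by simp
  finally show ?thesis .
qed

lemma uses_replicas_pair_interaction:
  "uses_replicas n f \<Longrightarrow> uses_replicas (n + 2) (\<lambda>\<tau>. f \<tau> * pair_interaction m V \<tau>)" if "m \<le> n"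
proof -
  assume "uses_replicas n f"
  then have "uses_replicas (n + 2) f" by (rule uses_replicas_mono) simp
  then show ?thesis
    unfolding pair_interaction_def using \<open>m \<le> n\<close>
    by (intro uses_replicas_mult uses_replicas_sum uses_replicas_const uses_replicas_at2[where F=V]) auto
qed

end

text \<open>A random Hamiltonian that is linear in independent standard Gaussians \<open>x e\<close>: the term of \<open>e\<close> is
  \<open>a e * x e * k e \<sigma>\<close> with a monomial \<open>k e\<close> of square one, and \<open>c\<close> is deterministic. The amplitudes
  \<open>a\<close> are arguments of the averages, because they move along the interpolation.\<close>

locale gaussian_gibbs = finite_configs S for S :: "'s set" +
  fixes E :: "'e set" and k :: "'e \<Rightarrow> 's \<Rightarrow> real" and c :: "'s \<Rightarrow> real"
  assumes finite_E: "finite E" and k_square: "\<And>e \<sigma>. e \<in> E \<Longrightarrow> \<sigma> \<in> S \<Longrightarrow> (k e \<sigma>)\<^sup>2 = 1"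
begin

definition energy :: "('e \<Rightarrow> real) \<Rightarrow> ('e \<Rightarrow> real) \<Rightarrow> 's \<Rightarrow> real" where
  "energy a x \<sigma> = c \<sigma> + (\<Sum>e\<in>E. a e * x e * k e \<sigma>)"

definition quenched :: "('e \<Rightarrow> real) \<Rightarrow> nat \<Rightarrow> ((nat \<Rightarrow> 's) \<Rightarrow> real) \<Rightarrow> real" where
  "quenched a n f = (\<integral>x. replica_avg S (energy a x) n f \<partial>std_gaussians E)"

lemma measurable_replica_avg:
  "(\<lambda>x. replica_avg S (energy a x) n f) \<in> borel_measurable (std_gaussians E)"
  unfolding replica_avg_def energy_def by measurable

lemma integrable_replica_avg:
  "integrable (std_gaussians E) (\<lambda>x. replica_avg S (energy a x) n f)"
  by (rule integrable_std_gaussians_bounded[OF measurable_replica_avg replica_avg_abs_le_sum])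

lemma quenched_cong:
  "(\<And>\<tau>. \<tau> \<in> {1..n} \<rightarrow>\<^sub>E S \<Longrightarrow> f \<tau> = g \<tau>) \<Longrightarrow> quenched a n f = quenched a n g"
  unfolding quenched_def using replica_avg_cong[of n S f g] by simp

lemma quenched_add: "quenched a n (\<lambda>\<tau>. f \<tau> + g \<tau>) = quenched a n f + quenched a n g"
  unfolding quenched_def by (simp add: replica_avg_add integrable_replica_avg)

lemma quenched_diff: "quenched a n (\<lambda>\<tau>. f \<tau> - g \<tau>) = quenched a n f - quenched a n g"
  unfolding quenched_def by (simp add: replica_avg_diff integrable_replica_avg)

lemma quenched_cmult: "quenched a n (\<lambda>\<tau>. b * f \<tau>) = b * quenched a n f"
  unfolding quenched_def by (simp add: replica_avg_cmult)

lemma quenched_sum: "quenched a n (\<lambda>\<tau>. \<Sum>j\<in>J. f j \<tau>) = (\<Sum>j\<in>J. quenched a n (f j))"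
  unfolding quenched_def by (simp add: replica_avg_sum integrable_replica_avg)

lemma quenched_mono:
  "(\<And>\<tau>. \<tau> \<in> {1..n} \<rightarrow>\<^sub>E S \<Longrightarrow> f \<tau> \<le> g \<tau>) \<Longrightarrow> quenched a n f \<le> quenched a n g"
  unfolding quenched_def
  by (rule integral_mono[OF integrable_replica_avg integrable_replica_avg]) (rule replica_avg_mono)

lemma quenched_abs_le: "\<bar>quenched a n f\<bar> \<le> quenched a n (\<lambda>\<tau>. \<bar>f \<tau>\<bar>)"
  using quenched_mono[of n f "\<lambda>\<tau>. \<bar>f \<tau>\<bar>" a] quenched_mono[of n "\<lambda>\<tau>. - f \<tau>" "\<lambda>\<tau>. \<bar>f \<tau>\<bar>" a]
    quenched_cmult[of a n "-1" f] by (simp add: abs_le_iff)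

lemma quenched_more: "uses_replicas n f \<Longrightarrow> n \<le> n' \<Longrightarrow> quenched a n' f = quenched a n f"
  unfolding quenched_def by (simp add: replica_avg_more[of n f n'])

lemma quenched_const: "quenched a n (\<lambda>_. b) = b"
proof -
  interpret prob_space "std_gaussians E" by (rule prob_space_std_gaussians)
  show ?thesis unfolding quenched_def by (simp add: replica_avg_const prob_space)
qed

lemma quenched_rename:
  "uses_replicas m f \<Longrightarrow> inj_on h {1..m} \<Longrightarrow> h ` {1..m} \<subseteq> {1..n} \<Longrightarrow> m \<le> n \<Longrightarrow>
   quenched a n (\<lambda>\<tau>. f (\<lambda>l. \<tau> (h l))) = quenched a n f"
  unfolding quenched_def by (simp add: replica_avg_rename[of m f h n])

lemma quenched_ibp:
  assumes f: "uses_replicas n f" and e: "e \<in> E"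
  shows "(\<integral>x. x e * replica_avg S (energy a x) n f \<partial>std_gaussians E)
       = a e * quenched a (Suc n) (\<lambda>\<tau>. f \<tau> * new_replica n (k e) \<tau>)"
proof -
  let ?F = "\<lambda>x. replica_avg S (energy a x) n f"
  let ?g = "\<lambda>\<tau>. f \<tau> * new_replica n (k e) \<tau>"
  let ?F' = "\<lambda>x. a e * replica_avg S (energy a x) (Suc n) ?g"
  have energy: "((\<lambda>y. energy a (x(e := y)) \<sigma>) has_real_derivative a e * k e \<sigma>) (at y)" for x y \<sigma>
  proof -
    have "energy a (x(e := y)) \<sigma> = (c \<sigma> + (\<Sum>e\<in>E-{e}. a e * x e * k e \<sigma>)) + a e * y * k e \<sigma>" for y
      unfolding energy_def using finite_E e by (simp add: sum.remove[of E e])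
    then show ?thesis by (auto intro!: derivative_eq_intros)
  qed
  have d: "((\<lambda>y. replica_avg S (energy a (x(e := y))) m g) has_real_derivative
      a e * replica_avg S (energy a (x(e := y))) (Suc m) (\<lambda>\<tau>. g \<tau> * new_replica m (k e) \<tau>)) (at y)"
    if "uses_replicas m g" for m g x y
    using DERIV_replica_avg[OF that, of "\<lambda>y. energy a (x(e := y))", OF energy]
    by (simp add: new_replica_cmult mult.left_commute replica_avg_cmult)
  define B where "B = (\<Sum>\<tau>\<in>{1..n} \<rightarrow>\<^sub>E S. \<bar>f \<tau>\<bar>) + \<bar>a e\<bar> * (\<Sum>\<tau>\<in>{1..Suc n} \<rightarrow>\<^sub>E S. \<bar>?g \<tau>\<bar>)"
  have "(\<integral>x. x e * ?F x \<partial>std_gaussians E) = (\<integral>x. ?F' x \<partial>std_gaussians E)"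
  proof (rule std_gaussians_ibp[OF finite_E e, where B=B])
    show "\<bar>?F x\<bar> \<le> B" for x
      unfolding B_def by (intro order_trans[OF replica_avg_abs_le_sum] add_increasing2) (auto intro!: mult_nonneg_nonneg sum_nonneg)
    show "\<bar>?F' x\<bar> \<le> B" for x
      unfolding B_def abs_mult[of "a e"]
      by (intro add_increasing mult_left_mono replica_avg_abs_le_sum) (auto intro!: sum_nonneg)
    show "isCont (\<lambda>y. ?F' (x(e := y))) y" for x y
      by (intro isCont_mult continuous_const DERIV_isCont[OF d] uses_replicas_new_replica f)
    show "(\<lambda>x. ?F' x) \<in> borel_measurable (std_gaussians E)"
      by (intro borel_measurable_times borel_measurable_const measurable_replica_avg)
  qed (fact measurable_replica_avg d[OF f])+
  then show ?thesis by (simp add: quenched_def)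
qed

text \<open>The \<open>s\<close>-derivative of the Hamiltonian is again linear in the Gaussians, with amplitudes
  \<open>a' s e\<close>; integrating the factor \<open>x e\<close> by parts gives \<open>a s e\<close> and a second new replica. Only the
  derivative of the covariance of the Hamiltonian remains.\<close>

theorem DERIV_quenched:
  assumes f: "uses_replicas n f"
    and a: "\<And>s e. e \<in> E \<Longrightarrow> ((\<lambda>s. a s e) has_real_derivative a' s e) (at s)"
    and A: "\<And>s e. e \<in> E \<Longrightarrow> \<bar>a' s e\<bar> \<le> A"
  shows "((\<lambda>s. quenched (a s) n f) has_real_derivative
     quenched (a s) (n + 2)
       (\<lambda>\<tau>. f \<tau> * pair_interaction n (\<lambda>\<sigma> \<sigma>'. \<Sum>e\<in>E. a s e * a' s e * (k e \<sigma> * k e \<sigma>')) \<tau>)) (at s)"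
proof -
  let ?g = "\<lambda>e \<tau>. f \<tau> * new_replica n (k e) \<tau>"
  let ?F' = "\<lambda>s x. \<Sum>e\<in>E. a' s e * (x e * replica_avg S (energy (a s) x) (Suc n) (?g e))"
  have g: "uses_replicas (Suc n) (?g e)" for e by (rule uses_replicas_new_replica[OF f])
  have "((\<lambda>s. energy (a s) x \<sigma>) has_real_derivative (\<Sum>e\<in>E. a' s e * x e * k e \<sigma>)) (at s)" for s x \<sigma>
    unfolding energy_def by (auto intro!: derivative_eq_intros a)
  from DERIV_replica_avg[OF f, of "\<lambda>s. energy (a s) _", OF this]
  have d: "((\<lambda>s. replica_avg S (energy (a s) x) n f) has_real_derivative ?F' s x) (at s)" for s x
    by (simp only: new_replica_lincomb sum_distrib_left mult.left_commute[of "f _"] replica_avg_sum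
        replica_avg_cmult) (simp only: mult.assoc)
  have "((\<lambda>s. quenched (a s) n f) has_real_derivative (\<integral>x. ?F' s x \<partial>std_gaussians E)) (at s)"
    unfolding quenched_def
  proof (rule DERIV_integral_dominated)
    let ?B = "\<lambda>e. \<Sum>\<tau>\<in>{1..Suc n} \<rightarrow>\<^sub>E S. \<bar>?g e \<tau>\<bar>"
    \<comment> \<open>The derivative is a sum of terms linear in one Gaussian with bounded factors.\<close>
    show "integrable (std_gaussians E) (\<lambda>x. \<Sum>e\<in>E. A * (\<bar>x e\<bar> * ?B e))"
      by (intro Bochner_Integration.integrable_sum integrable_mult_right integrable_mult_left
          integrable_std_gaussians_component)
    show "\<bar>?F' s x\<bar> \<le> (\<Sum>e\<in>E. A * (\<bar>x e\<bar> * ?B e))" for s x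
    proof (intro order_trans[OF sum_abs] sum_mono)
      fix e assume e: "e \<in> E"
      show "\<bar>a' s e * (x e * replica_avg S (energy (a s) x) (Suc n) (?g e))\<bar> \<le> A * (\<bar>x e\<bar> * ?B e)"
        unfolding abs_mult[of "a' s e"] abs_mult[of "x e"]
        by (intro mult_mono A[OF e] replica_avg_abs_le_sum order_refl mult_nonneg_nonneg abs_ge_zero
            order_trans[OF abs_ge_zero A[OF e]])
    qed
    show "?F' s \<in> borel_measurable (std_gaussians E)"
      by (intro borel_measurable_sum borel_measurable_times borel_measurable_const measurable_replica_avg
          measurable_std_gaussians_component)
  qed (fact integrable_replica_avg d)+
  also have "(\<integral>x. ?F' s x \<partial>std_gaussians E)
      = (\<Sum>e\<in>E. a' s e * (\<integral>x. x e * replica_avg S (energy (a s) x) (Suc n) (?g e) \<partial>std_gaussians E))"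
    by (subst Bochner_Integration.integral_sum)
      (auto intro!: integrable_mult_right integrable_std_gaussians_linear measurable_replica_avg
         replica_avg_abs_le_sum)
  also have "\<dots> = (\<Sum>e\<in>E. a s e * a' s e *
      quenched (a s) (n + 2) (\<lambda>\<tau>. f \<tau> * pair_interaction n (\<lambda>\<sigma> \<sigma>'. k e \<sigma> * k e \<sigma>') \<tau>))"
  proof (intro sum.cong refl)
    fix e assume e: "e \<in> E"
    have "quenched (a s) (Suc (Suc n)) (\<lambda>\<tau>. ?g e \<tau> * new_replica (Suc n) (k e) \<tau>)
        = quenched (a s) (n + 2) (\<lambda>\<tau>. f \<tau> * pair_interaction n (\<lambda>\<sigma> \<sigma>'. k e \<sigma> * k e \<sigma>') \<tau>)"
      unfolding add_2_eq_Suc'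
    proof (rule quenched_cong)
      fix \<tau> assume t: "\<tau> \<in> {1..Suc (Suc n)} \<rightarrow>\<^sub>E S"
      have "(k e (\<tau> l))\<^sup>2 = 1" if "1 \<le> l" "l \<le> n + 2" for l
        using t that by (intro k_square e) (auto simp: PiE_iff)
      then show "?g e \<tau> * new_replica (Suc n) (k e) \<tau> = f \<tau> * pair_interaction n (\<lambda>\<sigma> \<sigma>'. k e \<sigma> * k e \<sigma>') \<tau>"
        using new_replica_twice[of n "k e" \<tau>] by (simp add: mult.assoc)
    qed
    then show "a' s e * (\<integral>x. x e * replica_avg S (energy (a s) x) (Suc n) (?g e) \<partial>std_gaussians E)
      = a s e * a' s e * quenched (a s) (n + 2) (\<lambda>\<tau>. f \<tau> * pair_interaction n (\<lambda>\<sigma> \<sigma>'. k e \<sigma> * k e \<sigma>') \<tau>)"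
      by (simp add: quenched_ibp[OF g e])
  qed
  also have "\<dots> = quenched (a s) (n + 2)
      (\<lambda>\<tau>. \<Sum>e\<in>E. a s e * a' s e * (f \<tau> * pair_interaction n (\<lambda>\<sigma> \<sigma>'. k e \<sigma> * k e \<sigma>') \<tau>))"
    by (simp add: quenched_sum quenched_cmult)
  also have "(\<lambda>\<tau>. \<Sum>e\<in>E. a s e * a' s e * (f \<tau> * pair_interaction n (\<lambda>\<sigma> \<sigma>'. k e \<sigma> * k e \<sigma>') \<tau>))
     = (\<lambda>\<tau>. f \<tau> * pair_interaction n (\<lambda>\<sigma> \<sigma>'. \<Sum>e\<in>E. a s e * a' s e * (k e \<sigma> * k e \<sigma>')) \<tau>)"
  proof
    fix \<tau>
    have "pair_interaction n (\<lambda>\<sigma> \<sigma>'. \<Sum>e\<in>E. a s e * a' s e * (k e \<sigma> * k e \<sigma>')) \<tau>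
       = (\<Sum>l=1..n+2. \<Sum>l'=1..n+2. \<Sum>e\<in>E. a s e * a' s e * (pair_coeff n l l' * (k e (\<tau> l) * k e (\<tau> l'))))"
      by (simp add: pair_interaction_def sum_distrib_left mult_ac)
    also have "\<dots> = (\<Sum>l=1..n+2. \<Sum>e\<in>E. \<Sum>l'=1..n+2. a s e * a' s e * (pair_coeff n l l' * (k e (\<tau> l) * k e (\<tau> l'))))"
      by (intro sum.cong refl sum.swap)
    also have "\<dots> = (\<Sum>e\<in>E. \<Sum>l=1..n+2. \<Sum>l'=1..n+2. a s e * a' s e * (pair_coeff n l l' * (k e (\<tau> l) * k e (\<tau> l'))))"
      by (rule sum.swap)
    also have "\<dots> = (\<Sum>e\<in>E. a s e * a' s e * pair_interaction n (\<lambda>\<sigma> \<sigma>'. k e \<sigma> * k e \<sigma>') \<tau>)"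
      by (simp only: pair_interaction_def sum_distrib_left)
    finally show "(\<Sum>e\<in>E. a s e * a' s e * (f \<tau> * pair_interaction n (\<lambda>\<sigma> \<sigma>'. k e \<sigma> * k e \<sigma>') \<tau>))
       = f \<tau> * pair_interaction n (\<lambda>\<sigma> \<sigma>'. \<Sum>e\<in>E. a s e * a' s e * (k e \<sigma> * k e \<sigma>')) \<tau>"
      by (simp add: sum_distrib_left mult_ac)
  qed
  finally show ?thesis .
qed

end


text \<open>The angle parametrisation makes the amplitudes of a square-root interpolation smooth at both
  ends: with \<open>t = (sin \<theta>)\<^sup>2\<close> the covariance is affine in \<open>t\<close> and \<open>V\<close> is its \<open>t\<close>-derivative.\<close>

locale gaussian_path = gaussian_gibbs S E k c
  for S :: "'s set" and E :: "'e set" and k c +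
  fixes a a' :: "real \<Rightarrow> 'e \<Rightarrow> real" and A v :: real and V :: "'s \<Rightarrow> 's \<Rightarrow> real"
  assumes DERIV_a: "\<And>\<theta> e. e \<in> E \<Longrightarrow> ((\<lambda>\<theta>. a \<theta> e) has_real_derivative a' \<theta> e) (at \<theta>)"
    and a'_bound: "\<And>\<theta> e. e \<in> E \<Longrightarrow> \<bar>a' \<theta> e\<bar> \<le> A"
    and covariance: "\<And>\<theta> \<sigma> \<sigma>'. \<sigma> \<in> S \<Longrightarrow> \<sigma>' \<in> S \<Longrightarrow>
      (\<Sum>e\<in>E. a \<theta> e * a' \<theta> e * (k e \<sigma> * k e \<sigma>')) = sin \<theta> * cos \<theta> * V \<sigma> \<sigma>'"
    and V_bound: "\<And>\<sigma> \<sigma>'. \<sigma> \<in> S \<Longrightarrow> \<sigma>' \<in> S \<Longrightarrow> \<bar>V \<sigma> \<sigma>'\<bar> \<le> v"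
    and v_nonneg: "0 \<le> v"
begin

abbreviation \<open>\<phi> n f \<theta> \<equiv> quenched (a \<theta>) n f\<close>
abbreviation \<open>J n \<equiv> pair_interaction n V\<close>

lemma DERIV_path:
  assumes "uses_replicas n f"
  shows "((\<phi> n f) has_real_derivative sin \<theta> * cos \<theta> * \<phi> (n + 2) (\<lambda>\<tau>. f \<tau> * J n \<tau>) \<theta>) (at \<theta>)"
proof -
  have "quenched (a \<theta>) (n + 2)
       (\<lambda>\<tau>. f \<tau> * pair_interaction n (\<lambda>\<sigma> \<sigma>'. \<Sum>e\<in>E. a \<theta> e * a' \<theta> e * (k e \<sigma> * k e \<sigma>')) \<tau>)
      = quenched (a \<theta>) (n + 2) (\<lambda>\<tau>. (sin \<theta> * cos \<theta>) * (f \<tau> * J n \<tau>))"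
  proof (rule quenched_cong)
    fix \<tau> assume t: "\<tau> \<in> {1..n + 2} \<rightarrow>\<^sub>E S"
    have "pair_interaction n (\<lambda>\<sigma> \<sigma>'. \<Sum>e\<in>E. a \<theta> e * a' \<theta> e * (k e \<sigma> * k e \<sigma>')) \<tau>
        = (\<Sum>l=1..n+2. \<Sum>l'=1..n+2. pair_coeff n l l' * (sin \<theta> * cos \<theta> * V (\<tau> l) (\<tau> l')))"
      unfolding pair_interaction_def using t
      by (intro sum.cong refl arg_cong2[where f="(*)"] covariance) (auto simp: PiE_iff)
    also have "\<dots> = sin \<theta> * cos \<theta> * J n \<tau>"
      unfolding pair_interaction_def sum_distrib_left by (simp only: mult.left_commute[of "pair_coeff _ _ _"])
    finally show "f \<tau> * pair_interaction n (\<lambda>\<sigma> \<sigma>'. \<Sum>e\<in>E. a \<theta> e * a' \<theta> e * (k e \<sigma> * k e \<sigma>')) \<tau>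
      = (sin \<theta> * cos \<theta>) * (f \<tau> * J n \<tau>)" by simp
  qed
  then show ?thesis
    using DERIV_quenched[OF assms, of a a' A \<theta>, OF DERIV_a a'_bound] by (simp only: quenched_cmult)
qed

definition J_bound :: "nat \<Rightarrow> real" where
  "J_bound n = v * (real n + 2) ^ 4"

lemma J_bound_nonneg: "0 \<le> J_bound n"
  by (simp add: J_bound_def v_nonneg)

lemma abs_J_le:
  assumes "\<tau> \<in> {1..n + 2} \<rightarrow>\<^sub>E S"
  shows "\<bar>J n \<tau>\<bar> \<le> J_bound n"
proof -
  have "\<bar>J n \<tau>\<bar> \<le> (\<Sum>l=1..n+2. \<Sum>l'=1..n+2. (real n + 2)\<^sup>2 * v)"
    unfolding pair_interaction_def
  proof (intro order_trans[OF sum_abs] sum_mono)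
    fix l l' assume "l \<in> {1..n+2}" "l' \<in> {1..n+2}"
    then show "\<bar>pair_coeff n l l' * V (\<tau> l) (\<tau> l')\<bar> \<le> (real n + 2)\<^sup>2 * v"
      unfolding abs_mult using assms
      by (intro mult_mono abs_pair_coeff_le V_bound) (auto simp: PiE_iff)
  qed
  also have "\<dots> = J_bound n"
    by (simp add: J_bound_def power2_eq_square power4_eq_xxxx algebra_simps)
  finally show ?thesis .
qed

lemma abs_sin_cos_le: "\<bar>sin \<theta> * cos \<theta>\<bar> \<le> (1::real)"
  using mult_mono[OF abs_sin_le_one[of \<theta>] abs_cos_le_one[of \<theta>]] by (simp add: abs_mult)

text \<open>Along the path the average of a non-negative function satisfies a linear differential
  inequality, so it changes by at most a constant factor.\<close>

lemma path_le_endpoint: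
  assumes f: "uses_replicas n f" and pos: "\<And>\<tau>. \<tau> \<in> {1..n} \<rightarrow>\<^sub>E S \<Longrightarrow> 0 \<le> f \<tau>"
    and t: "0 \<le> \<theta>" "\<theta> \<le> pi / 2"
  shows "\<phi> n f \<theta> \<le> exp (2 * J_bound n) * \<phi> n f (pi / 2)"
proof -
  let ?K = "J_bound n"
  have nonneg: "0 \<le> \<phi> n f \<theta>" for \<theta>
    using quenched_mono[of n "\<lambda>_. 0" f "a \<theta>", OF pos] by (simp add: quenched_const)
  have "\<bar>\<phi> (n + 2) (\<lambda>\<tau>. f \<tau> * J n \<tau>) \<theta>\<bar> \<le> \<phi> (n + 2) (\<lambda>\<tau>. ?K * f \<tau>) \<theta>" for \<theta>
  proof (rule order_trans[OF quenched_abs_le quenched_mono])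
    fix \<tau> assume t: "\<tau> \<in> {1..n + 2} \<rightarrow>\<^sub>E S"
    have "f \<tau> = f (restrict \<tau> {1..n})" by (rule uses_replicasD[OF f]) auto
    moreover have "0 \<le> f (restrict \<tau> {1..n})" using t by (intro pos) (auto simp: PiE_iff)
    ultimately show "\<bar>f \<tau> * J n \<tau>\<bar> \<le> ?K * f \<tau>"
      using mult_left_mono[OF abs_J_le[OF t], of "f \<tau>"] by (simp add: abs_mult mult.commute)
  qed
  moreover have "\<phi> (n + 2) (\<lambda>\<tau>. ?K * f \<tau>) \<theta> = ?K * \<phi> n f \<theta>" for \<theta>
    by (simp only: quenched_cmult quenched_more[OF f le_add1])
  ultimately have J: "\<bar>\<phi> (n + 2) (\<lambda>\<tau>. f \<tau> * J n \<tau>) \<theta>\<bar> \<le> ?K * \<phi> n f \<theta>" for \<theta> by simp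
  have "exp (?K * \<theta>) * \<phi> n f \<theta> \<le> exp (?K * (pi / 2)) * \<phi> n f (pi / 2)"
  proof (rule DERIV_nonneg_imp_nondecreasing[OF t(2)])
    fix s :: real
    let ?d = "sin s * cos s * \<phi> (n + 2) (\<lambda>\<tau>. f \<tau> * J n \<tau>) s"
    have "((\<lambda>s. exp (?K * s) * \<phi> n f s) has_real_derivative
        exp (?K * s) * (?K * \<phi> n f s + ?d)) (at s)"
      by (rule derivative_eq_intros DERIV_path[OF f] refl)+ (simp add: algebra_simps)
    moreover have "\<bar>?d\<bar> \<le> 1 * (?K * \<phi> n f s)"
      unfolding abs_mult[of "sin s * cos s"] by (intro mult_mono abs_sin_cos_le J) auto
    then have "0 \<le> exp (?K * s) * (?K * \<phi> n f s + ?d)" by (intro mult_nonneg_nonneg) auto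
    ultimately show "\<exists>y. ((\<lambda>s. exp (?K * s) * \<phi> n f s) has_real_derivative y) (at s) \<and> 0 \<le> y"
      by blast
  qed
  moreover have "\<phi> n f \<theta> \<le> exp (?K * \<theta>) * \<phi> n f \<theta>"
    using mult_right_mono[of 1 "exp (?K * \<theta>)" "\<phi> n f \<theta>"] nonneg[of \<theta>] J_bound_nonneg[of n] t by simp
  moreover have "exp (?K * (pi / 2)) * \<phi> n f (pi / 2) \<le> exp (2 * ?K) * \<phi> n f (pi / 2)"
    using mult_left_mono[of "pi / 2" 2 ?K] pi_less_4 J_bound_nonneg[of n]
    by (intro mult_right_mono nonneg) (simp add: mult.commute)
  ultimately show ?thesis by linarith
qed

text \<open>Mean value theorem, with the derivative moved to the end of the path by \<open>path_le_endpoint\<close>.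
  The numerical constants use only \<open>pi / 2 \<le> 2\<close>.\<close>

lemma path_first_order:
  assumes f: "uses_replicas n f" and t: "0 \<le> \<theta>" "\<theta> \<le> pi / 2"
  shows "\<bar>\<phi> n f \<theta> - \<phi> n f 0\<bar>
    \<le> 2 * exp (2 * J_bound (n + 2)) * \<phi> (n + 2) (\<lambda>\<tau>. \<bar>f \<tau> * J n \<tau>\<bar>) (pi / 2)"
proof -
  let ?B = "exp (2 * J_bound (n + 2)) * \<phi> (n + 2) (\<lambda>\<tau>. \<bar>f \<tau> * J n \<tau>\<bar>) (pi / 2)"
  have u: "uses_replicas (n + 2) (\<lambda>\<tau>. \<bar>f \<tau> * J n \<tau>\<bar>)"
    using uses_replicas_pair_interaction[OF order_refl f, of V] unfolding uses_replicas_def by metis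
  have b: "\<bar>\<phi> (n + 2) (\<lambda>\<tau>. f \<tau> * J n \<tau>) s\<bar> \<le> ?B" if "0 \<le> s" "s \<le> pi / 2" for s
    using that by (intro order_trans[OF quenched_abs_le] path_le_endpoint[OF u]) auto
  show ?thesis
  proof (cases "\<theta> = 0")
    case True
    then show ?thesis
      using b[of 0] by (simp add: order_trans[OF abs_ge_zero b[of 0]])
  next
    case False
    then obtain z where z: "0 < z" "z < \<theta>" "\<phi> n f \<theta> - \<phi> n f 0 =
        (\<theta> - 0) * (sin z * cos z * \<phi> (n + 2) (\<lambda>\<tau>. f \<tau> * J n \<tau>) z)"
      using MVT2[of 0 \<theta> "\<phi> n f", OF _ DERIV_path[OF f]] t by auto
    have "\<bar>\<phi> n f \<theta> - \<phi> n f 0\<bar> \<le> 2 * (1 * ?B)"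
      unfolding z(3) abs_mult[of "\<theta> - 0"] abs_mult[of "sin z * cos z"]
      using z t pi_less_4 by (intro mult_mono abs_sin_cos_le b) auto
    then show ?thesis by simp
  qed
qed

text \<open>The first-order coefficient is \<open>1 / 2\<close>, the integral of \<open>sin \<theta> * cos \<theta>\<close> over the path. The
  remainder is the mean value theorem for the average minus \<open>(sin \<theta>)\<^sup>2 / 2\<close> times its first-order term,
  whose derivative is controlled by \<open>path_first_order\<close>.\<close>

lemma path_second_order:
  assumes f: "uses_replicas n f"
  shows "\<bar>\<phi> n f (pi / 2) - (\<phi> n f 0 + 1 / 2 * \<phi> (n + 2) (\<lambda>\<tau>. f \<tau> * J n \<tau>) 0)\<bar>
    \<le> 4 * exp (2 * J_bound (n + 4)) * \<phi> (n + 4) (\<lambda>\<tau>. \<bar>f \<tau> * J n \<tau> * J (n + 2) \<tau>\<bar>) (pi / 2)"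
proof -
  let ?g = "\<lambda>\<tau>. f \<tau> * J n \<tau>"
  let ?B = "2 * exp (2 * J_bound (n + 4)) * \<phi> (n + 4) (\<lambda>\<tau>. \<bar>f \<tau> * J n \<tau> * J (n + 2) \<tau>\<bar>) (pi / 2)"
  let ?F = "\<lambda>s. \<phi> n f s - (sin s)\<^sup>2 / 2 * \<phi> (n + 2) ?g 0"
  have sin2: "((\<lambda>s. (sin s)\<^sup>2 / 2 * C) has_real_derivative sin s * cos s * C) (at s)" for s C :: real
    by (auto intro!: derivative_eq_intros)
  have d: "(?F has_real_derivative sin s * cos s * (\<phi> (n + 2) ?g s - \<phi> (n + 2) ?g 0)) (at s)" for s
    unfolding right_diff_distrib by (rule DERIV_diff[OF DERIV_path[OF f] sin2])
  have u: "uses_replicas (n + 2) ?g" by (rule uses_replicas_pair_interaction[OF order_refl f])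
  have b: "\<bar>\<phi> (n + 2) ?g s - \<phi> (n + 2) ?g 0\<bar> \<le> ?B" if "0 \<le> s" "s \<le> pi / 2" for s
    using path_first_order[OF u that] by (simp add: numeral_eq_Suc)
  obtain z where z: "0 < z" "z < pi / 2" "?F (pi / 2) - ?F 0 =
      (pi / 2 - 0) * (sin z * cos z * (\<phi> (n + 2) ?g z - \<phi> (n + 2) ?g 0))"
    using MVT2[of 0 "pi / 2" ?F, OF _ d] by auto
  have "\<bar>?F (pi / 2) - ?F 0\<bar> \<le> 2 * (1 * ?B)"
    unfolding z(3) abs_mult[of "pi / 2 - 0"] abs_mult[of "sin z * cos z"]
    using z pi_less_4 by (intro mult_mono abs_sin_cos_le b) auto
  then show ?thesis by (simp add: algebra_simps)
qed

end

section \<open>A free spin in a Gaussian field\<close>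

text \<open>Flipping the spin \<open>\<epsilon>\<close> in one replica changes its weight by the factor
  $e^{-2Y\varepsilon}$, and $e^{Y\varepsilon}(\varepsilon - \tanh Y)$ is odd in $\varepsilon$. So
  the contributions of a configuration and of its flip to the average of
  $(\varepsilon - \tanh Y) f$ cancel.\<close>

lemma (in finite_configs) replica_avg_flip:
  assumes flip: "\<And>\<sigma>. \<sigma> \<in> S \<Longrightarrow> flip \<sigma> \<in> S" "\<And>\<sigma>. flip (flip \<sigma>) = \<sigma>"
    and \<epsilon>: "\<And>\<sigma>. \<sigma> \<in> S \<Longrightarrow> \<epsilon> \<sigma> = 1 \<or> \<epsilon> \<sigma> = - 1" "\<And>\<sigma>. \<epsilon> (flip \<sigma>) = - \<epsilon> \<sigma>"
    and H: "\<And>\<sigma>. \<sigma> \<in> S \<Longrightarrow> H (flip \<sigma>) = H \<sigma> - 2 * Y * \<epsilon> \<sigma>"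
    and l: "l \<in> {1..n}" and f: "\<And>\<tau>. f (\<tau>(l := flip (\<tau> l))) = f \<tau>"
  shows "replica_avg S H n (\<lambda>\<tau>. \<epsilon> (\<tau> l) * f \<tau>) = tanh Y * replica_avg S H n f"
proof -
  let ?w = "\<lambda>\<sigma>. exp (H \<sigma>) / (\<Sum>\<sigma>\<in>S. exp (H \<sigma>))"
  let ?F = "\<lambda>\<tau>. (\<Prod>j=1..n. ?w (\<tau> j)) * ((\<epsilon> (\<tau> l) - tanh Y) * f \<tau>)"
  let ?i = "\<lambda>\<tau>. \<tau>(l := flip (\<tau> l))"
  have one: "exp (- 2 * Y * e) * (- e - tanh Y) = - (e - tanh Y)" if "e = 1 \<or> e = - 1" for e :: real
  proof -
    have D: "exp Y + exp (- Y) > 0" by (simp add: add_pos_pos)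
    have p: "1 + tanh Y = 2 * exp Y / (exp Y + exp (- Y))" "1 - tanh Y = 2 * exp (- Y) / (exp Y + exp (- Y))"
      using D by (simp_all add: tanh_altdef field_simps)
    have q: "exp (- 2 * Y) * exp Y = exp (- Y)" "exp (2 * Y) * exp (- Y) = exp Y"
      by (simp_all add: exp_add[symmetric])
    have "exp (- 2 * Y) * (1 + tanh Y) = 1 - tanh Y" "exp (2 * Y) * (1 - tanh Y) = 1 + tanh Y"
      unfolding p using q by (simp_all add: field_simps)
    then show ?thesis using that by (auto simp: algebra_simps)
  qed
  have odd: "?F (?i \<tau>) = - ?F \<tau>" if t: "\<tau> \<in> {1..n} \<rightarrow>\<^sub>E S" for \<tau>
  proof -
    have tl: "\<tau> l \<in> S" using t l by (auto simp: PiE_iff)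
    have w: "?w (flip (\<tau> l)) * (- \<epsilon> (\<tau> l) - tanh Y) = - (?w (\<tau> l) * (\<epsilon> (\<tau> l) - tanh Y))"
    proof -
      have "exp (H (flip (\<tau> l))) = exp (H (\<tau> l)) * exp (- 2 * Y * \<epsilon> (\<tau> l))"
        unfolding H[OF tl] by (simp add: exp_add[symmetric])
      then show ?thesis
        using one[OF \<epsilon>(1)[OF tl]] by (simp add: mult.assoc) (simp add: algebra_simps diff_divide_distrib)
    qed
    have P: "(\<Prod>j\<in>{1..n}-{l}. ?w (?i \<tau> j)) = (\<Prod>j\<in>{1..n}-{l}. ?w (\<tau> j))"
      by (intro prod.cong) auto
    have "?F (?i \<tau>) = (\<Prod>j\<in>{1..n}-{l}. ?w (\<tau> j)) * f \<tau> * (?w (flip (\<tau> l)) * (- \<epsilon> (\<tau> l) - tanh Y))"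
      unfolding prod.remove[OF finite_atLeastAtMost l] P f by (simp add: \<epsilon>(2))
    also have "\<dots> = - ?F \<tau>"
      unfolding prod.remove[OF finite_atLeastAtMost l, of "\<lambda>j. ?w (\<tau> j)"] w by (simp add: mult_ac)
    finally show ?thesis .
  qed
  have i: "?i \<tau> \<in> {1..n} \<rightarrow>\<^sub>E S" if "\<tau> \<in> {1..n} \<rightarrow>\<^sub>E S" for \<tau>
    using that l flip(1) by (auto simp: PiE_iff extensional_def)
  have "(\<Sum>\<tau>\<in>{1..n} \<rightarrow>\<^sub>E S. ?F \<tau>) = (\<Sum>\<tau>\<in>{1..n} \<rightarrow>\<^sub>E S. - ?F \<tau>)"
  proof (rule sum.reindex_bij_witness[where i="?i" and j="?i"])
    fix \<tau> assume t: "\<tau> \<in> {1..n} \<rightarrow>\<^sub>E S"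
    show "?i (?i \<tau>) = \<tau>" "?i (?i \<tau>) = \<tau>" by (simp_all add: flip(2))
    show "?i \<tau> \<in> {1..n} \<rightarrow>\<^sub>E S" "?i \<tau> \<in> {1..n} \<rightarrow>\<^sub>E S" by (rule i[OF t])+
    show "- ?F (?i \<tau>) = ?F \<tau>" unfolding odd[OF t] by (rule minus_minus)
  qed
  then have "(\<Sum>\<tau>\<in>{1..n} \<rightarrow>\<^sub>E S. ?F \<tau>) = 0"
    unfolding sum_negf by linarith
  then have "replica_avg S H n (\<lambda>\<tau>. (\<epsilon> (\<tau> l) - tanh Y) * f \<tau>) = 0"
    unfolding replica_avg_def .
  then show ?thesis
    by (simp only: left_diff_distrib replica_avg_diff replica_avg_cmult)
qed

text \<open>At the amplitudes \<open>b\<close> the spin \<open>k e0\<close> feels only the external field \<open>h\<close> and its own Gaussian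
  field: flipping it leaves every other term that is present unchanged.\<close>

locale free_spin = gaussian_gibbs S E k c for S :: "'s set" and E :: "'e set" and k c +
  fixes b :: "'e \<Rightarrow> real" and e0 :: 'e and flip :: "'s \<Rightarrow> 's" and h :: real
  assumes e0: "e0 \<in> E"
    and flip_S: "\<And>\<sigma>. \<sigma> \<in> S \<Longrightarrow> flip \<sigma> \<in> S" and flip_flip: "\<And>\<sigma>. flip (flip \<sigma>) = \<sigma>"
    and spin_flip: "\<And>\<sigma>. k e0 (flip \<sigma>) = - k e0 \<sigma>"
    and other_flip: "\<And>e \<sigma>. e \<in> E \<Longrightarrow> e \<noteq> e0 \<Longrightarrow> b e \<noteq> 0 \<Longrightarrow> \<sigma> \<in> S \<Longrightarrow> k e (flip \<sigma>) = k e \<sigma>"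
    and c_flip: "\<And>\<sigma>. \<sigma> \<in> S \<Longrightarrow> c (flip \<sigma>) = c \<sigma> - 2 * h * k e0 \<sigma>"
begin

abbreviation spin :: "'s \<Rightarrow> real" where "spin \<equiv> k e0"

lemma energy_flip:
  assumes "\<sigma> \<in> S"
  shows "energy b x (flip \<sigma>) = energy b x \<sigma> - 2 * (b e0 * x e0 + h) * spin \<sigma>"
proof -
  have o: "(\<Sum>e\<in>E-{e0}. b e * x e * k e (flip \<sigma>)) = (\<Sum>e\<in>E-{e0}. b e * x e * k e \<sigma>)"
  proof (intro sum.cong refl)
    fix e assume "e \<in> E - {e0}"
    then show "b e * x e * k e (flip \<sigma>) = b e * x e * k e \<sigma>"
      using other_flip[of e \<sigma>] assms by (cases "b e = 0") auto
  qed
  show ?thesis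
    unfolding energy_def sum.remove[OF finite_E e0] o c_flip[OF assms] spin_flip
    by (simp add: algebra_simps)
qed

lemma spin_cases: "\<sigma> \<in> S \<Longrightarrow> spin \<sigma> = 1 \<or> spin \<sigma> = - 1"
  using k_square[OF e0] by (simp add: power2_eq_1_iff)

lemma replica_avg_spins:
  assumes A: "A \<subseteq> {1..n}" and f: "\<And>\<tau> l. f (\<tau>(l := flip (\<tau> l))) = f \<tau>"
  shows "replica_avg S (energy b x) n (\<lambda>\<tau>. (\<Prod>l\<in>A. spin (\<tau> l)) * f \<tau>)
       = tanh (b e0 * x e0 + h) ^ card A * replica_avg S (energy b x) n f"
  using finite_subset[OF A finite_atLeastAtMost] A
proof (induction A)
  case (insert l A)
  have inv: "(\<Prod>j\<in>A. spin ((\<tau>(l := flip (\<tau> l))) j)) * f (\<tau>(l := flip (\<tau> l))) = (\<Prod>j\<in>A. spin (\<tau> j)) * f \<tau>" for \<tau>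
    unfolding f using insert.hyps by (intro arg_cong2[where f="(*)"] prod.cong) auto
  have "replica_avg S (energy b x) n (\<lambda>\<tau>. (\<Prod>l\<in>insert l A. spin (\<tau> l)) * f \<tau>)
      = replica_avg S (energy b x) n (\<lambda>\<tau>. spin (\<tau> l) * ((\<Prod>l\<in>A. spin (\<tau> l)) * f \<tau>))"
    using insert.hyps by (simp add: mult.assoc)
  also have "\<dots> = tanh (b e0 * x e0 + h) * replica_avg S (energy b x) n (\<lambda>\<tau>. (\<Prod>l\<in>A. spin (\<tau> l)) * f \<tau>)"
    using insert.prems
    by (intro replica_avg_flip[where flip=flip] flip_S flip_flip spin_cases spin_flip inv) (auto simp: energy_flip)
  finally show ?case using insert by simp
qed simp

text \<open>Averages of functions of the other spins do not depend on the field of the free spin: by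
  the previous lemma, the derivative in that field vanishes.\<close>

lemma replica_avg_field_indep:
  assumes f: "\<And>\<tau> l. f (\<tau>(l := flip (\<tau> l))) = f \<tau>" and u: "uses_replicas n f"
  shows "replica_avg S (energy b (x(e0 := y))) n f = replica_avg S (energy b (x(e0 := y'))) n f"
proof -
  have "((\<lambda>y. replica_avg S (energy b (x(e0 := y))) n f) has_real_derivative 0) (at y)" for y
  proof -
    let ?H = "energy b (x(e0 := y))"
    let ?T = "tanh (b e0 * y + h) * replica_avg S ?H (Suc n) f"
    have dH: "((\<lambda>y. energy b (x(e0 := y)) \<sigma>) has_real_derivative b e0 * spin \<sigma>) (at y)" for \<sigma>
    proof -
      have "energy b (x(e0 := y)) \<sigma> = (c \<sigma> + (\<Sum>e\<in>E-{e0}. b e * x e * k e \<sigma>)) + b e0 * y * spin \<sigma>" for y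
        unfolding energy_def using finite_E e0 by (simp add: sum.remove[of E e0])
      then show ?thesis by (auto intro!: derivative_eq_intros)
    qed
    have d: "((\<lambda>y. replica_avg S (energy b (x(e0 := y))) n f) has_real_derivative
        b e0 * replica_avg S ?H (Suc n) (\<lambda>\<tau>. f \<tau> * new_replica n spin \<tau>)) (at y)"
      using DERIV_replica_avg[OF u, of "\<lambda>y. energy b (x(e0 := y))", OF dH]
      by (simp only: new_replica_cmult mult.left_commute[of "f _"] replica_avg_cmult)
    have s: "replica_avg S ?H (Suc n) (\<lambda>\<tau>. spin (\<tau> l) * f \<tau>) = ?T" if "l \<in> {1..Suc n}" for l
      using replica_avg_spins[of "{l}" "Suc n" f "x(e0 := y)", OF _ f] that by simp
    have "replica_avg S ?H (Suc n) (\<lambda>\<tau>. f \<tau> * new_replica n spin \<tau>)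
        = replica_avg S ?H (Suc n) (\<lambda>\<tau>. (\<Sum>l=1..n. spin (\<tau> l) * f \<tau>) - real n * (spin (\<tau> (Suc n)) * f \<tau>))"
      by (simp only: new_replica_def right_diff_distrib sum_distrib_left mult_ac)
    also have "\<dots> = (\<Sum>l=1..n. ?T) - real n * ?T"
      unfolding replica_avg_diff replica_avg_sum replica_avg_cmult
      by (intro arg_cong2[where f="(-)"] arg_cong2[where f="(*)"] sum.cong refl s) auto
    also have "\<dots> = 0" by simp
    finally show ?thesis using d by simp
  qed
  then show ?thesis by (rule DERIV_isconst_all[rule_format])
qed

text \<open>The factor $\tanh^{|A|}$ depends only on the field of the free spin, the average of \<open>f\<close> only on the
  other Gaussians, and they are independent.\<close>

lemma quenched_spins:
  assumes A: "A \<subseteq> {1..n}" and f: "\<And>\<tau> l. f (\<tau>(l := flip (\<tau> l))) = f \<tau>" and u: "uses_replicas n f"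
  shows "quenched b n (\<lambda>\<tau>. (\<Prod>l\<in>A. spin (\<tau> l)) * f \<tau>)
       = (\<integral>y. tanh (b e0 * y + h) ^ card A \<partial>std_normal_distribution) * quenched b n f"
proof -
  interpret N: prob_space std_normal_distribution by (rule prob_space_std_normal)
  have total: "measure std_normal_distribution UNIV = 1" using N.prob_space by simp
  let ?R = "\<lambda>x. replica_avg S (energy b x) n f"
  let ?T = "\<lambda>y. tanh (b e0 * y + h) ^ card A"
  have R: "?R (x(e0 := y)) = ?R (x(e0 := 0))" for x y by (rule replica_avg_field_indep[OF f u])
  have R_eq: "(\<lambda>y. ?R (x(e0 := y))) = (\<lambda>y. ?R (x(e0 := 0)))" for x
    by (intro ext R)
  have TR_eq: "(\<lambda>y. ?T y * ?R (x(e0 := y))) = (\<lambda>y. ?T y * ?R (x(e0 := 0)))" for x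
    by (intro ext arg_cong2[where f="(*)"] refl R)
  have eq: "replica_avg S (energy b x) n (\<lambda>\<tau>. (\<Prod>l\<in>A. spin (\<tau> l)) * f \<tau>) = ?T (x e0) * ?R x" for x
    by (rule replica_avg_spins[OF A f])
  have "quenched b n (\<lambda>\<tau>. (\<Prod>l\<in>A. spin (\<tau> l)) * f \<tau>)
     = (\<integral>x. (\<integral>y. ?T y * ?R (x(e0 := y)) \<partial>std_normal_distribution) \<partial>std_gaussians (E - {e0}))"
    unfolding quenched_def
    by (subst integral_std_gaussians_split[OF finite_E e0 integrable_replica_avg]) (simp only: eq fun_upd_same)
  also have "\<dots> = (\<integral>y. ?T y \<partial>std_normal_distribution) * (\<integral>x. ?R (x(e0 := 0)) \<partial>std_gaussians (E - {e0}))"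
    unfolding TR_eq by simp
  also have "(\<integral>x. ?R (x(e0 := 0)) \<partial>std_gaussians (E - {e0})) = quenched b n f"
    unfolding quenched_def
    by (subst integral_std_gaussians_split[OF finite_E e0 integrable_replica_avg])
      (simp only: R_eq, simp add: total)
  finally show ?thesis .
qed

end

section \<open>The disorder as a standard Gaussian vector\<close>

lemma indep_std_gaussians:
  assumes "E \<noteq> {}"
  shows "prob_space.indep_vars (std_gaussians E) (\<lambda>_. borel) (\<lambda>e x. x e) E"
proof -
  interpret prob_space "std_gaussians E" by (rule prob_space_std_gaussians)
  have s: "sets (PiM E (\<lambda>_. borel)) = sets (std_gaussians E)" by (intro sets_PiM_cong) auto
  have "distr (std_gaussians E) (PiM E (\<lambda>_. borel)) (\<lambda>x. \<lambda>e\<in>E. x e)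
      = distr (std_gaussians E) (std_gaussians E) (\<lambda>x. x)"
    by (intro distr_cong s refl) (auto simp: space_PiM)
  also have "\<dots> = std_gaussians E" by (rule distr_id2) simp
  also have "\<dots> = PiM E (\<lambda>e. distr (std_gaussians E) borel (\<lambda>x. x e))"
  proof (intro PiM_cong refl)
    fix e assume e: "e \<in> E"
    have "std_normal_distribution = distr (std_gaussians E) std_normal_distribution (\<lambda>x. x e)"
      using distr_PiM_component[of E "\<lambda>_. std_normal_distribution" e] prob_space_std_normal e by simp
    also have "\<dots> = distr (std_gaussians E) borel (\<lambda>x. x e)" by (intro distr_cong) auto
    finally show "std_normal_distribution = distr (std_gaussians E) borel (\<lambda>x. x e)" .
  qed
  finally show ?thesis
    using assms by (subst indep_vars_iff_distr_eq_PiM') auto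
qed

text \<open>Both families consist of independent variables with the same laws, hence have the same joint
  law. The index set may be larger on the right, which leaves room for an auxiliary Gaussian.\<close>

lemma integral_indep_gaussians:
  fixes X :: "'e \<Rightarrow> 'w \<Rightarrow> real" and F :: "('e \<Rightarrow> real) \<Rightarrow> real"
  assumes M: "prob_space M" "prob_space.indep_vars M (\<lambda>_. borel) X J"
    and X: "\<And>e. e \<in> J \<Longrightarrow> centered_gaussian M (X e) (v e)"
    and J: "J \<subseteq> E" "J \<noteq> {}"
    and F: "F \<in> borel_measurable (PiM J (\<lambda>_. borel))"
  shows "(\<integral>\<omega>. F (\<lambda>e\<in>J. X e \<omega>) \<partial>M) = (\<integral>x. F (\<lambda>e\<in>J. sqrt (v e) * x e) \<partial>std_gaussians E)"
proof -
  interpret M: prob_space M by (rule M(1))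
  interpret G: prob_space "std_gaussians E" by (rule prob_space_std_gaussians)
  let ?Y = "\<lambda>e x. sqrt (v e) * x e"
  have Xm: "X e \<in> borel_measurable M" if "e \<in> J" for e using X[OF that] unfolding centered_gaussian_def by (rule conjunct1)
  have Ym: "?Y e \<in> borel_measurable (std_gaussians E)" if "e \<in> J" for e
  proof -
    have "e \<in> E" using that J(1) by (rule rev_subsetD)
    then show ?thesis
      by (rule borel_measurable_times[OF borel_measurable_const measurable_std_gaussians_component])
  qed
  have "G.indep_vars (\<lambda>_. borel) ?Y J"
    using G.indep_vars_compose2[OF G.indep_vars_subset[OF indep_std_gaussians J(1)],
        of "\<lambda>e y. sqrt (v e) * y" "\<lambda>_. borel"] J by auto
  then have Y: "distr (std_gaussians E) (PiM J (\<lambda>_. borel)) (\<lambda>x. \<lambda>e\<in>J. ?Y e x)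
      = PiM J (\<lambda>e. distr (std_gaussians E) borel (?Y e))"
    by (rule G.indep_vars_iff_distr_eq_PiM'[where X="?Y" and M'="\<lambda>_. borel", OF J(2) Ym, THEN iffD1, rotated])
  have "distr M (PiM J (\<lambda>_. borel)) (\<lambda>\<omega>. \<lambda>e\<in>J. X e \<omega>) = PiM J (\<lambda>e. distr M borel (X e))"
    by (rule M.indep_vars_iff_distr_eq_PiM'[where X=X and M'="\<lambda>_. borel", OF J(2) Xm, THEN iffD1, OF _ M(2)])
  also have "\<dots> = PiM J (\<lambda>e. distr (std_gaussians E) borel (?Y e))"
  proof (intro PiM_cong refl)
    fix e assume e: "e \<in> J"
    have c: "distr (std_gaussians E) std_normal_distribution (\<lambda>x. x e) = std_normal_distribution"
      using distr_PiM_component[of E "\<lambda>_. std_normal_distribution" e] prob_space_std_normal e J by auto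
    have "distr M borel (X e) = distr std_normal_distribution borel (\<lambda>x. sqrt (v e) * x)"
      using X[OF e] unfolding centered_gaussian_def by (rule conjunct2)
    also have "\<dots> = distr (distr (std_gaussians E) std_normal_distribution (\<lambda>x. x e)) borel (\<lambda>x. sqrt (v e) * x)"
      by (simp only: c)
    also have "\<dots> = distr (std_gaussians E) borel (?Y e)"
      using e J by (subst distr_distr) (auto simp: comp_def)
    finally show "distr M borel (X e) = distr (std_gaussians E) borel (?Y e)" .
  qed
  also note Y[symmetric]
  finally have eq: "distr M (PiM J (\<lambda>_. borel)) (\<lambda>\<omega>. \<lambda>e\<in>J. X e \<omega>)
      = distr (std_gaussians E) (PiM J (\<lambda>_. borel)) (\<lambda>x. \<lambda>e\<in>J. ?Y e x)" .
  have "(\<integral>\<omega>. F (\<lambda>e\<in>J. X e \<omega>) \<partial>M) = integral\<^sup>L (distr M (PiM J (\<lambda>_. borel)) (\<lambda>\<omega>. \<lambda>e\<in>J. X e \<omega>)) F"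
    using Xm by (intro integral_distr[symmetric] F measurable_restrict) auto
  also have "\<dots> = (\<integral>x. F (\<lambda>e\<in>J. ?Y e x) \<partial>std_gaussians E)"
    unfolding eq using Ym by (intro integral_distr F measurable_restrict) auto
  finally show ?thesis .
qed

section \<open>The cavity path of the multi-species model\<close>

locale sk_system =
  fixes D :: "real ^ 'm ^ 'm" and lam q :: "real ^ 'm" and \<beta> h :: real
    and N :: nat and I :: "'m \<Rightarrow> nat set" and M :: "'w measure" and g :: "nat \<Rightarrow> nat \<Rightarrow> 'w \<Rightarrow> real"
  assumes species_ge_2: "CARD('m) \<ge> 2"
    and D_sym: "\<And>s t. D $ s $ t = D $ t $ s" and D_nonneg: "\<And>s t. 0 \<le> D $ s $ t"
    and lam: "\<And>s. 0 < lam $ s" "\<And>s. lam $ s < 1"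
    and rs: "rs_solution \<beta> h D lam q"
    and N_pos: "0 < N"
    and partition: "species_partition lam N I"
    and disorder: "sk_disorder D N I M g"
begin

lemma q: "0 \<le> q $ s" "q $ s \<le> 1"
  using rs by (auto simp: rs_solution_def)

definition species :: "nat \<Rightarrow> 'm" where
  "species j = (THE s. j \<in> I s)"

lemma species_iff:
  assumes "j \<in> {1..N}"
  shows "j \<in> I s \<longleftrightarrow> species j = s"
proof -
  have "j \<in> (\<Union>s. I s)" using assms partition by (simp add: species_partition_def)
  then obtain t where t: "j \<in> I t" by auto
  have u: "s = t" if "j \<in> I s" for s
  proof (rule ccontr)
    assume "s \<noteq> t"
    then have "I s \<inter> I t = {}"
      using partition unfolding species_partition_def disjoint_family_on_def by simp
    with that t show False by auto
  qed
  have "species j = t" unfolding species_def using t u by (rule the_equality)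
  then show ?thesis using t u[of s] by blast
qed

lemma I_subset: "I s \<subseteq> {1..N}"
proof -
  have "(\<Union>s. I s) = {1..N}" using partition by (simp add: species_partition_def)
  then show ?thesis by auto
qed

lemma I_eq: "I s = {j \<in> {1..N}. species j = s}"
  using I_subset[of s] species_iff[of _ s] by auto

lemma finite_I: "finite (I s)"
  using I_subset finite_subset by blast

lemma card_I: "real (card (I s)) = lam $ s * real N"
  using partition by (simp add: species_partition_def)

lemma card_I_pos: "0 < real (card (I s))"
  using card_I lam(1) N_pos by simp

definition edges :: "(nat \<times> nat) set" where
  "edges = {(i, j). 1 \<le> i \<and> i < j \<and> j \<le> N}"

lemma finite_edges: "finite edges"
  by (rule finite_subset[of _ "{1..N} \<times> {1..N}"]) (auto simp: edges_def)

lemma edges_nonempty: "edges \<noteq> {}"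
proof -
  obtain s t :: 'm where st: "s \<noteq> t"
    using species_ge_2 card_le_Suc0_iff_eq[of "UNIV :: 'm set"] by fastforce
  have ne: "I s \<noteq> {}" for s
  proof
    assume "I s = {}"
    then show False using card_I_pos[of s] by simp
  qed
  obtain i j where i: "i \<in> I s" and j: "j \<in> I t" using ne[of s] ne[of t] by blast
  have ij: "i \<in> {1..N}" "species i = s" "j \<in> {1..N}" "species j = t"
    using i j I_eq[of s] I_eq[of t] by simp_all
  then have "i \<noteq> j" using st by auto
  then have "(min i j, max i j) \<in> edges"
    using ij(1,3) by (simp add: edges_def min_def max_def)
  then show ?thesis by auto
qed

text \<open>The component $(\Delta^2\Lambda q)_p$; times $\beta^2$ it is the variance of the limiting
  cavity field of a site of species \<open>p\<close>.\<close>

definition field_var :: "'m \<Rightarrow> real" where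
  "field_var p = (\<Sum>t\<in>UNIV. D $ p $ t * lam $ t * q $ t)"

lemma field_var_nonneg: "0 \<le> field_var p"
  unfolding field_var_def using D_nonneg lam(1) q(1)
  by (intro sum_nonneg mult_nonneg_nonneg) (auto intro: less_imp_le)

text \<open>The pair \<open>(0, 0)\<close>, which is not an edge, labels the additional Gaussian variable that
  replaces the cavity field of the site.\<close>

definition labels :: "(nat \<times> nat) set" where
  "labels = insert (0, 0) edges"

definition monomial :: "nat \<Rightarrow> nat \<times> nat \<Rightarrow> (nat \<Rightarrow> real) \<Rightarrow> real" where
  "monomial i e \<sigma> = (if e = (0, 0) then \<sigma> i else \<sigma> (fst e) * \<sigma> (snd e))"

definition amplitude :: "nat \<times> nat \<Rightarrow> real" where
  "amplitude e = \<beta> / sqrt (real N) * sqrt (D $ species (fst e) $ species (snd e))"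

definition coupling :: "nat \<Rightarrow> real \<Rightarrow> nat \<times> nat \<Rightarrow> real" where
  "coupling i \<theta> e =
     (if e = (0, 0) then \<beta> * sqrt (field_var (species i)) * cos \<theta>
      else if i = fst e \<or> i = snd e then amplitude e * sin \<theta> else amplitude e)"

definition coupling_deriv :: "nat \<Rightarrow> real \<Rightarrow> nat \<times> nat \<Rightarrow> real" where
  "coupling_deriv i \<theta> e =
     (if e = (0, 0) then - (\<beta> * sqrt (field_var (species i)) * sin \<theta>)
      else if i = fst e \<or> i = snd e then amplitude e * cos \<theta> else 0)"

definition external :: "(nat \<Rightarrow> real) \<Rightarrow> real" where
  "external \<sigma> = h * (\<Sum>j=1..N. \<sigma> j)"

text \<open>$\beta^2$ times the first term is the covariance, between two replicas, of the field that the other spins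
  exert on site \<open>i\<close>; its predicted value is subtracted.\<close>

definition cavity_overlap :: "nat \<Rightarrow> (nat \<Rightarrow> real) \<Rightarrow> (nat \<Rightarrow> real) \<Rightarrow> real" where
  "cavity_overlap i \<sigma> \<sigma>' =
     (\<Sum>j\<in>{1..N} - {i}. D $ species i $ species j * \<sigma> j * \<sigma>' j) / real N - field_var (species i)"

definition cavity_cov :: "nat \<Rightarrow> (nat \<Rightarrow> real) \<Rightarrow> (nat \<Rightarrow> real) \<Rightarrow> real" where
  "cavity_cov i \<sigma> \<sigma>' = \<beta>\<^sup>2 * (\<sigma> i * \<sigma>' i) * cavity_overlap i \<sigma> \<sigma>'"

definition D_total :: real where
  "D_total = (\<Sum>s\<in>UNIV. \<Sum>t\<in>UNIV. D $ s $ t)"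

lemma row_le_D_total: "(\<Sum>t\<in>UNIV. D $ s $ t) \<le> D_total"
  unfolding D_total_def by (rule member_le_sum) (auto intro!: sum_nonneg D_nonneg)

lemma D_le_D_total: "D $ s $ t \<le> D_total"
  by (rule order_trans[OF member_le_sum[of t UNIV "\<lambda>t. D $ s $ t"] row_le_D_total]) (auto intro: D_nonneg)

lemma D_total_nonneg: "0 \<le> D_total"
  unfolding D_total_def by (intro sum_nonneg D_nonneg)

lemma finite_configs_system: "finite_configs (configs N)"
proof
  show "finite (configs N)" unfolding configs_def by (intro finite_PiE) auto
  have "(\<lambda>j\<in>{1..N}. 1) \<in> configs N" unfolding configs_def by auto
  then show "configs N \<noteq> {}" by blast
qed

lemma config_values: "\<sigma> \<in> configs N \<Longrightarrow> j \<in> {1..N} \<Longrightarrow> \<sigma> j = 1 \<or> \<sigma> j = - 1"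
  unfolding configs_def by (auto simp: PiE_iff)

lemma config_abs: "\<sigma> \<in> configs N \<Longrightarrow> j \<in> {1..N} \<Longrightarrow> \<bar>\<sigma> j\<bar> = 1"
  using config_values by fastforce

lemma config_square: "\<sigma> \<in> configs N \<Longrightarrow> j \<in> {1..N} \<Longrightarrow> \<sigma> j * \<sigma> j = 1"
  using config_values by fastforce

text \<open>At the end of the cavity path the auxiliary variable is decoupled and the average is the
  one of the model.\<close>

lemma nu_eq_quenched_integral:
  "nu \<beta> h N M g n f = (\<integral>x. replica_avg (configs N)
      (\<lambda>\<sigma>. external \<sigma> + (\<Sum>e\<in>labels. coupling i (pi / 2) e * x e * monomial i e \<sigma>)) n f \<partial>std_gaussians labels)"
proof -
  let ?F = "\<lambda>y. replica_avg (configs N)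
      (\<lambda>\<sigma>. \<beta> / sqrt (real N) * (\<Sum>e\<in>edges. y e * (\<sigma> (fst e) * \<sigma> (snd e))) + h * (\<Sum>j=1..N. \<sigma> j)) n f"
  have z: "(0, 0) \<notin> edges" by (simp add: edges_def)
  have M: "prob_space M" "prob_space.indep_vars M (\<lambda>_. borel) (\<lambda>(i, j). g i j) edges"
    using disorder unfolding sk_disorder_def edges_def by auto
  have X: "centered_gaussian M ((\<lambda>(i, j). g i j) e) (D $ species (fst e) $ species (snd e))" if "e \<in> edges" for e
  proof -
    obtain i j where e: "e = (i, j)" by (cases e)
    then have "i \<in> I (species i)" "j \<in> I (species j)" "i < j"
      using that species_iff[of i] species_iff[of j] by (auto simp: edges_def)
    then show ?thesis using disorder unfolding sk_disorder_def e by auto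
  qed
  have sub: "edges \<subseteq> labels" by (auto simp: labels_def)
  have "nu \<beta> h N M g n f = (\<integral>\<omega>. ?F (\<lambda>e\<in>edges. (\<lambda>(i, j). g i j) e \<omega>) \<partial>M)"
    unfolding nu_def
  proof (intro Bochner_Integration.integral_cong refl)
    fix \<omega>
    have "hamiltonian \<beta> h N (\<lambda>i j. g i j \<omega>) \<sigma> = \<beta> / sqrt (real N) *
        (\<Sum>e\<in>edges. (\<lambda>e\<in>edges. (\<lambda>(i, j). g i j) e \<omega>) e * (\<sigma> (fst e) * \<sigma> (snd e))) + h * (\<Sum>j=1..N. \<sigma> j)" for \<sigma>
      unfolding hamiltonian_def edges_def
      by (intro arg_cong2[where f="(+)"] arg_cong2[where f="(*)"] sum.cong refl) (auto simp: mult.assoc)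
    then show "gibbs_avg \<beta> h N (\<lambda>i j. g i j \<omega>) n f = ?F (\<lambda>e\<in>edges. (\<lambda>(i, j). g i j) e \<omega>)"
      unfolding gibbs_avg_def gibbs_def partition_function_def replica_avg_def by simp
  qed
  also have "\<dots> = (\<integral>x. ?F (\<lambda>e\<in>edges. sqrt (D $ species (fst e) $ species (snd e)) * x e) \<partial>std_gaussians labels)"
  proof (rule integral_indep_gaussians[OF M X sub edges_nonempty])
    show "?F \<in> borel_measurable (PiM edges (\<lambda>_. borel))"
      unfolding replica_avg_def by measurable
  qed
  also have "\<dots> = (\<integral>x. replica_avg (configs N)
      (\<lambda>\<sigma>. external \<sigma> + (\<Sum>e\<in>labels. coupling i (pi / 2) e * x e * monomial i e \<sigma>)) n f \<partial>std_gaussians labels)"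
  proof (intro Bochner_Integration.integral_cong refl arg_cong[where f="\<lambda>H. replica_avg (configs N) H n f"] ext)
    fix x \<sigma>
    have "(\<Sum>e\<in>labels. coupling i (pi / 2) e * x e * monomial i e \<sigma>)
        = (\<Sum>e\<in>edges. coupling i (pi / 2) e * x e * monomial i e \<sigma>)"
      unfolding labels_def using finite_edges z by (simp add: coupling_def)
    also have "\<dots> = (\<Sum>e\<in>edges. \<beta> / sqrt (real N) *
        ((\<lambda>e\<in>edges. sqrt (D $ species (fst e) $ species (snd e)) * x e) e * (\<sigma> (fst e) * \<sigma> (snd e))))"
      using z by (intro sum.cong refl) (auto simp: coupling_def amplitude_def monomial_def mult.assoc)
    finally show "\<beta> / sqrt (real N) *
        (\<Sum>e\<in>edges. (\<lambda>e\<in>edges. sqrt (D $ species (fst e) $ species (snd e)) * x e) e * (\<sigma> (fst e) * \<sigma> (snd e)))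
        + h * (\<Sum>j=1..N. \<sigma> j)
       = external \<sigma> + (\<Sum>e\<in>labels. coupling i (pi / 2) e * x e * monomial i e \<sigma>)"
      by (simp add: external_def sum_distrib_left)
  qed
  finally show ?thesis .
qed

end

locale sk_cavity = sk_system D lam q \<beta> h N I M g
  for D :: "real ^ 'm ^ 'm" and lam q :: "real ^ 'm" and \<beta> h :: real
    and N :: nat and I :: "'m \<Rightarrow> nat set" and M :: "'w measure" and g :: "nat \<Rightarrow> nat \<Rightarrow> 'w \<Rightarrow> real" +
  fixes i :: nat
  assumes site: "i \<in> {1..N}"
begin

lemma sum_edges_at_site:
  "(\<Sum>e | e \<in> edges \<and> (i = fst e \<or> i = snd e). F e) = (\<Sum>j\<in>{1..N} - {i}. F (min i j, max i j))"
  using site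
  by (intro sum.reindex_bij_witness[where j="\<lambda>e. if i = fst e then snd e else fst e" and i="\<lambda>j. (min i j, max i j)"])
    (auto simp: edges_def min_def max_def split: if_splits)

text \<open>Couplings of the site contribute with $+\sin\theta\cos\theta$, the auxiliary field with
  $-\sin\theta\cos\theta$ times its variance, and all other couplings are constant.\<close>

lemma coupling_covariance:
  assumes s: "\<sigma> \<in> configs N" "\<sigma>' \<in> configs N"
  shows "(\<Sum>e\<in>labels. coupling i \<theta> e * coupling_deriv i \<theta> e * (monomial i e \<sigma> * monomial i e \<sigma>'))
    = sin \<theta> * cos \<theta> * cavity_cov i \<sigma> \<sigma>'"
proof -
  let ?p = "species i"
  let ?T = "\<lambda>e. coupling i \<theta> e * coupling_deriv i \<theta> e * (monomial i e \<sigma> * monomial i e \<sigma>')"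
  have z: "(0, 0) \<notin> edges" by (simp add: edges_def)
  have amp: "amplitude e * amplitude e = \<beta>\<^sup>2 / real N * D $ species (fst e) $ species (snd e)" for e
  proof -
    have "amplitude e * amplitude e = \<beta>\<^sup>2 / (sqrt (real N) * sqrt (real N)) *
        (sqrt (D $ species (fst e) $ species (snd e)) * sqrt (D $ species (fst e) $ species (snd e)))"
      by (simp add: amplitude_def power2_eq_square)
    then show ?thesis using D_nonneg by simp
  qed
  have fv: "sqrt (field_var ?p) * sqrt (field_var ?p) = field_var ?p"
    using field_var_nonneg by simp
  have T0: "?T (0, 0) = - sin \<theta> * cos \<theta> * \<beta>\<^sup>2 * (\<sigma> i * \<sigma>' i) * field_var ?p"
    unfolding coupling_def coupling_deriv_def monomial_def
    using fv by (simp add: power2_eq_square mult_ac)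
  have "(\<Sum>e\<in>labels. ?T e) = ?T (0, 0) + (\<Sum>e\<in>edges. ?T e)"
    unfolding labels_def using finite_edges z by simp
  also have "(\<Sum>e\<in>edges. ?T e) = (\<Sum>e | e \<in> edges \<and> (i = fst e \<or> i = snd e). ?T e)"
    using finite_edges z by (intro sum.mono_neutral_right) (auto simp: coupling_deriv_def)
  also have "\<dots> = (\<Sum>j\<in>{1..N} - {i}. ?T (min i j, max i j))"
    by (rule sum_edges_at_site)
  also have "\<dots> = (\<Sum>j\<in>{1..N} - {i}. sin \<theta> * cos \<theta> * \<beta>\<^sup>2 * (\<sigma> i * \<sigma>' i) / real N * (D $ ?p $ species j * \<sigma> j * \<sigma>' j))"
  proof (intro sum.cong refl)
    fix j assume j: "j \<in> {1..N} - {i}"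
    let ?e = "(min i j, max i j)"
    have "coupling i \<theta> ?e * coupling_deriv i \<theta> ?e = sin \<theta> * cos \<theta> * (amplitude ?e * amplitude ?e)"
      using j site by (auto simp: coupling_def coupling_deriv_def min_def max_def)
    also have "amplitude ?e * amplitude ?e = \<beta>\<^sup>2 / real N * D $ ?p $ species j"
      unfolding amp by (auto simp: min_def max_def D_sym)
    finally have c: "coupling i \<theta> ?e * coupling_deriv i \<theta> ?e = sin \<theta> * cos \<theta> * (\<beta>\<^sup>2 / real N * D $ ?p $ species j)" .
    have "monomial i ?e \<sigma> * monomial i ?e \<sigma>' = (\<sigma> i * \<sigma>' i) * (\<sigma> j * \<sigma>' j)"
      using j site by (auto simp: monomial_def min_def max_def)
    with c show "?T ?e = sin \<theta> * cos \<theta> * \<beta>\<^sup>2 * (\<sigma> i * \<sigma>' i) / real N * (D $ ?p $ species j * \<sigma> j * \<sigma>' j)"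
      by simp
  qed
  also have "?T (0, 0) + \<dots> = sin \<theta> * cos \<theta> * cavity_cov i \<sigma> \<sigma>'"
    unfolding T0 sum_distrib_left[symmetric] cavity_cov_def cavity_overlap_def
    by (simp add: algebra_simps)
  finally show ?thesis .
qed

lemma abs_cavity_overlap_le:
  assumes s: "\<sigma> \<in> configs N" "\<sigma>' \<in> configs N"
  shows "\<bar>cavity_overlap i \<sigma> \<sigma>'\<bar> \<le> 2 * D_total"
proof -
  have "\<bar>\<Sum>j\<in>{1..N} - {i}. D $ species i $ species j * \<sigma> j * \<sigma>' j\<bar> \<le> (\<Sum>j\<in>{1..N} - {i}. D_total)"
    using config_abs[OF s(1)] config_abs[OF s(2)] D_nonneg D_le_D_total
    by (intro order_trans[OF sum_abs] sum_mono) (auto simp: abs_mult)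
  also have "\<dots> \<le> real N * D_total"
    using site D_total_nonneg by (simp add: mult_right_mono)
  finally have "\<bar>(\<Sum>j\<in>{1..N} - {i}. D $ species i $ species j * \<sigma> j * \<sigma>' j) / real N\<bar> \<le> D_total"
    using N_pos by (simp add: divide_le_eq mult.commute)
  moreover have "field_var (species i) \<le> D_total"
  proof -
    have "D $ p $ t * lam $ t * q $ t \<le> D $ p $ t * 1 * 1" for p t
      using lam q D_nonneg[of p t] by (intro mult_mono) (auto intro: less_imp_le)
    then have "field_var (species i) \<le> (\<Sum>t\<in>UNIV. D $ species i $ t)"
      unfolding field_var_def by (intro sum_mono) simp
    then show ?thesis using row_le_D_total[of "species i"] by linarith
  qed
  ultimately show ?thesis
    using field_var_nonneg[of "species i"] unfolding cavity_overlap_def by linarith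
qed

sublocale gaussian_path "configs N" labels "monomial i" external "coupling i" "coupling_deriv i"
  "\<bar>\<beta>\<bar> * sqrt (field_var (species i)) + (\<Sum>e\<in>edges. \<bar>amplitude e\<bar>)" "2 * \<beta>\<^sup>2 * D_total" "cavity_cov i"
proof -
  interpret finite_configs "configs N" by (rule finite_configs_system)
  show "gaussian_path (configs N) labels (monomial i) (coupling i) (coupling_deriv i)
     (\<bar>\<beta>\<bar> * sqrt (field_var (species i)) + (\<Sum>e\<in>edges. \<bar>amplitude e\<bar>)) (2 * \<beta>\<^sup>2 * D_total) (cavity_cov i)"
  proof
    show "finite labels" using finite_edges by (simp add: labels_def)
    \<comment> \<open>Monomials are products of one or two spins with values \<open>1\<close> and \<open>- 1\<close>.\<close>
    show "(monomial i e \<sigma>)\<^sup>2 = 1" if "e \<in> labels" "\<sigma> \<in> configs N" for e \<sigma>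
    proof -
      have "fst e \<in> {1..N} \<and> snd e \<in> {1..N}" if "e \<noteq> (0, 0)"
        using that \<open>e \<in> labels\<close> by (auto simp: labels_def edges_def)
      then show ?thesis
        using config_square[OF that(2), of "fst e"] config_square[OF that(2), of "snd e"]
          config_square[OF that(2) site]
        unfolding power2_eq_square[symmetric] by (auto simp: monomial_def power_mult_distrib)
    qed
    show "((\<lambda>\<theta>. coupling i \<theta> e) has_real_derivative coupling_deriv i \<theta> e) (at \<theta>)" for \<theta> e
    proof (cases "e = (0, 0)")
      case True
      then show ?thesis unfolding coupling_def coupling_deriv_def by (auto intro!: derivative_eq_intros)
    next
      case False
      then show ?thesis unfolding coupling_def coupling_deriv_def
        by (cases "i = fst e \<or> i = snd e") (auto intro!: derivative_eq_intros)
    qed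
    show "\<bar>coupling_deriv i \<theta> e\<bar> \<le> \<bar>\<beta>\<bar> * sqrt (field_var (species i)) + (\<Sum>e\<in>edges. \<bar>amplitude e\<bar>)"
      if "e \<in> labels" for \<theta> e
    proof (cases "e = (0, 0)")
      case True
      have "\<bar>\<beta> * sqrt (field_var (species i)) * sin \<theta>\<bar> \<le> \<bar>\<beta>\<bar> * sqrt (field_var (species i)) * 1"
        unfolding abs_mult using field_var_nonneg by (intro mult_mono) auto
      moreover have "0 \<le> (\<Sum>e\<in>edges. \<bar>amplitude e\<bar>)" by (intro sum_nonneg) auto
      ultimately show ?thesis
        unfolding True coupling_deriv_def by (simp only: simp_thms if_True abs_minus_cancel mult_1_right)
    next
      case False
      then have "\<bar>amplitude e\<bar> \<le> (\<Sum>e\<in>edges. \<bar>amplitude e\<bar>)"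
        using that finite_edges by (intro member_le_sum) (auto simp: labels_def)
      moreover have "\<bar>coupling_deriv i \<theta> e\<bar> \<le> \<bar>amplitude e\<bar> * 1"
        using False mult_left_mono[OF abs_cos_le_one, of "\<bar>amplitude e\<bar>" \<theta>]
        by (simp add: coupling_deriv_def abs_mult)
      moreover have "0 \<le> \<bar>\<beta>\<bar> * sqrt (field_var (species i))" using field_var_nonneg by auto
      ultimately show ?thesis by linarith
    qed
    show "\<bar>cavity_cov i \<sigma> \<sigma>'\<bar> \<le> 2 * \<beta>\<^sup>2 * D_total" if "\<sigma> \<in> configs N" "\<sigma>' \<in> configs N" for \<sigma> \<sigma>'
      using abs_cavity_overlap_le[OF that] config_abs[OF that(1) site] config_abs[OF that(2) site]
        mult_left_mono[of "\<bar>cavity_overlap i \<sigma> \<sigma>'\<bar>" "2 * D_total" "\<beta>\<^sup>2"]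
      by (simp add: cavity_cov_def abs_mult)
    show "0 \<le> 2 * \<beta>\<^sup>2 * D_total" using D_total_nonneg by simp
  qed (rule coupling_covariance)
qed

sublocale free_spin "configs N" labels "monomial i" external "coupling i 0" "(0, 0)" "\<lambda>\<sigma>. \<sigma>(i := - \<sigma> i)" h
proof
  show "(0, 0) \<in> labels" by (simp add: labels_def)
  show "\<sigma>(i := - \<sigma> i) \<in> configs N" if "\<sigma> \<in> configs N" for \<sigma>
    using that site config_values[OF that site] unfolding configs_def by (auto simp: PiE_iff extensional_def)
  show "(\<sigma>(i := - \<sigma> i))(i := - (\<sigma>(i := - \<sigma> i)) i) = \<sigma>" for \<sigma> :: "nat \<Rightarrow> real" by simp
  show "monomial i (0, 0) (\<sigma>(i := - \<sigma> i)) = - monomial i (0, 0) \<sigma>" for \<sigma> by (simp add: monomial_def)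
  show "monomial i e (\<sigma>(i := - \<sigma> i)) = monomial i e \<sigma>"
    if "e \<in> labels" "e \<noteq> (0, 0)" "coupling i 0 e \<noteq> 0" for e \<sigma>
    using that by (auto simp: coupling_def monomial_def split: if_splits)
  show "external (\<sigma>(i := - \<sigma> i)) = external \<sigma> - 2 * h * monomial i (0, 0) \<sigma>" for \<sigma>
  proof -
    have "(\<Sum>j\<in>{1..N}-{i}. (\<sigma>(i := - \<sigma> i)) j) = (\<Sum>j\<in>{1..N}-{i}. \<sigma> j)" by (intro sum.cong) auto
    then show ?thesis
      unfolding external_def sum.remove[OF finite_atLeastAtMost site]
      by (simp add: monomial_def algebra_simps)
  qed
qed

lemma nu_eq_path: "nu \<beta> h N M g n f = quenched (coupling i (pi / 2)) n f"
  unfolding quenched_def energy_def by (rule nu_eq_quenched_integral)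

end

section \<open>Overlap deviations and the error scale\<close>

definition replica_pairs :: "nat \<Rightarrow> (nat \<times> nat) set" where
  "replica_pairs n = {(l, l'). l \<in> {1..n} \<and> l' \<in> {1..n} \<and> l \<noteq> l'}"

lemma card_replica_pairs_le: "real (card (replica_pairs n)) \<le> (real n)\<^sup>2"
proof -
  have "card (replica_pairs n) \<le> card ({1..n} \<times> {1..n})"
    by (intro card_mono) (auto simp: replica_pairs_def)
  then have "real (card (replica_pairs n)) \<le> real (n * n)" by (simp only: card_cartesian_product card_atLeastAtMost of_nat_le_iff diff_Suc_1)
  then show ?thesis by (simp add: power2_eq_square)
qed

lemma sum_replica_pairs:
  fixes F :: "nat \<Rightarrow> nat \<Rightarrow> real"
  assumes "\<And>l. F l l = 0"
  shows "(\<Sum>l=1..n. \<Sum>l'=1..n. F l l') = (\<Sum>x\<in>replica_pairs n. F (fst x) (snd x))"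
proof -
  have "(\<Sum>l=1..n. \<Sum>l'=1..n. F l l') = (\<Sum>x\<in>{1..n} \<times> {1..n}. F (fst x) (snd x))"
    by (simp add: sum.cartesian_product case_prod_unfold)
  also have "\<dots> = (\<Sum>x\<in>replica_pairs n. F (fst x) (snd x))"
    using assms by (intro sum.mono_neutral_right) (auto simp: replica_pairs_def)
  finally show ?thesis .
qed

lemma pair_interaction_pairs:
  "pair_interaction n V \<tau> =
     (\<Sum>x\<in>replica_pairs (n + 2). pair_coeff n (fst x) (snd x) * V (\<tau> (fst x)) (\<tau> (snd x)))"
  unfolding pair_interaction_def by (rule sum_replica_pairs) (simp add: pair_coeff_def)

lemma mult3_le_cubes:
  fixes x y z :: real
  assumes "0 \<le> x" "0 \<le> y" "0 \<le> z"
  shows "x * y * z \<le> x ^ 3 + y ^ 3 + z ^ 3"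
proof -
  define m where "m = max x (max y z)"
  have m: "x \<le> m" "y \<le> m" "z \<le> m" "0 \<le> m" using assms by (auto simp: m_def)
  have "x * y * z \<le> m * m * m" using assms m by (intro mult_mono) auto
  also have "\<dots> = m ^ 3" by (simp add: power3_eq_cube)
  also have "\<dots> \<le> x ^ 3 + y ^ 3 + z ^ 3"
    using assms unfolding m_def max_def by auto
  finally show ?thesis .
qed

text \<open>Used with \<open>u = 1 / N\<close>: it trades a correction of relative size $1/N$ for the error scale.
  Either \<open>x\<close> is at most $\sqrt u$, and the first term suffices, or \<open>u\<close> is at most $x^2$.\<close>

lemma mult_le_powr_add_cube:
  fixes u x :: real
  assumes u: "0 < u" and x: "0 \<le> x"
  shows "u * x \<le> u powr (3 / 2) + x ^ 3"
proof (cases "x \<le> sqrt u")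
  case True
  have "u * x \<le> u * sqrt u" using True u by (intro mult_left_mono) auto
  also have "\<dots> = u powr (1 + 1 / 2)" using u by (simp only: powr_add powr_one powr_half_sqrt) 
  also have "\<dots> = u powr (3 / 2)" by simp
  finally show ?thesis using x by (simp add: add_increasing2)
next
  case False
  then have "sqrt u * sqrt u \<le> x * x" using u x by (intro mult_mono) auto
  then have "u * x \<le> x * x * x" using u x by (intro mult_right_mono) auto
  then show ?thesis using u by (simp add: power3_eq_cube add_increasing)
qed

context sk_system
begin

definition overlap_dev :: "'m \<Rightarrow> (nat \<Rightarrow> real) \<Rightarrow> (nat \<Rightarrow> real) \<Rightarrow> real" where
  "overlap_dev s \<sigma> \<sigma>' = (\<Sum>j\<in>I s. \<sigma> j * \<sigma>' j) / real (card (I s)) - q $ s"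

text \<open>The summand \<open>1 / N\<close> absorbs the effect of removing one site from an overlap.\<close>

definition dev_size :: "(nat \<Rightarrow> real) \<Rightarrow> (nat \<Rightarrow> real) \<Rightarrow> real" where
  "dev_size \<sigma> \<sigma>' = (\<Sum>s\<in>UNIV. \<bar>overlap_dev s \<sigma> \<sigma>'\<bar>) + 1 / real N"

text \<open>The component $(\Delta^2\Lambda(R - q))_p$, which is \<open>cavity_overlap\<close> up to the contribution
  of the removed site.\<close>

definition field_dev :: "'m \<Rightarrow> (nat \<Rightarrow> real) \<Rightarrow> (nat \<Rightarrow> real) \<Rightarrow> real" where
  "field_dev p \<sigma> \<sigma>' = (\<Sum>t\<in>UNIV. D $ p $ t * lam $ t * overlap_dev t \<sigma> \<sigma>')"

text \<open>The site is left out of the sum but the normalisation is kept, so that the difference to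
  \<open>overlap_dev\<close> is exactly the term of the site.\<close>

definition cavity_dev :: "nat \<Rightarrow> 'm \<Rightarrow> (nat \<Rightarrow> real) \<Rightarrow> (nat \<Rightarrow> real) \<Rightarrow> real" where
  "cavity_dev i s \<sigma> \<sigma>' = (\<Sum>j\<in>I s - {i}. \<sigma> j * \<sigma>' j) / real (card (I s)) - q $ s"

definition lam_inv :: real where
  "lam_inv = 1 + (\<Sum>s\<in>UNIV. 1 / lam $ s)"

definition err :: real where
  "err = real N powr (- 3 / 2) + nu \<beta> h N M g 2 (\<lambda>\<tau>. dev_size (\<tau> 1) (\<tau> 2) ^ 3)"

lemma lam_inv_ge: "1 \<le> lam_inv" "1 / lam $ s \<le> lam_inv"
proof -
  have "0 \<le> (\<Sum>s\<in>UNIV. 1 / lam $ s)" using lam(1) by (intro sum_nonneg) (simp add: less_imp_le)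
  then show "1 \<le> lam_inv" by (simp add: lam_inv_def)
  have "1 / lam $ s \<le> (\<Sum>s\<in>UNIV. 1 / lam $ s)"
    using lam(1) by (intro member_le_sum) (auto simp: less_imp_le)
  then show "1 / lam $ s \<le> lam_inv" by (simp add: lam_inv_def)
qed

lemma inv_card_I_le: "1 / real (card (I s)) \<le> lam_inv / real N"
proof -
  have "1 / real (card (I s)) = (1 / lam $ s) / real N" by (simp add: card_I)
  also have "\<dots> \<le> lam_inv / real N" by (intro divide_right_mono lam_inv_ge(2)) simp
  finally show ?thesis .
qed

lemma dev_size_nonneg: "0 \<le> dev_size \<sigma> \<sigma>'"
  unfolding dev_size_def by (intro add_nonneg_nonneg sum_nonneg) auto

lemma overlap_dev_le_dev_size: "\<bar>overlap_dev s \<sigma> \<sigma>'\<bar> + 1 / real N \<le> dev_size \<sigma> \<sigma>'"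
  unfolding dev_size_def
  using member_le_sum[of s UNIV "\<lambda>s. \<bar>overlap_dev s \<sigma> \<sigma>'\<bar>"] by simp

lemma overlap_dev_commute: "overlap_dev s \<sigma> \<sigma>' = overlap_dev s \<sigma>' \<sigma>"
  by (simp add: overlap_dev_def mult.commute)

lemma overlap_minus_q: "(overlap I \<tau> a b - q) $ s = overlap_dev s (\<tau> a) (\<tau> b)"
  by (simp add: overlap_def overlap_dev_def)

lemma abs_field_dev_le: "\<bar>field_dev p \<sigma> \<sigma>'\<bar> \<le> D_total * (\<Sum>s\<in>UNIV. \<bar>overlap_dev s \<sigma> \<sigma>'\<bar>)"
  unfolding field_dev_def sum_distrib_left
proof (intro order_trans[OF sum_abs] sum_mono)
  fix t
  have "D $ p $ t * lam $ t \<le> D_total * 1"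
    using D_nonneg lam D_le_D_total D_total_nonneg by (intro mult_mono) (auto intro: less_imp_le)
  moreover have "0 \<le> D $ p $ t * lam $ t" using D_nonneg lam(1) by (simp add: less_imp_le)
  ultimately show "\<bar>D $ p $ t * lam $ t * overlap_dev t \<sigma> \<sigma>'\<bar> \<le> D_total * \<bar>overlap_dev t \<sigma> \<sigma>'\<bar>"
    by (simp add: abs_mult[of "D $ p $ t * lam $ t"] mult_right_mono)
qed

end

context sk_cavity
begin

lemma overlap_dev_eq_cavity_dev:
  "overlap_dev s \<sigma> \<sigma>' = cavity_dev i s \<sigma> \<sigma>' + (if s = species i then \<sigma> i * \<sigma>' i / real (card (I s)) else 0)"
proof -
  have *: "i \<in> I s \<longleftrightarrow> s = species i" using species_iff[OF site, of s] by auto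
  show ?thesis
  proof (cases "s = species i")
    case True
    then have "(\<Sum>j\<in>I s. \<sigma> j * \<sigma>' j) = \<sigma> i * \<sigma>' i + (\<Sum>j\<in>I s - {i}. \<sigma> j * \<sigma>' j)"
      using * by (intro sum.remove finite_I) simp
    then show ?thesis using True by (simp add: overlap_dev_def cavity_dev_def add_divide_distrib)
  next
    case False
    then have "I s - {i} = I s" using * by auto
    then show ?thesis using False by (simp add: overlap_dev_def cavity_dev_def)
  qed
qed

lemma site_abs:
  assumes "\<sigma> \<in> configs N" "\<sigma>' \<in> configs N"
  shows "\<bar>\<sigma> i * \<sigma>' i\<bar> = 1"
  using config_abs[OF assms(1) site] config_abs[OF assms(2) site] by (simp add: abs_mult)

lemma cavity_dev_close:
  assumes s: "\<sigma> \<in> configs N" "\<sigma>' \<in> configs N"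
  shows "\<bar>cavity_dev i s \<sigma> \<sigma>' - overlap_dev s \<sigma> \<sigma>'\<bar> \<le> lam_inv / real N"
proof -
  have "\<bar>\<sigma> i * \<sigma>' i / real (card (I s))\<bar> \<le> lam_inv / real N"
    unfolding abs_divide site_abs[OF s] using inv_card_I_le[of s] by simp
  moreover have "0 \<le> lam_inv / real N" using lam_inv_ge(1) by simp
  ultimately show ?thesis
    unfolding overlap_dev_eq_cavity_dev by (cases "s = species i") simp_all
qed

lemma abs_cavity_dev_le:
  assumes s: "\<sigma> \<in> configs N" "\<sigma>' \<in> configs N"
  shows "\<bar>cavity_dev i s \<sigma> \<sigma>'\<bar> \<le> lam_inv * dev_size \<sigma> \<sigma>'"
proof -
  have "\<bar>cavity_dev i s \<sigma> \<sigma>'\<bar> \<le> 1 * \<bar>overlap_dev s \<sigma> \<sigma>'\<bar> + lam_inv * (1 / real N)"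
    using cavity_dev_close[OF s, of s] by simp
  also have "\<dots> \<le> lam_inv * \<bar>overlap_dev s \<sigma> \<sigma>'\<bar> + lam_inv * (1 / real N)"
    using lam_inv_ge(1) by (intro add_right_mono mult_right_mono) auto
  also have "\<dots> \<le> lam_inv * dev_size \<sigma> \<sigma>'"
    unfolding distrib_left[symmetric]
    using lam_inv_ge(1) overlap_dev_le_dev_size[of s] by (intro mult_left_mono) auto
  finally show ?thesis .
qed

lemma cavity_overlap_eq:
  assumes s: "\<sigma> \<in> configs N" "\<sigma>' \<in> configs N"
  shows "cavity_overlap i \<sigma> \<sigma>' = field_dev (species i) \<sigma> \<sigma>'
    - D $ species i $ species i * (\<sigma> i * \<sigma>' i) / real N"
proof -
  let ?p = "species i"
  have "(\<Sum>j\<in>{1..N}. D $ ?p $ species j * \<sigma> j * \<sigma>' j) = (\<Sum>t\<in>UNIV. \<Sum>j\<in>I t. D $ ?p $ species j * \<sigma> j * \<sigma>' j)"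
    using sum.group[of "{1..N}" UNIV species "\<lambda>j. D $ ?p $ species j * \<sigma> j * \<sigma>' j"]
    by (simp add: I_eq)
  also have "\<dots> = (\<Sum>t\<in>UNIV. D $ ?p $ t * (\<Sum>j\<in>I t. \<sigma> j * \<sigma>' j))"
  proof (intro sum.cong refl)
    fix t
    have "(\<Sum>j\<in>I t. D $ ?p $ species j * \<sigma> j * \<sigma>' j) = (\<Sum>j\<in>I t. D $ ?p $ t * (\<sigma> j * \<sigma>' j))"
      by (intro sum.cong refl) (simp add: I_eq mult.assoc)
    then show "(\<Sum>j\<in>I t. D $ ?p $ species j * \<sigma> j * \<sigma>' j) = D $ ?p $ t * (\<Sum>j\<in>I t. \<sigma> j * \<sigma>' j)"
      by (simp only: sum_distrib_left)
  qed
  also have "\<dots> = (\<Sum>t\<in>UNIV. D $ ?p $ t * (real (card (I t)) * (overlap_dev t \<sigma> \<sigma>' + q $ t)))"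
  proof (intro sum.cong refl)
    fix t
    show "D $ ?p $ t * (\<Sum>j\<in>I t. \<sigma> j * \<sigma>' j)
        = D $ ?p $ t * (real (card (I t)) * (overlap_dev t \<sigma> \<sigma>' + q $ t))"
      using card_I_pos[of t] by (simp add: overlap_dev_def)
  qed
  also have "\<dots> = (\<Sum>t\<in>UNIV. real N * (D $ ?p $ t * lam $ t * overlap_dev t \<sigma> \<sigma>' + D $ ?p $ t * lam $ t * q $ t))"
    by (simp only: card_I distrib_left mult_ac)
  also have "\<dots> = real N * (field_dev ?p \<sigma> \<sigma>' + field_var ?p)"
    by (simp only: sum_distrib_left[symmetric] sum.distrib field_dev_def field_var_def)
  finally have "(\<Sum>j\<in>{1..N}. D $ ?p $ species j * \<sigma> j * \<sigma>' j) = real N * (field_dev ?p \<sigma> \<sigma>' + field_var ?p)" .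
  then have "(\<Sum>j\<in>{1..N}-{i}. D $ ?p $ species j * \<sigma> j * \<sigma>' j)
     = real N * (field_dev ?p \<sigma> \<sigma>' + field_var ?p) - D $ ?p $ ?p * (\<sigma> i * \<sigma>' i)"
    unfolding sum.remove[OF finite_atLeastAtMost site] by (simp add: mult.assoc)
  then show ?thesis
    unfolding cavity_overlap_def using N_pos by (simp add: diff_divide_distrib)
qed

lemma cavity_overlap_close:
  assumes s: "\<sigma> \<in> configs N" "\<sigma>' \<in> configs N"
  shows "\<bar>cavity_overlap i \<sigma> \<sigma>' - field_dev (species i) \<sigma> \<sigma>'\<bar> \<le> D_total / real N"
  unfolding cavity_overlap_eq[OF s]
  using site_abs[OF s] D_nonneg D_le_D_total by (simp add: abs_mult divide_right_mono)

lemma abs_cavity_overlap_le_dev: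
  assumes s: "\<sigma> \<in> configs N" "\<sigma>' \<in> configs N"
  shows "\<bar>cavity_overlap i \<sigma> \<sigma>'\<bar> \<le> D_total * dev_size \<sigma> \<sigma>'"
  using cavity_overlap_close[OF s] abs_field_dev_le[of "species i" \<sigma> \<sigma>']
  unfolding dev_size_def distrib_left by simp

lemma abs_cavity_cov_le_dev:
  assumes s: "\<sigma> \<in> configs N" "\<sigma>' \<in> configs N"
  shows "\<bar>cavity_cov i \<sigma> \<sigma>'\<bar> \<le> \<beta>\<^sup>2 * D_total * dev_size \<sigma> \<sigma>'"
proof -
  have "\<bar>cavity_cov i \<sigma> \<sigma>'\<bar> = \<beta>\<^sup>2 * \<bar>\<sigma> i * \<sigma>' i\<bar> * \<bar>cavity_overlap i \<sigma> \<sigma>'\<bar>"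
    unfolding cavity_cov_def by (simp add: abs_mult)
  then show ?thesis
    using mult_left_mono[OF abs_cavity_overlap_le_dev[OF s], of "\<beta>\<^sup>2"]
    unfolding site_abs[OF s] by (simp add: mult.assoc)
qed

definition dev_sum :: "nat \<Rightarrow> (nat \<Rightarrow> nat \<Rightarrow> real) \<Rightarrow> real" where
  "dev_sum n \<tau> = (\<Sum>x\<in>replica_pairs n. dev_size (\<tau> (fst x)) (\<tau> (snd x)))"

lemma dev_sum_nonneg: "0 \<le> dev_sum n \<tau>"
  unfolding dev_sum_def by (intro sum_nonneg dev_size_nonneg)

lemma abs_J_le_dev_sum:
  assumes t: "\<tau> \<in> {1..m} \<rightarrow>\<^sub>E configs N" and m: "n + 2 \<le> m"
  shows "\<bar>J n \<tau>\<bar> \<le> (real n + 2)\<^sup>2 * (\<beta>\<^sup>2 * D_total) * dev_sum (n + 2) \<tau>"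
  unfolding pair_interaction_pairs dev_sum_def sum_distrib_left
proof (intro order_trans[OF sum_abs] sum_mono)
  fix x assume "x \<in> replica_pairs (n + 2)"
  then have "\<tau> (fst x) \<in> configs N" "\<tau> (snd x) \<in> configs N"
    using t m by (auto simp: replica_pairs_def PiE_iff)
  then show "\<bar>pair_coeff n (fst x) (snd x) * cavity_cov i (\<tau> (fst x)) (\<tau> (snd x))\<bar>
      \<le> (real n + 2)\<^sup>2 * (\<beta>\<^sup>2 * D_total) * dev_size (\<tau> (fst x)) (\<tau> (snd x))"
    unfolding abs_mult[of "pair_coeff _ _ _"] mult.assoc[of "(real n + 2)\<^sup>2"]
    by (intro mult_mono abs_pair_coeff_le abs_cavity_cov_le_dev) auto
qed

abbreviation "\<nu> \<equiv> nu \<beta> h N M g"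

lemma nu_mono:
  "(\<And>\<tau>. \<tau> \<in> {1..n} \<rightarrow>\<^sub>E configs N \<Longrightarrow> f \<tau> \<le> f' \<tau>) \<Longrightarrow> \<nu> n f \<le> \<nu> n f'"
  unfolding nu_eq_path by (rule quenched_mono)

lemma nu_add: "\<nu> n (\<lambda>\<tau>. f \<tau> + f' \<tau>) = \<nu> n f + \<nu> n f'"
  unfolding nu_eq_path by (rule quenched_add)

lemma nu_diff: "\<nu> n (\<lambda>\<tau>. f \<tau> - f' \<tau>) = \<nu> n f - \<nu> n f'"
  unfolding nu_eq_path by (rule quenched_diff)

lemma nu_cmult: "\<nu> n (\<lambda>\<tau>. b * f \<tau>) = b * \<nu> n f"
  unfolding nu_eq_path by (rule quenched_cmult)

lemma nu_sum: "\<nu> n (\<lambda>\<tau>. \<Sum>j\<in>A. f j \<tau>) = (\<Sum>j\<in>A. \<nu> n (f j))"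
  unfolding nu_eq_path by (rule quenched_sum)

lemma nu_const: "\<nu> n (\<lambda>_. b) = b"
  unfolding nu_eq_path by (rule quenched_const)

lemma nu_abs_le: "\<bar>\<nu> n f\<bar> \<le> \<nu> n (\<lambda>\<tau>. \<bar>f \<tau>\<bar>)"
  unfolding nu_eq_path by (rule quenched_abs_le)

lemma nu_rename:
  assumes "uses_replicas m f" "inj_on s {1..m}" "s ` {1..m} \<subseteq> {1..n}" "m \<le> n"
  shows "\<nu> n (\<lambda>\<tau>. f (\<lambda>l. \<tau> (s l))) = \<nu> m f"
  unfolding nu_eq_path quenched_rename[OF assms] quenched_more[OF assms(1,4)] ..

text \<open>By exchangeability all pairs of distinct replicas have the same third moment; products over
  different pairs are then reduced to it by \<open>mult3_le_cubes\<close>.\<close>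

lemma nu_dev_cube:
  assumes "a \<in> {1..n}" "b \<in> {1..n}" "a \<noteq> b"
  shows "\<nu> n (\<lambda>\<tau>. dev_size (\<tau> a) (\<tau> b) ^ 3) = \<nu> 2 (\<lambda>\<tau>. dev_size (\<tau> 1) (\<tau> 2) ^ 3)"
proof -
  let ?s = "\<lambda>l::nat. if l = 1 then a else b"
  have 12: "{1..2::nat} = {1, 2}" by auto
  have u: "uses_replicas 2 (\<lambda>\<tau>. dev_size (\<tau> 1) (\<tau> 2) ^ 3)"
    by (rule uses_replicas_at2[where F="\<lambda>\<sigma> \<sigma>'. dev_size \<sigma> \<sigma>' ^ 3"]) auto
  have "\<nu> n (\<lambda>\<tau>. dev_size (\<tau> (?s 1)) (\<tau> (?s 2)) ^ 3) = \<nu> 2 (\<lambda>\<tau>. dev_size (\<tau> 1) (\<tau> 2) ^ 3)"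
    using assms by (intro nu_rename[OF u]) (auto simp: 12 inj_on_def)
  then show ?thesis by simp
qed

lemma nu_dev_cube_le:
  assumes "a \<in> {1..n}" "b \<in> {1..n}" "a \<noteq> b"
  shows "\<nu> n (\<lambda>\<tau>. dev_size (\<tau> a) (\<tau> b) ^ 3) \<le> err"
  unfolding nu_dev_cube[OF assms] err_def by simp

lemma err_nonneg: "0 \<le> err"
proof -
  have "0 \<le> \<nu> 2 (\<lambda>\<tau>. dev_size (\<tau> 1) (\<tau> 2) ^ 3)"
    using nu_mono[of 2 "\<lambda>_. 0" "\<lambda>\<tau>. dev_size (\<tau> 1) (\<tau> 2) ^ 3"] dev_size_nonneg by (simp add: nu_const)
  then show ?thesis by (simp add: err_def)
qed

lemma nu_dev_over_N:
  assumes "x \<in> replica_pairs n"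
  shows "\<nu> n (\<lambda>\<tau>. 1 / real N * dev_size (\<tau> (fst x)) (\<tau> (snd x))) \<le> err"
proof -
  have "1 / real N * dev_size \<sigma> \<sigma>' \<le> real N powr (- 3 / 2) + dev_size \<sigma> \<sigma>' ^ 3" for \<sigma> \<sigma>'
  proof -
    have "(1 / real N) powr (3 / 2) = real N powr (- 3 / 2)"
      using N_pos by (simp add: powr_divide powr_minus_divide)
    then show ?thesis
      using mult_le_powr_add_cube[of "1 / real N" "dev_size \<sigma> \<sigma>'"] N_pos dev_size_nonneg by simp
  qed
  then have "\<nu> n (\<lambda>\<tau>. 1 / real N * dev_size (\<tau> (fst x)) (\<tau> (snd x)))
      \<le> \<nu> n (\<lambda>\<tau>. real N powr (- 3 / 2) + dev_size (\<tau> (fst x)) (\<tau> (snd x)) ^ 3)"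
    by (intro nu_mono)
  also have "\<dots> = err"
    unfolding nu_add nu_const err_def using assms
    by (subst nu_dev_cube) (auto simp: replica_pairs_def)
  finally show ?thesis .
qed

lemma nu_dev_three:
  assumes "x \<in> replica_pairs n" "y \<in> replica_pairs n" "z \<in> replica_pairs n"
  shows "\<nu> n (\<lambda>\<tau>. dev_size (\<tau> (fst x)) (\<tau> (snd x)) * dev_size (\<tau> (fst y)) (\<tau> (snd y))
           * dev_size (\<tau> (fst z)) (\<tau> (snd z))) \<le> 3 * err"
proof -
  have "\<nu> n (\<lambda>\<tau>. dev_size (\<tau> (fst x)) (\<tau> (snd x)) * dev_size (\<tau> (fst y)) (\<tau> (snd y))
           * dev_size (\<tau> (fst z)) (\<tau> (snd z)))
     \<le> \<nu> n (\<lambda>\<tau>. dev_size (\<tau> (fst x)) (\<tau> (snd x)) ^ 3 + dev_size (\<tau> (fst y)) (\<tau> (snd y)) ^ 3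
           + dev_size (\<tau> (fst z)) (\<tau> (snd z)) ^ 3)"
    by (intro nu_mono mult3_le_cubes dev_size_nonneg)
  also have "\<dots> \<le> err + err + err"
    unfolding nu_add using assms by (intro add_mono nu_dev_cube_le) (auto simp: replica_pairs_def)
  finally show ?thesis by simp
qed

lemma replica_pairs_mono: "m \<le> n \<Longrightarrow> x \<in> replica_pairs m \<Longrightarrow> x \<in> replica_pairs n"
  by (auto simp: replica_pairs_def)

lemma sum_replica_pairs_le:
  assumes "\<And>x. x \<in> replica_pairs m \<Longrightarrow> F x \<le> C" "0 \<le> C"
  shows "(\<Sum>x\<in>replica_pairs m. F x) \<le> (real m)\<^sup>2 * C"
proof -
  have "(\<Sum>x\<in>replica_pairs m. F x) \<le> real (card (replica_pairs m)) * C"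
    using assms(1) by (rule sum_bounded_above)
  also have "\<dots> \<le> (real m)\<^sup>2 * C" by (intro mult_right_mono card_replica_pairs_le assms(2))
  finally show ?thesis .
qed

lemma nu_dev_sum_over_N:
  assumes "m \<le> n"
  shows "\<nu> n (\<lambda>\<tau>. 1 / real N * dev_sum m \<tau>) \<le> (real m)\<^sup>2 * err"
  unfolding dev_sum_def sum_distrib_left nu_sum
  by (intro sum_replica_pairs_le nu_dev_over_N err_nonneg replica_pairs_mono[OF assms])

lemma nu_dev_dev_sum:
  assumes "m \<le> n" "x \<in> replica_pairs n" "y \<in> replica_pairs n"
  shows "\<nu> n (\<lambda>\<tau>. dev_size (\<tau> (fst x)) (\<tau> (snd x)) * dev_size (\<tau> (fst y)) (\<tau> (snd y)) * dev_sum m \<tau>)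
    \<le> (real m)\<^sup>2 * (3 * err)"
  unfolding dev_sum_def sum_distrib_left nu_sum
  by (intro sum_replica_pairs_le nu_dev_three assms replica_pairs_mono[OF assms(1)]) (simp_all add: err_nonneg)

lemma nu_dev_sum_dev_sum:
  assumes "m \<le> n" "m' \<le> n" "x \<in> replica_pairs n"
  shows "\<nu> n (\<lambda>\<tau>. dev_size (\<tau> (fst x)) (\<tau> (snd x)) * dev_sum m \<tau> * dev_sum m' \<tau>)
    \<le> (real m)\<^sup>2 * ((real m')\<^sup>2 * (3 * err))"
proof -
  have "\<nu> n (\<lambda>\<tau>. dev_size (\<tau> (fst x)) (\<tau> (snd x)) * dev_sum m \<tau> * dev_sum m' \<tau>)
     = (\<Sum>y\<in>replica_pairs m. \<nu> n (\<lambda>\<tau>. dev_size (\<tau> (fst x)) (\<tau> (snd x))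
          * dev_size (\<tau> (fst y)) (\<tau> (snd y)) * dev_sum m' \<tau>))"
    unfolding dev_sum_def[of m] sum_distrib_left sum_distrib_right nu_sum ..
  also have "\<dots> \<le> (real m)\<^sup>2 * ((real m')\<^sup>2 * (3 * err))"
    by (intro sum_replica_pairs_le nu_dev_dev_sum assms replica_pairs_mono[OF assms(1)])
      (simp_all add: err_nonneg)
  finally show ?thesis .
qed

end

section \<open>The cavity expansion at one site\<close>

text \<open>The replicas whose spin survives in $\varepsilon_1\varepsilon_2\varepsilon_a\varepsilon_b$,
  squares of spins being \<open>1\<close>.\<close>

definition odd_replicas :: "nat \<Rightarrow> nat \<Rightarrow> nat set" where
  "odd_replicas a b = ({1, 2} - {a, b}) \<union> ({a, b} - {1, 2})"

lemma prod_four_spins: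
  fixes e :: "nat \<Rightarrow> real"
  assumes e: "e 1 * e 1 = 1" "e 2 * e 2 = 1" and ab: "a \<noteq> b"
  shows "e 1 * e 2 * (e a * e b) = (\<Prod>l\<in>odd_replicas a b. e l)"
proof -
  have d: "e 1 * (e 1 * x) = x" "e 2 * (e 2 * x) = x" for x
    using e by (metis mult.assoc mult_1_left)+
  consider "a = 1" "b = 2" | "a = 2" "b = 1" | "a = 1" "b \<noteq> 2" | "a = 2" "b \<noteq> 1"
    | "b = 1" "a \<noteq> 2" | "b = 2" "a \<noteq> 1" | "a \<noteq> 1" "a \<noteq> 2" "b \<noteq> 1" "b \<noteq> 2"
    by blast
  then show ?thesis
  proof cases
    case 1
    then have "odd_replicas a b = {}" by (auto simp: odd_replicas_def)
    then show ?thesis using 1 e d by (simp add: mult_ac)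
  next
    case 2
    then have "odd_replicas a b = {}" by (auto simp: odd_replicas_def)
    then show ?thesis using 2 e d by (simp add: mult_ac)
  next
    case 3
    then have "odd_replicas a b = {2, b}" using ab by (auto simp: odd_replicas_def)
    then show ?thesis using 3 d by (simp add: mult_ac)
  next
    case 4
    then have "odd_replicas a b = {1, b}" using ab by (auto simp: odd_replicas_def)
    then show ?thesis using 4 d by (simp add: mult_ac)
  next
    case 5
    then have "odd_replicas a b = {2, a}" using ab by (auto simp: odd_replicas_def)
    then show ?thesis using 5 d by (simp add: mult_ac)
  next
    case 6
    then have "odd_replicas a b = {1, a}" using ab by (auto simp: odd_replicas_def)
    then show ?thesis using 6 d by (simp add: mult_ac)
  next
    case 7
    then have "odd_replicas a b = {1, 2, a, b}" using ab by (auto simp: odd_replicas_def)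
    then show ?thesis using 7 ab by (simp add: mult_ac)
  qed
qed

lemma abs_tanh_power_le: "\<bar>tanh (x::real) ^ n\<bar> \<le> 1"
  using tanh_real_lt_1[of x] tanh_real_gt_neg1[of x] unfolding power_abs by (intro power_le_one) auto

lemma borel_measurable_std_normal:
  "f \<in> borel_measurable borel \<Longrightarrow> f \<in> borel_measurable std_normal_distribution"
  by simp

context sk_system
begin

text \<open>The moments of the spin in its limiting field; the second one is \<open>q\<close> and the fourth one is
  the vector written $\hat q$.\<close>

definition tanh_mean :: "nat \<Rightarrow> 'm \<Rightarrow> real" where
  "tanh_mean j p = (\<integral>y. tanh (\<beta> * sqrt (field_var p) * y + h) ^ j \<partial>std_normal_distribution)"

lemma tanh_moment_eq: "tanh_moment j \<beta> h D lam q $ p = tanh_mean j p"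
proof -
  have "((D ** diag lam) *v q) $ p = field_var p"
  proof -
    have "(D ** diag lam) $ p $ t = D $ p $ t * lam $ t" for t
    proof -
      have "(D ** diag lam) $ p $ t = (\<Sum>k\<in>UNIV. D $ p $ k * (if k = t then lam $ k else 0))"
        by (simp add: matrix_matrix_mult_def diag_def)
      also have "\<dots> = (\<Sum>k\<in>UNIV. if k = t then D $ p $ k * lam $ k else 0)"
        by (rule sum.cong) auto
      also have "\<dots> = D $ p $ t * lam $ t"
        by (simp only: sum.delta finite_class.finite_UNIV UNIV_I if_True)
      finally show ?thesis .
    qed
    then show ?thesis by (simp add: matrix_vector_mult_def field_var_def)
  qed
  then show ?thesis by (simp add: tanh_moment_def tanh_mean_def mult_ac)
qed

lemma tanh_mean_2: "tanh_mean 2 p = q $ p"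
  using rs tanh_moment_eq[of 2 p] by (simp add: rs_solution_def)

lemma tanh_mean_0: "tanh_mean 0 p = 1"
  using prob_space.prob_space[OF prob_space_std_normal] by (simp add: tanh_mean_def)

lemma abs_tanh_mean_le: "\<bar>tanh_mean j p\<bar> \<le> 1"
proof -
  interpret prob_space std_normal_distribution by (rule prob_space_std_normal)
  have "integrable std_normal_distribution (\<lambda>y. tanh (\<beta> * sqrt (field_var p) * y + h) ^ j)"
  proof (rule integrable_const_bound[where B=1])
    have "continuous_on UNIV (\<lambda>y::real. tanh (\<beta> * sqrt (field_var p) * y + h) ^ j)"
      by (intro continuous_on_power continuous_on_tanh continuous_on_add continuous_on_mult
          continuous_on_const continuous_on_id) simp
    then have "(\<lambda>y. tanh (\<beta> * sqrt (field_var p) * y + h) ^ j) \<in> borel_measurable borel"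
      by (rule borel_measurable_continuous_onI)
    then show "(\<lambda>y. tanh (\<beta> * sqrt (field_var p) * y + h) ^ j) \<in> borel_measurable std_normal_distribution"
      by (rule borel_measurable_std_normal)
    show "AE y in std_normal_distribution. norm (tanh (\<beta> * sqrt (field_var p) * y + h) ^ j) \<le> 1"
      by (intro AE_I2) (simp only: real_norm_def abs_tanh_power_le)
  qed
  moreover have "tanh (\<beta> * sqrt (field_var p) * y + h) ^ j \<le> 1" "- 1 \<le> tanh (\<beta> * sqrt (field_var p) * y + h) ^ j" for y
    using abs_tanh_power_le[of "\<beta> * sqrt (field_var p) * y + h" j] by linarith+
  ultimately show ?thesis
    unfolding tanh_mean_def abs_le_iff
    using integral_le_const[of _ 1] integral_ge_const[of _ "- 1"] by simp
qed

text \<open>In the decoupled system, the covariance of $\varepsilon_1\varepsilon_2$ and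
  $\varepsilon_a\varepsilon_b$.\<close>

definition spin_cov :: "'m \<Rightarrow> nat \<Rightarrow> nat \<Rightarrow> real" where
  "spin_cov p a b = tanh_mean (card (odd_replicas a b)) p - q $ p * q $ p"

lemma abs_spin_cov_le: "\<bar>spin_cov p a b\<bar> \<le> 2"
proof -
  have "0 \<le> q $ p * q $ p" "q $ p * q $ p \<le> 1"
    using q mult_le_one[OF q(2) q(1) q(2)] by auto
  then show ?thesis
    using abs_tanh_mean_le[of "card (odd_replicas a b)" p] unfolding spin_cov_def by linarith
qed

text \<open>The first-order term of the expansion at a site of species \<open>p\<close>, with all cavity quantities
  already replaced by full ones, and the contribution of the site to its own species. Only
  species occur in it, so it is the same for all sites of \<open>p\<close>. The observable uses \<open>4\<close> replicas in
  all cases, and the derivative adds two more.\<close>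

definition cavity_main :: "'m \<Rightarrow> 'm \<Rightarrow> nat \<Rightarrow> nat \<Rightarrow> real" where
  "cavity_main p r a b =
     \<beta>\<^sup>2 / 2 * (\<Sum>x\<in>replica_pairs 6. pair_coeff 4 (fst x) (snd x) * spin_cov p (fst x) (snd x) *
       nu \<beta> h N M g 6 (\<lambda>\<tau>. overlap_dev r (\<tau> a) (\<tau> b) * field_dev p (\<tau> (fst x)) (\<tau> (snd x))))
     + (if r = p then spin_cov p a b / real (card (I p)) else 0)"

text \<open>The constant of \<open>path_le_endpoint\<close> for the cavity path; like all constants below it
  involves only \<open>\<beta>\<close>, the variances and the ratios of the species.\<close>

definition growth :: "nat \<Rightarrow> real" where
  "growth n = exp (2 * (2 * \<beta>\<^sup>2 * D_total * (real n + 2) ^ 4))"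

text \<open>The three summands belong to \<open>cavity_diagonal\<close>, \<open>cavity_second_order\<close> and
  \<open>cavity_first_order_pair\<close>. The factors \<open>36\<close> and \<open>64\<close> bound the coefficients \<open>pair_coeff n\<close> for
  \<open>n = 4, 6\<close> or the number of pairs among \<open>6\<close> or \<open>8\<close> replicas, and \<open>3\<close> comes from
  \<open>mult3_le_cubes\<close>.\<close>

definition site_const :: real where
  "site_const =
     lam_inv * (2 * growth 6 * (2 * (36 * (\<beta>\<^sup>2 * D_total)))) * 36
     + 4 * growth 8 * (2 * lam_inv * (36 * (\<beta>\<^sup>2 * D_total)) * (64 * (\<beta>\<^sup>2 * D_total))) * (36 * (64 * 3))
     + \<beta>\<^sup>2 / 2 * (36 * (36 * 2 *
         (2 * growth 8 * (lam_inv * D_total * (64 * (\<beta>\<^sup>2 * D_total))) * (64 * 3)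
          + (lam_inv * D_total + D_total))))"

end

context sk_cavity
begin

lemma growth_eq: "exp (2 * J_bound n) = growth n"
  by (simp add: growth_def J_bound_def)

lemma growth_nonneg: "0 \<le> growth n"
  by (simp add: growth_def)

lemma spin_eq: "monomial i (0, 0) \<sigma> = \<sigma> i"
  by (simp add: monomial_def)

lemma cavity_dev_flip:
  "cavity_dev i s (\<sigma>(i := y)) \<sigma>' = cavity_dev i s \<sigma> \<sigma>'"
  "cavity_dev i s \<sigma> (\<sigma>'(i := y)) = cavity_dev i s \<sigma> \<sigma>'"
  unfolding cavity_dev_def by (auto intro!: sum.cong arg_cong2[where f="(-)"] arg_cong2[where f="(/)"])

lemma cavity_overlap_flip:
  "cavity_overlap i (\<sigma>(i := y)) \<sigma>' = cavity_overlap i \<sigma> \<sigma>'"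
  "cavity_overlap i \<sigma> (\<sigma>'(i := y)) = cavity_overlap i \<sigma> \<sigma>'"
  unfolding cavity_overlap_def by (auto intro!: sum.cong arg_cong2[where f="(-)"] arg_cong2[where f="(/)"])

abbreviation "\<nu>0 \<equiv> quenched (coupling i 0)"

lemma nu0_spins:
  assumes "A \<subseteq> {1..n}" and f: "\<And>\<tau> l. f (\<tau>(l := (\<tau> l)(i := - \<tau> l i))) = f \<tau>" and u: "uses_replicas n f"
  shows "\<nu>0 n (\<lambda>\<tau>. (\<Prod>l\<in>A. \<tau> l i) * f \<tau>) = tanh_mean (card A) (species i) * \<nu>0 n f"
  using quenched_spins[OF assms]
  by (simp add: spin_eq tanh_mean_def coupling_def)

lemma nu0_pair:
  assumes ab: "a \<in> {1..n}" "b \<in> {1..n}" "a \<noteq> b"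
    and f: "\<And>\<tau> l. f (\<tau>(l := (\<tau> l)(i := - \<tau> l i))) = f \<tau>" and u: "uses_replicas n f"
  shows "\<nu>0 n (\<lambda>\<tau>. (\<Prod>l\<in>{a, b}. \<tau> l i) * f \<tau>) = q $ species i * \<nu>0 n f"
proof -
  have "card {a, b} = 2" using ab(3) by simp
  moreover have "{a, b} \<subseteq> {1..n}" using ab by simp
  ultimately show ?thesis using nu0_spins[of "{a, b}" n f, OF _ f u] by (simp only: tanh_mean_2)
qed

text \<open>Repeated spins square to one, so only the replicas in \<open>odd_replicas a b\<close> count.\<close>

lemma nu0_centered_pair:
  assumes n: "2 \<le> n" and ab: "a \<in> {1..n}" "b \<in> {1..n}" "a \<noteq> b"
    and f: "\<And>\<tau> l. f (\<tau>(l := (\<tau> l)(i := - \<tau> l i))) = f \<tau>" and u: "uses_replicas n f"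
  shows "\<nu>0 n (\<lambda>\<tau>. (\<tau> 1 i * \<tau> 2 i - q $ species i) * (\<tau> a i * \<tau> b i) * f \<tau>)
    = spin_cov (species i) a b * \<nu>0 n f"
proof -
  let ?q = "q $ species i"
  have sub: "odd_replicas a b \<subseteq> {1..n}" using n ab by (auto simp: odd_replicas_def)
  have "\<nu>0 n (\<lambda>\<tau>. (\<tau> 1 i * \<tau> 2 i - ?q) * (\<tau> a i * \<tau> b i) * f \<tau>)
     = \<nu>0 n (\<lambda>\<tau>. (\<Prod>l\<in>odd_replicas a b. \<tau> l i) * f \<tau> - ?q * ((\<Prod>l\<in>{a, b}. \<tau> l i) * f \<tau>))"
  proof (rule quenched_cong)
    fix \<tau> :: "nat \<Rightarrow> nat \<Rightarrow> real" assume t: "\<tau> \<in> {1..n} \<rightarrow>\<^sub>E configs N"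
    have "\<tau> 1 i * \<tau> 1 i = 1" "\<tau> 2 i * \<tau> 2 i = 1"
      using t n by (auto intro!: config_square site simp: PiE_iff)
    from prod_four_spins[of "\<lambda>l. \<tau> l i", OF this ab(3)]
    show "(\<tau> 1 i * \<tau> 2 i - ?q) * (\<tau> a i * \<tau> b i) * f \<tau>
        = (\<Prod>l\<in>odd_replicas a b. \<tau> l i) * f \<tau> - ?q * ((\<Prod>l\<in>{a, b}. \<tau> l i) * f \<tau>)"
      using ab(3) by (simp add: left_diff_distrib)
  qed
  also have "\<dots> = spin_cov (species i) a b * \<nu>0 n f"
    unfolding quenched_diff quenched_cmult nu0_spins[OF sub f u] spin_cov_def
      nu0_pair[OF ab f u] by (simp only: left_diff_distrib mult.assoc)
  finally show ?thesis .
qed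

text \<open>The zeroth-order term vanishes because the second moment of the spin is \<open>q\<close>.\<close>

lemma nu0_centered:
  assumes n: "2 \<le> n"
    and f: "\<And>\<tau> l. f (\<tau>(l := (\<tau> l)(i := - \<tau> l i))) = f \<tau>" and u: "uses_replicas n f"
  shows "\<nu>0 n (\<lambda>\<tau>. (\<tau> 1 i * \<tau> 2 i - q $ species i) * f \<tau>) = 0"
proof -
  have "\<nu>0 n (\<lambda>\<tau>. (\<Prod>l\<in>{1, 2}. \<tau> l i) * f \<tau>) = q $ species i * \<nu>0 n f"
    using n by (intro nu0_pair f u) auto
  then show ?thesis by (simp add: left_diff_distrib quenched_diff quenched_cmult)
qed

lemma abs_centered_le:
  assumes "\<tau> \<in> {1..n :: nat} \<rightarrow>\<^sub>E configs N" "2 \<le> n"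
  shows "\<bar>\<tau> 1 i * \<tau> 2 i - q $ species i\<bar> \<le> 2"
proof -
  have "\<bar>\<tau> 1 i * \<tau> 2 i\<bar> = 1" using assms by (intro site_abs) (auto simp: PiE_iff)
  then show ?thesis using q[of "species i"] by linarith
qed

lemma replica_in_configs: "\<tau> \<in> {1..n} \<rightarrow>\<^sub>E configs N \<Longrightarrow> x \<in> replica_pairs n \<Longrightarrow>
   \<tau> (fst x) \<in> configs N \<and> \<tau> (snd x) \<in> configs N"
  by (auto simp: replica_pairs_def PiE_iff)

text \<open>The site's own spin inside the second overlap. This term carries a factor \<open>1 / N\<close>, so
  a first-order comparison with the decoupled system is enough.\<close>

lemma cavity_diagonal:
  assumes ab: "a \<in> {1..4}" "b \<in> {1..4}" "a \<noteq> b"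
  shows "1 / real N * \<bar>\<nu> 4 (\<lambda>\<tau>. (\<tau> 1 i * \<tau> 2 i - q $ species i) * (\<tau> a i * \<tau> b i)) - spin_cov (species i) a b\<bar>
    \<le> 2 * growth 6 * (2 * (36 * (\<beta>\<^sup>2 * D_total))) * 36 * err"
proof -
  let ?g = "\<lambda>\<tau>::nat \<Rightarrow> nat \<Rightarrow> real. (\<tau> 1 i * \<tau> 2 i - q $ species i) * (\<tau> a i * \<tau> b i)"
  let ?c = "2 * (36 * (\<beta>\<^sup>2 * D_total))"
  have c: "0 \<le> ?c" using D_total_nonneg by simp
  have u: "uses_replicas 4 ?g"
    using ab by (intro uses_replicas_mult uses_replicas_diff uses_replicas_const
        uses_replicas_at[where F="\<lambda>\<sigma>. \<sigma> i"]) auto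
  have "\<nu>0 4 ?g = spin_cov (species i) a b"
    using nu0_centered_pair[of 4 a b "\<lambda>_. 1"] ab by (simp add: uses_replicas_const quenched_const)
  then have "\<bar>\<nu> 4 ?g - spin_cov (species i) a b\<bar> \<le> 2 * growth 6 * \<nu> 6 (\<lambda>\<tau>. \<bar>?g \<tau> * J 4 \<tau>\<bar>)"
    using path_first_order[OF u, of "pi / 2"] by (simp add: nu_eq_path growth_eq)
  also have "\<dots> \<le> 2 * growth 6 * \<nu> 6 (\<lambda>\<tau>. ?c * dev_sum 6 \<tau>)"
  proof (intro mult_left_mono nu_mono)
    fix \<tau> :: "nat \<Rightarrow> nat \<Rightarrow> real" assume t: "\<tau> \<in> {1..6} \<rightarrow>\<^sub>E configs N"
    have "\<bar>\<tau> a i * \<tau> b i\<bar> = 1" using t ab by (intro site_abs) (auto simp: PiE_iff)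
    then have g: "\<bar>?g \<tau>\<bar> \<le> 2" using abs_centered_le[OF t] by (simp add: abs_mult)
    have "\<bar>?g \<tau> * J 4 \<tau>\<bar> = \<bar>?g \<tau>\<bar> * \<bar>J 4 \<tau>\<bar>" by (rule abs_mult)
    also have "\<dots> \<le> 2 * (36 * (\<beta>\<^sup>2 * D_total) * dev_sum 6 \<tau>)"
      using abs_J_le_dev_sum[OF t, of 4] by (intro mult_mono g) auto
    also have "\<dots> = ?c * dev_sum 6 \<tau>" by simp
    finally show "\<bar>?g \<tau> * J 4 \<tau>\<bar> \<le> ?c * dev_sum 6 \<tau>" .
  qed (simp add: growth_nonneg)
  finally have "\<bar>\<nu> 4 ?g - spin_cov (species i) a b\<bar> \<le> 2 * growth 6 * (?c * \<nu> 6 (dev_sum 6))"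
    by (simp only: nu_cmult)
  then have "1 / real N * \<bar>\<nu> 4 ?g - spin_cov (species i) a b\<bar>
      \<le> 1 / real N * (2 * growth 6 * (?c * \<nu> 6 (dev_sum 6)))"
    by (rule mult_left_mono) simp
  also have "\<dots> = 2 * growth 6 * ?c * \<nu> 6 (\<lambda>\<tau>. 1 / real N * dev_sum 6 \<tau>)"
    by (simp only: nu_cmult mult_ac)
  also have "\<dots> \<le> 2 * growth 6 * ?c * (36 * err)"
    using nu_dev_sum_over_N[of 6 6]
    by (intro mult_left_mono mult_nonneg_nonneg growth_nonneg zero_le_power2 D_total_nonneg) auto
  finally show ?thesis by (simp only: mult.assoc)
qed

text \<open>The first-order term of the expansion lives in the decoupled system. Two deviations are
  already present, so returning to the model and restoring the site each cost a
  further factor of the size of a deviation.\<close>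

lemma cavity_first_order_pair:
  assumes y: "y \<in> replica_pairs 4" and x: "x \<in> replica_pairs 6"
  shows "\<bar>\<nu>0 6 (\<lambda>\<tau>. cavity_dev i r (\<tau> (fst y)) (\<tau> (snd y)) * cavity_overlap i (\<tau> (fst x)) (\<tau> (snd x)))
      - \<nu> 6 (\<lambda>\<tau>. overlap_dev r (\<tau> (fst y)) (\<tau> (snd y)) * field_dev (species i) (\<tau> (fst x)) (\<tau> (snd x)))\<bar>
    \<le> (2 * growth 8 * (lam_inv * D_total * (64 * (\<beta>\<^sup>2 * D_total))) * (64 * 3)
          + (lam_inv * D_total + D_total)) * err"
proof -
  let ?P = "\<lambda>\<tau>. cavity_dev i r (\<tau> (fst y)) (\<tau> (snd y))"
  let ?Q = "\<lambda>\<tau>. cavity_overlap i (\<tau> (fst x)) (\<tau> (snd x))"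
  let ?Y = "\<lambda>\<tau>. overlap_dev r (\<tau> (fst y)) (\<tau> (snd y))"
  let ?W = "\<lambda>\<tau>. field_dev (species i) (\<tau> (fst x)) (\<tau> (snd x))"
  let ?dy = "\<lambda>\<tau>. dev_size (\<tau> (fst y)) (\<tau> (snd y))"
  let ?dx = "\<lambda>\<tau>. dev_size (\<tau> (fst x)) (\<tau> (snd x))"
  let ?c = "lam_inv * D_total * (64 * (\<beta>\<^sup>2 * D_total))"
  have y6: "y \<in> replica_pairs 6" using y by (rule replica_pairs_mono[rotated]) simp
  have y8: "y \<in> replica_pairs 8" using y by (rule replica_pairs_mono[rotated]) simp
  have x8: "x \<in> replica_pairs 8" using x by (rule replica_pairs_mono[rotated]) simp
  have li: "0 \<le> lam_inv" using lam_inv_ge(1) by simp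
  have u: "uses_replicas 6 (\<lambda>\<tau>. ?P \<tau> * ?Q \<tau>)"
    using y6 x by (intro uses_replicas_mult uses_replicas_at2[where F="cavity_dev i r"]
        uses_replicas_at2[where F="cavity_overlap i"]) (auto simp: replica_pairs_def)
  have "\<bar>\<nu>0 6 (\<lambda>\<tau>. ?P \<tau> * ?Q \<tau>) - \<nu> 6 (\<lambda>\<tau>. ?P \<tau> * ?Q \<tau>)\<bar>
      \<le> 2 * growth 8 * \<nu> 8 (\<lambda>\<tau>. \<bar>?P \<tau> * ?Q \<tau> * J 6 \<tau>\<bar>)"
    using path_first_order[OF u, of "pi / 2"] by (simp add: nu_eq_path growth_eq abs_minus_commute)
  also have "\<dots> \<le> 2 * growth 8 * \<nu> 8 (\<lambda>\<tau>. ?c * (?dy \<tau> * ?dx \<tau> * dev_sum 8 \<tau>))"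
  proof (intro mult_left_mono nu_mono)
    fix \<tau> :: "nat \<Rightarrow> nat \<Rightarrow> real" assume t: "\<tau> \<in> {1..8} \<rightarrow>\<^sub>E configs N"
    have "\<bar>?P \<tau> * ?Q \<tau> * J 6 \<tau>\<bar> = \<bar>?P \<tau>\<bar> * \<bar>?Q \<tau>\<bar> * \<bar>J 6 \<tau>\<bar>"
      by (simp only: abs_mult)
    also have "\<dots> \<le> lam_inv * ?dy \<tau> * (D_total * ?dx \<tau>) * (64 * (\<beta>\<^sup>2 * D_total) * dev_sum 8 \<tau>)"
      using replica_in_configs[OF t y8] replica_in_configs[OF t x8] abs_J_le_dev_sum[OF t, of 6]
      by (intro mult_mono abs_cavity_dev_le abs_cavity_overlap_le_dev mult_nonneg_nonneg
          li D_total_nonneg dev_size_nonneg) auto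
    also have "\<dots> = ?c * (?dy \<tau> * ?dx \<tau> * dev_sum 8 \<tau>)" by simp
    finally show "\<bar>?P \<tau> * ?Q \<tau> * J 6 \<tau>\<bar> \<le> ?c * (?dy \<tau> * ?dx \<tau> * dev_sum 8 \<tau>)" .
  qed (simp add: growth_nonneg)
  also have "\<dots> \<le> 2 * growth 8 * (?c * (64 * (3 * err)))"
    unfolding nu_cmult using nu_dev_dev_sum[of 8 8 y x] y8 x8
    by (intro mult_left_mono mult_nonneg_nonneg growth_nonneg zero_le_power2 D_total_nonneg li) auto
  finally have A: "\<bar>\<nu>0 6 (\<lambda>\<tau>. ?P \<tau> * ?Q \<tau>) - \<nu> 6 (\<lambda>\<tau>. ?P \<tau> * ?Q \<tau>)\<bar>
      \<le> 2 * growth 8 * (?c * (64 * (3 * err)))" .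
  have "\<bar>\<nu> 6 (\<lambda>\<tau>. ?P \<tau> * ?Q \<tau>) - \<nu> 6 (\<lambda>\<tau>. ?Y \<tau> * ?W \<tau>)\<bar>
      \<le> \<nu> 6 (\<lambda>\<tau>. \<bar>?P \<tau> * ?Q \<tau> - ?Y \<tau> * ?W \<tau>\<bar>)"
    unfolding nu_diff[symmetric] by (rule nu_abs_le)
  also have "\<dots> \<le> \<nu> 6 (\<lambda>\<tau>. lam_inv * D_total * (1 / real N * ?dx \<tau>) + D_total * (1 / real N * ?dy \<tau>))"
  proof (rule nu_mono)
    fix \<tau> :: "nat \<Rightarrow> nat \<Rightarrow> real" assume t: "\<tau> \<in> {1..6} \<rightarrow>\<^sub>E configs N"
    note cy = replica_in_configs[OF t y6] and cx = replica_in_configs[OF t x]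
    have split: "?P \<tau> * ?Q \<tau> - ?Y \<tau> * ?W \<tau> = (?P \<tau> - ?Y \<tau>) * ?Q \<tau> + (?Q \<tau> - ?W \<tau>) * ?Y \<tau>"
      by (simp add: algebra_simps)
    have "\<bar>?P \<tau> * ?Q \<tau> - ?Y \<tau> * ?W \<tau>\<bar> \<le> \<bar>?P \<tau> - ?Y \<tau>\<bar> * \<bar>?Q \<tau>\<bar> + \<bar>?Q \<tau> - ?W \<tau>\<bar> * \<bar>?Y \<tau>\<bar>"
      unfolding split by (rule order_trans[OF abs_triangle_ineq]) (simp only: abs_mult order_refl)
    also have "\<dots> \<le> lam_inv / real N * (D_total * ?dx \<tau>) + D_total / real N * ?dy \<tau>"
    proof (rule add_mono)
      have P: "\<bar>?P \<tau> - ?Y \<tau>\<bar> \<le> lam_inv / real N" using cy by (intro cavity_dev_close) auto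
      have Q: "\<bar>?Q \<tau>\<bar> \<le> D_total * ?dx \<tau>" using cx by (intro abs_cavity_overlap_le_dev) auto
      have W: "\<bar>?Q \<tau> - ?W \<tau>\<bar> \<le> D_total / real N" using cx by (intro cavity_overlap_close) auto
      have "0 \<le> 1 / real N" by simp
      then have Y: "\<bar>?Y \<tau>\<bar> \<le> ?dy \<tau>"
        using overlap_dev_le_dev_size[of r "\<tau> (fst y)" "\<tau> (snd y)"] by linarith
      show "\<bar>?P \<tau> - ?Y \<tau>\<bar> * \<bar>?Q \<tau>\<bar> \<le> lam_inv / real N * (D_total * ?dx \<tau>)"
        by (rule mult_mono[OF P Q]) (simp_all add: li)
      show "\<bar>?Q \<tau> - ?W \<tau>\<bar> * \<bar>?Y \<tau>\<bar> \<le> D_total / real N * ?dy \<tau>"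
        by (rule mult_mono[OF W Y]) (simp_all add: D_total_nonneg)
    qed
    also have "\<dots> = lam_inv * D_total * (1 / real N * ?dx \<tau>) + D_total * (1 / real N * ?dy \<tau>)" by simp
    finally show "\<bar>?P \<tau> * ?Q \<tau> - ?Y \<tau> * ?W \<tau>\<bar>
      \<le> lam_inv * D_total * (1 / real N * ?dx \<tau>) + D_total * (1 / real N * ?dy \<tau>)" .
  qed
  also have "\<dots> \<le> lam_inv * D_total * err + D_total * err"
    unfolding nu_add nu_cmult[of 6 "lam_inv * D_total"] nu_cmult[of 6 D_total]
    using li D_total_nonneg by (intro add_mono mult_left_mono nu_dev_over_N x y6) auto
  finally have B: "\<bar>\<nu> 6 (\<lambda>\<tau>. ?P \<tau> * ?Q \<tau>) - \<nu> 6 (\<lambda>\<tau>. ?Y \<tau> * ?W \<tau>)\<bar> \<le> lam_inv * D_total * err + D_total * err" .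
  have "\<bar>\<nu>0 6 (\<lambda>\<tau>. ?P \<tau> * ?Q \<tau>) - \<nu> 6 (\<lambda>\<tau>. ?Y \<tau> * ?W \<tau>)\<bar>
      \<le> 2 * growth 8 * (?c * (64 * (3 * err))) + (lam_inv * D_total * err + D_total * err)"
    using A B by linarith
  then show ?thesis by (simp only: distrib_right mult.assoc)
qed

text \<open>One deviation is present in the observable, and the remainder of second order contributes two
  more.\<close>

lemma cavity_second_order:
  assumes y: "y \<in> replica_pairs 4"
  shows "\<bar>\<nu> 4 (\<lambda>\<tau>. (\<tau> 1 i * \<tau> 2 i - q $ species i) * cavity_dev i r (\<tau> (fst y)) (\<tau> (snd y)))
     - \<beta>\<^sup>2 / 2 * (\<Sum>x\<in>replica_pairs 6. pair_coeff 4 (fst x) (snd x) * spin_cov (species i) (fst x) (snd x) *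
       \<nu>0 6 (\<lambda>\<tau>. cavity_dev i r (\<tau> (fst y)) (\<tau> (snd y)) * cavity_overlap i (\<tau> (fst x)) (\<tau> (snd x))))\<bar>
   \<le> 4 * growth 8 * (2 * lam_inv * (36 * (\<beta>\<^sup>2 * D_total)) * (64 * (\<beta>\<^sup>2 * D_total))) * (36 * (64 * 3)) * err"
proof -
  let ?e = "\<lambda>\<tau>::nat \<Rightarrow> nat \<Rightarrow> real. \<tau> 1 i * \<tau> 2 i - q $ species i"
  let ?P = "\<lambda>\<tau>. cavity_dev i r (\<tau> (fst y)) (\<tau> (snd y))"
  let ?Q = "\<lambda>x \<tau>. cavity_overlap i (\<tau> (fst x)) (\<tau> (snd x))"
  let ?f = "\<lambda>\<tau>. ?e \<tau> * ?P \<tau>"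
  let ?dy = "\<lambda>\<tau>. dev_size (\<tau> (fst y)) (\<tau> (snd y))"
  let ?c = "2 * lam_inv * (36 * (\<beta>\<^sup>2 * D_total)) * (64 * (\<beta>\<^sup>2 * D_total))"
  have y8: "y \<in> replica_pairs 8" using y by (rule replica_pairs_mono[rotated]) simp
  have li: "0 \<le> lam_inv" using lam_inv_ge(1) by simp
  have uP: "uses_replicas n ?P" if "4 \<le> n" for n
    using y that by (intro uses_replicas_at2[where F="cavity_dev i r"]) (auto simp: replica_pairs_def)
  have u: "uses_replicas 4 ?f"
    by (intro uses_replicas_mult uses_replicas_diff uses_replicas_const uP
        uses_replicas_at[where F="\<lambda>\<sigma>. \<sigma> i"]) auto
  have z: "\<nu>0 4 ?f = 0"
    by (intro nu0_centered uP) (simp_all add: cavity_dev_flip)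
  have "\<nu>0 6 (\<lambda>\<tau>. ?f \<tau> * J 4 \<tau>) = \<nu>0 6 (\<lambda>\<tau>. \<Sum>x\<in>replica_pairs 6. \<beta>\<^sup>2 * pair_coeff 4 (fst x) (snd x) *
      (?e \<tau> * (\<tau> (fst x) i * \<tau> (snd x) i) * (?P \<tau> * ?Q x \<tau>)))"
    unfolding pair_interaction_pairs sum_distrib_left cavity_cov_def by (simp add: mult_ac)
  also have "\<dots> = (\<Sum>x\<in>replica_pairs 6. \<beta>\<^sup>2 * (pair_coeff 4 (fst x) (snd x) * spin_cov (species i) (fst x) (snd x) *
      \<nu>0 6 (\<lambda>\<tau>. ?P \<tau> * ?Q x \<tau>)))"
    unfolding quenched_sum quenched_cmult
  proof (intro sum.cong refl)
    fix x assume x: "x \<in> replica_pairs 6"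
    have "\<nu>0 6 (\<lambda>\<tau>. ?e \<tau> * (\<tau> (fst x) i * \<tau> (snd x) i) * (?P \<tau> * ?Q x \<tau>))
        = spin_cov (species i) (fst x) (snd x) * \<nu>0 6 (\<lambda>\<tau>. ?P \<tau> * ?Q x \<tau>)"
    proof (rule nu0_centered_pair)
      show "uses_replicas 6 (\<lambda>\<tau>. ?P \<tau> * ?Q x \<tau>)"
        using x by (intro uses_replicas_mult uP uses_replicas_at2[where F="cavity_overlap i"])
          (auto simp: replica_pairs_def)
    qed (use x in \<open>auto simp: replica_pairs_def cavity_dev_flip cavity_overlap_flip\<close>)
    then show "\<beta>\<^sup>2 * pair_coeff 4 (fst x) (snd x) *
         \<nu>0 6 (\<lambda>\<tau>. ?e \<tau> * (\<tau> (fst x) i * \<tau> (snd x) i) * (?P \<tau> * ?Q x \<tau>))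
       = \<beta>\<^sup>2 * (pair_coeff 4 (fst x) (snd x) * spin_cov (species i) (fst x) (snd x) * \<nu>0 6 (\<lambda>\<tau>. ?P \<tau> * ?Q x \<tau>))"
      by (simp only: mult.assoc)
  qed
  finally have J: "\<nu>0 6 (\<lambda>\<tau>. ?f \<tau> * J 4 \<tau>) = \<beta>\<^sup>2 * (\<Sum>x\<in>replica_pairs 6. pair_coeff 4 (fst x) (snd x) *
      spin_cov (species i) (fst x) (snd x) * \<nu>0 6 (\<lambda>\<tau>. ?P \<tau> * ?Q x \<tau>))"
    by (simp only: sum_distrib_left)
  have "\<bar>\<nu> 4 ?f - (\<nu>0 4 ?f + 1 / 2 * \<nu>0 6 (\<lambda>\<tau>. ?f \<tau> * J 4 \<tau>))\<bar>
      \<le> 4 * growth 8 * \<nu> 8 (\<lambda>\<tau>. \<bar>?f \<tau> * J 4 \<tau> * J 6 \<tau>\<bar>)"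
    using path_second_order[OF u] by (simp add: nu_eq_path growth_eq)
  also have "\<dots> \<le> 4 * growth 8 * \<nu> 8 (\<lambda>\<tau>. ?c * (?dy \<tau> * dev_sum 6 \<tau> * dev_sum 8 \<tau>))"
  proof (intro mult_left_mono nu_mono)
    fix \<tau> :: "nat \<Rightarrow> nat \<Rightarrow> real" assume t: "\<tau> \<in> {1..8} \<rightarrow>\<^sub>E configs N"
    have "\<bar>?f \<tau> * J 4 \<tau> * J 6 \<tau>\<bar> = \<bar>?e \<tau>\<bar> * \<bar>?P \<tau>\<bar> * \<bar>J 4 \<tau>\<bar> * \<bar>J 6 \<tau>\<bar>"
      by (simp only: abs_mult)
    also have "\<dots> \<le> 2 * (lam_inv * ?dy \<tau>) * (36 * (\<beta>\<^sup>2 * D_total) * dev_sum 6 \<tau>)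
        * (64 * (\<beta>\<^sup>2 * D_total) * dev_sum 8 \<tau>)"
      using replica_in_configs[OF t y8] abs_J_le_dev_sum[OF t, of 4] abs_J_le_dev_sum[OF t, of 6]
        abs_centered_le[OF t]
      by (intro mult_mono abs_cavity_dev_le mult_nonneg_nonneg li D_total_nonneg dev_size_nonneg
          dev_sum_nonneg) auto
    also have "\<dots> = ?c * (?dy \<tau> * dev_sum 6 \<tau> * dev_sum 8 \<tau>)" by simp
    finally show "\<bar>?f \<tau> * J 4 \<tau> * J 6 \<tau>\<bar> \<le> ?c * (?dy \<tau> * dev_sum 6 \<tau> * dev_sum 8 \<tau>)" .
  qed (simp add: growth_nonneg)
  also have "\<dots> \<le> 4 * growth 8 * (?c * (36 * (64 * (3 * err))))"
    unfolding nu_cmult using nu_dev_sum_dev_sum[of 6 8 8 y] y8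
    by (intro mult_left_mono mult_nonneg_nonneg growth_nonneg zero_le_power2 D_total_nonneg li) auto
  finally show ?thesis
    unfolding z J by (simp only: mult.assoc add_0_left times_divide_eq_left mult_1_left)
qed

end

section \<open>The linear system of the overlap covariances\<close>

context sk_cavity
begin

lemma cavity_site:
  assumes y: "y \<in> replica_pairs 4"
  shows "\<bar>\<nu> 4 (\<lambda>\<tau>. (\<tau> 1 i * \<tau> 2 i - q $ species i) * overlap_dev r (\<tau> (fst y)) (\<tau> (snd y)))
     - cavity_main (species i) r (fst y) (snd y)\<bar> \<le> site_const * err"
proof -
  let ?p = "species i"
  let ?e = "\<lambda>\<tau>::nat \<Rightarrow> nat \<Rightarrow> real. \<tau> 1 i * \<tau> 2 i - q $ ?p"
  let ?P = "\<lambda>\<tau>. cavity_dev i r (\<tau> (fst y)) (\<tau> (snd y))"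
  let ?g = "\<lambda>\<tau>. ?e \<tau> * (\<tau> (fst y) i * \<tau> (snd y) i)"
  let ?w = "\<lambda>x. pair_coeff 4 (fst x) (snd x) * spin_cov ?p (fst x) (snd x)"
  let ?X0 = "\<lambda>x. \<nu>0 6 (\<lambda>\<tau>. ?P \<tau> * cavity_overlap i (\<tau> (fst x)) (\<tau> (snd x)))"
  let ?X1 = "\<lambda>x. \<nu> 6 (\<lambda>\<tau>. overlap_dev r (\<tau> (fst y)) (\<tau> (snd y)) * field_dev ?p (\<tau> (fst x)) (\<tau> (snd x)))"
  let ?s = "spin_cov ?p (fst y) (snd y)"
  let ?n = "real (card (I r))"
  let ?K1 = "2 * growth 6 * (2 * (36 * (\<beta>\<^sup>2 * D_total))) * 36"
  let ?K2 = "4 * growth 8 * (2 * lam_inv * (36 * (\<beta>\<^sup>2 * D_total)) * (64 * (\<beta>\<^sup>2 * D_total))) * (36 * (64 * 3))"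
  let ?K3 = "2 * growth 8 * (lam_inv * D_total * (64 * (\<beta>\<^sup>2 * D_total))) * (64 * 3) + (lam_inv * D_total + D_total)"
  have li: "0 \<le> lam_inv" using lam_inv_ge(1) by simp
  have split: "\<nu> 4 (\<lambda>\<tau>. ?e \<tau> * overlap_dev r (\<tau> (fst y)) (\<tau> (snd y)))
      = \<nu> 4 (\<lambda>\<tau>. ?e \<tau> * ?P \<tau>) + (if r = ?p then 1 / ?n * \<nu> 4 ?g else 0)"
  proof (cases "r = ?p")
    case True
    have "?e \<tau> * overlap_dev r (\<tau> (fst y)) (\<tau> (snd y)) = ?e \<tau> * ?P \<tau> + 1 / ?n * ?g \<tau>" for \<tau>
      unfolding overlap_dev_eq_cavity_dev using True by (simp add: distrib_left)
    then show ?thesis using True by (simp only: nu_add nu_cmult if_True refl)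
  next
    case False
    then show ?thesis unfolding overlap_dev_eq_cavity_dev by simp
  qed
  have diag: "\<bar>(if r = ?p then 1 / ?n * \<nu> 4 ?g else 0) - (if r = ?p then ?s / real (card (I ?p)) else 0)\<bar>
      \<le> lam_inv * (?K1 * err)"
  proof (cases "r = ?p")
    case True
    have "\<bar>1 / ?n * \<nu> 4 ?g - ?s / ?n\<bar> = 1 / ?n * \<bar>\<nu> 4 ?g - ?s\<bar>"
      by (simp add: diff_divide_distrib[symmetric])
    also have "\<dots> \<le> lam_inv / real N * \<bar>\<nu> 4 ?g - ?s\<bar>"
      by (intro mult_right_mono inv_card_I_le) simp
    also have "\<dots> = lam_inv * (1 / real N * \<bar>\<nu> 4 ?g - ?s\<bar>)" by simp
    also have "\<dots> \<le> lam_inv * (?K1 * err)"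
      using y by (intro mult_left_mono li cavity_diagonal) (auto simp: replica_pairs_def)
    finally show ?thesis using True by simp
  next
    case False
    then show ?thesis using li err_nonneg growth_nonneg D_total_nonneg by simp
  qed
  have "\<bar>(\<Sum>x\<in>replica_pairs 6. ?w x * ?X0 x) - (\<Sum>x\<in>replica_pairs 6. ?w x * ?X1 x)\<bar>
      \<le> (\<Sum>x\<in>replica_pairs 6. \<bar>?w x * (?X0 x - ?X1 x)\<bar>)"
    unfolding sum_subtractf[symmetric] right_diff_distrib[symmetric] by (rule sum_abs)
  also have "\<dots> \<le> (real 6)\<^sup>2 * (36 * 2 * (?K3 * err))"
  proof (rule sum_replica_pairs_le)
    fix x assume x: "x \<in> replica_pairs 6"
    have "\<bar>?w x\<bar> \<le> 36 * 2"
      unfolding abs_mult using abs_pair_coeff_le[of 4 "fst x" "snd x"]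
      by (intro mult_mono abs_spin_cov_le) auto
    then show "\<bar>?w x * (?X0 x - ?X1 x)\<bar> \<le> 36 * 2 * (?K3 * err)"
      unfolding abs_mult[of "?w x"] by (intro mult_mono cavity_first_order_pair y x) auto
  qed (use li err_nonneg growth_nonneg D_total_nonneg in simp)
  finally have S: "\<bar>(\<Sum>x\<in>replica_pairs 6. ?w x * ?X0 x) - (\<Sum>x\<in>replica_pairs 6. ?w x * ?X1 x)\<bar>
      \<le> 36 * (36 * 2 * (?K3 * err))" by simp
  have drift: "\<bar>\<beta>\<^sup>2 / 2 * (\<Sum>x\<in>replica_pairs 6. ?w x * ?X0 x) - \<beta>\<^sup>2 / 2 * (\<Sum>x\<in>replica_pairs 6. ?w x * ?X1 x)\<bar>
      \<le> \<beta>\<^sup>2 / 2 * (36 * (36 * 2 * (?K3 * err)))"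
    unfolding right_diff_distrib[symmetric] abs_mult[of "\<beta>\<^sup>2 / 2"]
    using mult_left_mono[OF S, of "\<beta>\<^sup>2 / 2"] by simp
  have "\<bar>\<nu> 4 (\<lambda>\<tau>. ?e \<tau> * overlap_dev r (\<tau> (fst y)) (\<tau> (snd y))) - cavity_main ?p r (fst y) (snd y)\<bar>
      \<le> lam_inv * (?K1 * err) + ?K2 * err + \<beta>\<^sup>2 / 2 * (36 * (36 * 2 * (?K3 * err)))"
    unfolding split cavity_main_def using diag drift cavity_second_order[OF y, of r] by linarith
  also have "\<dots> = site_const * err"
    unfolding site_const_def by (simp only: distrib_right mult.assoc)
  finally show ?thesis .
qed

end

context sk_system
begin

text \<open>The entries of the matrices $U(0)$, $U(1)$ and $U(2)$.\<close>

definition cov0 :: "'m \<Rightarrow> 'm \<Rightarrow> real" where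
  "cov0 t r = nu \<beta> h N M g 4 (\<lambda>\<tau>. overlap_dev t (\<tau> 1) (\<tau> 2) * overlap_dev r (\<tau> 3) (\<tau> 4))"

definition cov1 :: "'m \<Rightarrow> 'm \<Rightarrow> real" where
  "cov1 t r = nu \<beta> h N M g 3 (\<lambda>\<tau>. overlap_dev t (\<tau> 1) (\<tau> 2) * overlap_dev r (\<tau> 1) (\<tau> 3))"

definition cov2 :: "'m \<Rightarrow> 'm \<Rightarrow> real" where
  "cov2 t r = nu \<beta> h N M g 2 (\<lambda>\<tau>. overlap_dev t (\<tau> 1) (\<tau> 2) * overlap_dev r (\<tau> 1) (\<tau> 2))"

text \<open>Selects a value by the number of replicas that two pairs share.\<close>

definition by_pattern :: "nat \<Rightarrow> nat \<Rightarrow> nat \<Rightarrow> nat \<Rightarrow> real \<Rightarrow> real \<Rightarrow> real \<Rightarrow> real" where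
  "by_pattern a b c d x0 x1 x2 =
     (if {a, b} = {c, d} then x2 else if {a, b} \<inter> {c, d} = {} then x0 else x1)"

end

context sk_cavity
begin

text \<open>By exchangeability only the number of replicas that the two pairs share matters.\<close>

lemma nu_pair_pattern:
  assumes n: "4 \<le> n" and ab: "a \<in> {1..n}" "b \<in> {1..n}" "a \<noteq> b" and cd: "c \<in> {1..n}" "d \<in> {1..n}" "c \<noteq> d"
  shows "\<nu> n (\<lambda>\<tau>. overlap_dev t (\<tau> a) (\<tau> b) * overlap_dev r (\<tau> c) (\<tau> d))
    = by_pattern a b c d (cov0 t r) (cov1 t r) (cov2 t r)"
proof -
  let ?Y = overlap_dev
  have i: "{1..2::nat} = {1, 2}" "{1..3::nat} = {1, 2, 3}" "{1..4::nat} = {1, 2, 3, 4}" by auto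
  have same: "\<nu> n (\<lambda>\<tau>. ?Y t (\<tau> a) (\<tau> b) * ?Y r (\<tau> a) (\<tau> b)) = cov2 t r"
  proof -
    let ?s = "\<lambda>l::nat. if l = 1 then a else b"
    let ?f = "\<lambda>\<tau>. ?Y t (\<tau> 1) (\<tau> 2) * ?Y r (\<tau> 1) (\<tau> 2)"
    have u: "uses_replicas 2 ?f"
      by (intro uses_replicas_mult uses_replicas_at2[where F="?Y _"]) auto
    have "\<nu> n (\<lambda>\<tau>. ?f (\<lambda>l. \<tau> (?s l))) = \<nu> 2 ?f"
      using ab n by (intro nu_rename[OF u]) (auto simp: i inj_on_def)
    then show ?thesis by (simp add: cov2_def)
  qed
  have one: "\<nu> n (\<lambda>\<tau>. ?Y t (\<tau> x) (\<tau> y) * ?Y r (\<tau> x) (\<tau> z)) = cov1 t r"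
    if "x \<in> {1..n}" "y \<in> {1..n}" "z \<in> {1..n}" "x \<noteq> y" "x \<noteq> z" "y \<noteq> z" for x y z
  proof -
    let ?s = "\<lambda>l::nat. if l = 1 then x else if l = 2 then y else z"
    let ?f = "\<lambda>\<tau>. ?Y t (\<tau> 1) (\<tau> 2) * ?Y r (\<tau> 1) (\<tau> 3)"
    have u: "uses_replicas 3 ?f"
      by (intro uses_replicas_mult uses_replicas_at2[where F="?Y _"]) auto
    have "\<nu> n (\<lambda>\<tau>. ?f (\<lambda>l. \<tau> (?s l))) = \<nu> 3 ?f"
      using that n by (intro nu_rename[OF u]) (auto simp: i inj_on_def)
    then show ?thesis by (simp add: cov1_def)
  qed
  have none: "\<nu> n (\<lambda>\<tau>. ?Y t (\<tau> a) (\<tau> b) * ?Y r (\<tau> c) (\<tau> d)) = cov0 t r" if "{a, b} \<inter> {c, d} = {}"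
  proof -
    let ?s = "\<lambda>l::nat. if l = 1 then a else if l = 2 then b else if l = 3 then c else d"
    let ?f = "\<lambda>\<tau>. ?Y t (\<tau> 1) (\<tau> 2) * ?Y r (\<tau> 3) (\<tau> 4)"
    have u: "uses_replicas 4 ?f"
      by (intro uses_replicas_mult uses_replicas_at2[where F="?Y _"]) auto
    have "\<nu> n (\<lambda>\<tau>. ?f (\<lambda>l. \<tau> (?s l))) = \<nu> 4 ?f"
      using that n ab cd by (intro nu_rename[OF u]) (auto simp: i inj_on_def)
    then show ?thesis by (simp add: cov0_def)
  qed
  have swap: "(\<lambda>\<tau>. ?Y t (\<tau> a) (\<tau> b) * ?Y r (\<tau> c) (\<tau> d)) = (\<lambda>\<tau>. ?Y t (\<tau> a') (\<tau> b') * ?Y r (\<tau> c') (\<tau> d'))"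
    if "a' = a \<and> b' = b \<or> a' = b \<and> b' = a" "c' = c \<and> d' = d \<or> c' = d \<and> d' = c" for a' b' c' d'
    using that by (auto simp: overlap_dev_commute[of _ "_ b"] overlap_dev_commute[of _ "_ d"])
  consider "{a, b} = {c, d}" | "{a, b} \<inter> {c, d} = {}" | "a = c" "b \<noteq> d" | "a = d" "b \<noteq> c"
    | "b = c" "a \<noteq> d" | "b = d" "a \<noteq> c"
    by fastforce
  then show ?thesis
  proof cases
    case 1
    then have "(\<lambda>\<tau>. ?Y t (\<tau> a) (\<tau> b) * ?Y r (\<tau> c) (\<tau> d)) = (\<lambda>\<tau>. ?Y t (\<tau> a) (\<tau> b) * ?Y r (\<tau> a) (\<tau> b))"
      by (intro swap) (auto simp: doubleton_eq_iff)
    then show ?thesis using same 1 by (simp only: by_pattern_def if_True refl)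
  next
    case 2
    then have "{a, b} \<noteq> {c, d}" by auto
    then show ?thesis using none[OF 2] 2 by (simp only: by_pattern_def if_True if_False refl)
  next
    case 3
    then have "by_pattern a b c d (cov0 t r) (cov1 t r) (cov2 t r) = cov1 t r"
      by (auto simp: by_pattern_def doubleton_eq_iff)
    then show ?thesis using one[of a b d] 3 ab cd by simp
  next
    case 4
    then have "by_pattern a b c d (cov0 t r) (cov1 t r) (cov2 t r) = cov1 t r"
      by (auto simp: by_pattern_def doubleton_eq_iff)
    then show ?thesis using one[of a b c] 4 ab cd swap[of a b d c] by simp
  next
    case 5
    then have "by_pattern a b c d (cov0 t r) (cov1 t r) (cov2 t r) = cov1 t r"
      by (auto simp: by_pattern_def doubleton_eq_iff)
    then show ?thesis using one[of b a d] 5 ab cd swap[of b a c d] by simp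
  next
    case 6
    then have "by_pattern a b c d (cov0 t r) (cov1 t r) (cov2 t r) = cov1 t r"
      by (auto simp: by_pattern_def doubleton_eq_iff)
    then show ?thesis using one[of b a c] 6 ab cd swap[of b a d c] by simp
  qed
qed

end

context sk_system
begin

lemma some_cavity: "sk_cavity D lam q \<beta> h N I M g 1"
  using N_pos by unfold_locales auto

lemma site_cavity: "i \<in> {1..N} \<Longrightarrow> sk_cavity D lam q \<beta> h N I M g i"
  by unfold_locales

lemma spin_cov_pattern:
  assumes "a \<noteq> b"
  shows "spin_cov p a b = by_pattern a b 1 2 (tanh_mean 4 p - q $ p * q $ p) (q $ p - q $ p * q $ p) (1 - q $ p * q $ p)"
proof -
  consider "{a, b} = {1, 2}" | "{a, b} \<inter> {1, 2} = {}" | "a = 1" "b \<noteq> 2" | "a = 2" "b \<noteq> 1"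
    | "b = 1" "a \<noteq> 2" | "b = 2" "a \<noteq> 1"
    by fastforce
  then show ?thesis
  proof cases
    case 1
    then have "odd_replicas a b = {}" by (simp add: odd_replicas_def)
    then show ?thesis using 1 by (simp add: spin_cov_def by_pattern_def tanh_mean_0)
  next
    case 2
    then have "odd_replicas a b = {1, 2, a, b}" by (auto simp: odd_replicas_def)
    moreover have "card {1, 2, a, b} = 4" using 2 assms by (simp add: card_insert_if)
    ultimately show ?thesis using 2 by (auto simp: spin_cov_def by_pattern_def)
  next
    case 3
    then have "odd_replicas a b = {2, b}" "card {2, b} = 2" using assms by (auto simp: odd_replicas_def)
    then have "spin_cov p a b = q $ p - q $ p * q $ p" by (simp only: spin_cov_def tanh_mean_2)
    then show ?thesis using 3 assms by (auto simp: by_pattern_def doubleton_eq_iff)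
  next
    case 4
    then have "odd_replicas a b = {1, b}" "card {1, b} = 2" using assms by (auto simp: odd_replicas_def)
    then have "spin_cov p a b = q $ p - q $ p * q $ p" by (simp only: spin_cov_def tanh_mean_2)
    then show ?thesis using 4 assms by (auto simp: by_pattern_def doubleton_eq_iff)
  next
    case 5
    then have "odd_replicas a b = {2, a}" "card {2, a} = 2" using assms by (auto simp: odd_replicas_def)
    then have "spin_cov p a b = q $ p - q $ p * q $ p" by (simp only: spin_cov_def tanh_mean_2)
    then show ?thesis using 5 assms by (auto simp: by_pattern_def doubleton_eq_iff)
  next
    case 6
    then have "odd_replicas a b = {1, a}" "card {1, a} = 2" using assms by (auto simp: odd_replicas_def)
    then have "spin_cov p a b = q $ p - q $ p * q $ p" by (simp only: spin_cov_def tanh_mean_2)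
    then show ?thesis using 6 assms by (auto simp: by_pattern_def doubleton_eq_iff)
  qed
qed

text \<open>The entries of $\Delta^2\Lambda C$.\<close>

definition DL_mult :: "('m \<Rightarrow> 'm \<Rightarrow> real) \<Rightarrow> 'm \<Rightarrow> 'm \<Rightarrow> real" where
  "DL_mult C p r = (\<Sum>t\<in>UNIV. D $ p $ t * lam $ t * C t r)"

lemma nu_overlap_field_dev:
  assumes y: "a \<in> {1..4}" "b \<in> {1..4}" "a \<noteq> b" and x: "x \<in> replica_pairs 6"
  shows "nu \<beta> h N M g 6 (\<lambda>\<tau>. overlap_dev r (\<tau> a) (\<tau> b) * field_dev p (\<tau> (fst x)) (\<tau> (snd x)))
    = by_pattern (fst x) (snd x) a b (DL_mult cov0 p r) (DL_mult cov1 p r) (DL_mult cov2 p r)"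
proof -
  interpret sk_cavity D lam q \<beta> h N I M g 1 by (rule some_cavity)
  have "\<nu> 6 (\<lambda>\<tau>. overlap_dev r (\<tau> a) (\<tau> b) * field_dev p (\<tau> (fst x)) (\<tau> (snd x)))
     = \<nu> 6 (\<lambda>\<tau>. \<Sum>t\<in>UNIV. D $ p $ t * lam $ t *
         (overlap_dev t (\<tau> (fst x)) (\<tau> (snd x)) * overlap_dev r (\<tau> a) (\<tau> b)))"
    unfolding field_dev_def sum_distrib_left by (simp add: mult_ac)
  also have "\<dots> = (\<Sum>t\<in>UNIV. D $ p $ t * lam $ t * by_pattern (fst x) (snd x) a b (cov0 t r) (cov1 t r) (cov2 t r))"
    unfolding nu_sum nu_cmult using x y
    by (intro sum.cong refl arg_cong2[where f="(*)"] nu_pair_pattern) (auto simp: replica_pairs_def)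
  also have "\<dots> = by_pattern (fst x) (snd x) a b (DL_mult cov0 p r) (DL_mult cov1 p r) (DL_mult cov2 p r)"
    by (simp add: by_pattern_def DL_mult_def)
  finally show ?thesis .
qed

lemma cavity_main_pattern:
  assumes ab: "a \<in> {1..4}" "b \<in> {1..4}" "a \<noteq> b"
  shows "cavity_main p r a b = \<beta>\<^sup>2 / 2 * (\<Sum>l=1..6. \<Sum>l'=1..6. pair_coeff 4 l l' *
      by_pattern l l' 1 2 (tanh_mean 4 p - q $ p * q $ p) (q $ p - q $ p * q $ p) (1 - q $ p * q $ p) *
      by_pattern l l' a b (DL_mult cov0 p r) (DL_mult cov1 p r) (DL_mult cov2 p r))
    + (if r = p then spin_cov p a b / (lam $ p * real N) else 0)"
proof -
  have "(\<Sum>x\<in>replica_pairs 6. pair_coeff 4 (fst x) (snd x) * spin_cov p (fst x) (snd x) *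
       nu \<beta> h N M g 6 (\<lambda>\<tau>. overlap_dev r (\<tau> a) (\<tau> b) * field_dev p (\<tau> (fst x)) (\<tau> (snd x))))
    = (\<Sum>x\<in>replica_pairs 6. pair_coeff 4 (fst x) (snd x) *
      by_pattern (fst x) (snd x) 1 2 (tanh_mean 4 p - q $ p * q $ p) (q $ p - q $ p * q $ p) (1 - q $ p * q $ p) *
      by_pattern (fst x) (snd x) a b (DL_mult cov0 p r) (DL_mult cov1 p r) (DL_mult cov2 p r))"
  proof (intro sum.cong refl arg_cong2[where f="(*)"])
    fix x assume x: "x \<in> replica_pairs 6"
    show "spin_cov p (fst x) (snd x) = by_pattern (fst x) (snd x) 1 2
        (tanh_mean 4 p - q $ p * q $ p) (q $ p - q $ p * q $ p) (1 - q $ p * q $ p)"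
      using x by (intro spin_cov_pattern) (auto simp: replica_pairs_def)
    show "nu \<beta> h N M g 6 (\<lambda>\<tau>. overlap_dev r (\<tau> a) (\<tau> b) * field_dev p (\<tau> (fst x)) (\<tau> (snd x)))
      = by_pattern (fst x) (snd x) a b (DL_mult cov0 p r) (DL_mult cov1 p r) (DL_mult cov2 p r)"
      by (rule nu_overlap_field_dev[OF ab x])
  qed
  then show ?thesis
    unfolding cavity_main_def card_I
    by (subst sum_replica_pairs) (simp_all add: pair_coeff_def)
qed

lemma sum_to_6: "(\<Sum>l=1..6. F l) = F 1 + F 2 + F 3 + F 4 + F 5 + F (6::nat)" for F :: "nat \<Rightarrow> real"
proof -
  have "{1..6::nat} = {1, 2, 3, 4, 5, 6}" by auto
  then show ?thesis by simp
qed

abbreviation \<open>spin_cov2 p \<equiv> 1 - q $ p * q $ p\<close>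
abbreviation \<open>spin_cov1 p \<equiv> q $ p - q $ p * q $ p\<close>
abbreviation \<open>spin_cov0 p \<equiv> tanh_mean 4 p - q $ p * q $ p\<close>

text \<open>The sum is evaluated pair by pair. Over both orders of \<open>l, l'\<close>, two of the four original
  replicas have weight \<open>2\<close>, an original one and a new one \<open>-3\<close> or \<open>-5\<close>, and the two new ones \<open>20\<close>.\<close>

lemma cavity_main_12:
  "cavity_main p r 1 2 = \<beta>\<^sup>2 * (spin_cov2 p * DL_mult cov2 p r - 4 * spin_cov1 p * DL_mult cov1 p r + 3 * spin_cov0 p * DL_mult cov0 p r)
     + (if r = p then spin_cov2 p / (lam $ p * real N) else 0)"
  by (subst cavity_main_pattern)
    (simp_all add: sum_to_6 pair_coeff_def replica_coeff_def spin_cov_pattern by_pattern_def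
      doubleton_eq_iff, simp_all add: algebra_simps)

lemma cavity_main_13:
  "cavity_main p r 1 3 = \<beta>\<^sup>2 * (spin_cov1 p * DL_mult cov2 p r + (spin_cov2 p - 2 * spin_cov1 p - 3 * spin_cov0 p) * DL_mult cov1 p r
       + (6 * spin_cov0 p - 3 * spin_cov1 p) * DL_mult cov0 p r)
     + (if r = p then spin_cov1 p / (lam $ p * real N) else 0)"
  by (subst cavity_main_pattern)
    (simp_all add: sum_to_6 pair_coeff_def replica_coeff_def spin_cov_pattern by_pattern_def
      doubleton_eq_iff, simp_all add: algebra_simps)

lemma cavity_main_34:
  "cavity_main p r 3 4 = \<beta>\<^sup>2 * (spin_cov0 p * DL_mult cov2 p r + (4 * spin_cov1 p - 8 * spin_cov0 p) * DL_mult cov1 p r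
       + (spin_cov2 p - 8 * spin_cov1 p + 10 * spin_cov0 p) * DL_mult cov0 p r)
     + (if r = p then spin_cov0 p / (lam $ p * real N) else 0)"
  by (subst cavity_main_pattern)
    (simp_all add: sum_to_6 pair_coeff_def replica_coeff_def spin_cov_pattern by_pattern_def
      doubleton_eq_iff, simp_all add: algebra_simps)

text \<open>The overlap of species \<open>p\<close> is the average of \<open>\<tau> 1 i * \<tau> 2 i\<close> over its sites, and the bound at
  each site has the same main term and the same constant.\<close>

lemma nu_overlaps_main:
  assumes y: "a \<in> {1..4}" "b \<in> {1..4}" "a \<noteq> b"
  shows "\<bar>nu \<beta> h N M g 4 (\<lambda>\<tau>. overlap_dev p (\<tau> 1) (\<tau> 2) * overlap_dev r (\<tau> a) (\<tau> b)) - cavity_main p r a b\<bar>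
    \<le> site_const * err"
proof -
  interpret c: sk_cavity D lam q \<beta> h N I M g 1 by (rule some_cavity)
  let ?n = "real (card (I p))"
  let ?x = "\<lambda>i. nu \<beta> h N M g 4 (\<lambda>\<tau>. (\<tau> 1 i * \<tau> 2 i - q $ p) * overlap_dev r (\<tau> a) (\<tau> b))"
  have dev: "overlap_dev p \<sigma> \<sigma>' = (\<Sum>i\<in>I p. 1 / ?n * (\<sigma> i * \<sigma>' i - q $ p))" for \<sigma> \<sigma>'
    using card_I_pos[of p]
    by (simp add: overlap_dev_def sum_distrib_left[symmetric] sum_subtractf diff_divide_distrib
        sum_divide_distrib[symmetric])
  have "nu \<beta> h N M g 4 (\<lambda>\<tau>. overlap_dev p (\<tau> 1) (\<tau> 2) * overlap_dev r (\<tau> a) (\<tau> b)) = (\<Sum>i\<in>I p. 1 / ?n * ?x i)"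
    unfolding dev sum_distrib_right mult.assoc c.nu_sum c.nu_cmult ..
  moreover have "cavity_main p r a b = (\<Sum>i\<in>I p. 1 / ?n * cavity_main p r a b)"
    using card_I_pos[of p] by simp
  ultimately have "\<bar>nu \<beta> h N M g 4 (\<lambda>\<tau>. overlap_dev p (\<tau> 1) (\<tau> 2) * overlap_dev r (\<tau> a) (\<tau> b)) - cavity_main p r a b\<bar>
      = \<bar>\<Sum>i\<in>I p. 1 / ?n * (?x i - cavity_main p r a b)\<bar>"
    by (simp only: sum_subtractf right_diff_distrib)
  also have "\<dots> \<le> (\<Sum>i\<in>I p. 1 / ?n * (site_const * err))"
  proof (intro order_trans[OF sum_abs] sum_mono)
    fix i assume i: "i \<in> I p"
    then have iN: "i \<in> {1..N}" "species i = p" using I_eq[of p] by auto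
    interpret s: sk_cavity D lam q \<beta> h N I M g i by (rule site_cavity[OF iN(1)])
    have "\<bar>?x i - cavity_main p r a b\<bar> \<le> site_const * err"
      using s.cavity_site[of "(a, b)" r] y iN(2) by (simp add: replica_pairs_def)
    then show "\<bar>1 / ?n * (?x i - cavity_main p r a b)\<bar> \<le> 1 / ?n * (site_const * err)"
      unfolding abs_mult by (intro mult_mono) auto
  qed
  also have "\<dots> = site_const * err" using card_I_pos[of p] by simp
  finally show ?thesis .
qed

lemma cov_expansions:
  "\<bar>cov2 p r - cavity_main p r 1 2\<bar> \<le> site_const * err"
  "\<bar>cov1 p r - cavity_main p r 1 3\<bar> \<le> site_const * err"
  "\<bar>cov0 p r - cavity_main p r 3 4\<bar> \<le> site_const * err"
proof -
  interpret sk_cavity D lam q \<beta> h N I M g 1 by (rule some_cavity)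
  show "\<bar>cov2 p r - cavity_main p r 1 2\<bar> \<le> site_const * err"
    using nu_overlaps_main[of 1 2 p r] nu_pair_pattern[of 4 1 2 1 2 p r] by (simp add: by_pattern_def)
  show "\<bar>cov1 p r - cavity_main p r 1 3\<bar> \<le> site_const * err"
    using nu_overlaps_main[of 1 3 p r] nu_pair_pattern[of 4 1 2 1 3 p r]
    by (simp add: by_pattern_def doubleton_eq_iff)
  show "\<bar>cov0 p r - cavity_main p r 3 4\<bar> \<le> site_const * err"
    using nu_overlaps_main[of 3 4 p r] nu_pair_pattern[of 4 1 2 3 4 p r]
    by (simp add: by_pattern_def doubleton_eq_iff)
qed

end

section \<open>The matrix identities\<close>

lemma power3_sum_le:
  fixes x :: "'a \<Rightarrow> real"
  assumes A: "finite A" and x: "\<And>s. s \<in> A \<Longrightarrow> 0 \<le> x s"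
  shows "(\<Sum>s\<in>A. x s) ^ 3 \<le> real (card A) ^ 3 * (\<Sum>s\<in>A. x s ^ 3)"
proof (cases "A = {}")
  case False
  define m where "m = Max (x ` A)"
  have "m \<in> x ` A" using A False by (simp add: m_def)
  then obtain s where s: "s \<in> A" "m = x s" by auto
  have "x t \<le> m" if "t \<in> A" for t using A that by (simp add: m_def)
  then have "(\<Sum>s\<in>A. x s) \<le> real (card A) * m" by (rule sum_bounded_above)
  then have "(\<Sum>s\<in>A. x s) ^ 3 \<le> (real (card A) * m) ^ 3" using x by (intro power_mono sum_nonneg)
  also have "\<dots> = real (card A) ^ 3 * x s ^ 3" by (simp add: s power_mult_distrib)
  also have "\<dots> \<le> real (card A) ^ 3 * (\<Sum>s\<in>A. x s ^ 3)"
    using A x s(1) by (intro mult_left_mono member_le_sum[of s A "\<lambda>s. x s ^ 3"]) auto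
  finally show ?thesis .
qed simp

lemma power3_add_le:
  fixes a b :: real
  assumes "0 \<le> a" "0 \<le> b"
  shows "(a + b) ^ 3 \<le> 8 * (a ^ 3 + b ^ 3)"
proof -
  have "(a + b) ^ 3 \<le> (2 * max a b) ^ 3" using assms by (intro power_mono) auto
  also have "\<dots> = 8 * max a b ^ 3" by (simp add: power_mult_distrib)
  also have "\<dots> \<le> 8 * (a ^ 3 + b ^ 3)" using assms by (auto simp: max_def)
  finally show ?thesis .
qed

lemma diag_mult_nth: "(diag v ** A) $ p $ r = v $ p * A $ p $ r" for A :: "real ^ 'n ^ 'n"
proof -
  have "(diag v ** A) $ p $ r = (\<Sum>k\<in>UNIV. (if p = k then v $ p else 0) * A $ k $ r)"
    by (simp add: matrix_matrix_mult_def diag_def)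
  also have "\<dots> = (\<Sum>k\<in>UNIV. if p = k then v $ p * A $ k $ r else 0)"
    by (rule sum.cong) auto
  finally show ?thesis by (simp only: sum.delta' finite_class.finite_UNIV UNIV_I if_True)
qed

lemma mult_diag_nth: "(A ** diag v) $ p $ r = A $ p $ r * v $ r" for A :: "real ^ 'n ^ 'n"
proof -
  have "(A ** diag v) $ p $ r = (\<Sum>k\<in>UNIV. A $ p $ k * (if k = r then v $ k else 0))"
    by (simp add: matrix_matrix_mult_def diag_def)
  also have "\<dots> = (\<Sum>k\<in>UNIV. if k = r then A $ p $ k * v $ k else 0)"
    by (rule sum.cong) auto
  finally show ?thesis by (simp only: sum.delta finite_class.finite_UNIV UNIV_I if_True)
qed

lemma matrix_inv_diag:
  fixes v :: "real ^ 'n"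
  assumes "\<And>s. v $ s \<noteq> 0"
  shows "matrix_inv (diag v) = diag (\<chi> s. 1 / v $ s)"
proof -
  have d: "diag v ** diag (\<chi> s. 1 / v $ s) = mat 1" "diag (\<chi> s. 1 / v $ s) ** diag v = mat 1"
    using assms by (auto simp: vec_eq_iff diag_mult_nth) (auto simp: diag_def mat_def)
  show ?thesis unfolding matrix_inv_def
  proof (rule some_equality)
    fix B assume B: "diag v ** B = mat 1 \<and> B ** diag v = mat 1"
    have "B = B ** (diag v ** diag (\<chi> s. 1 / v $ s))" by (simp add: d)
    also have "\<dots> = diag (\<chi> s. 1 / v $ s)" unfolding matrix_mul_assoc using B by simp
    finally show "B = diag (\<chi> s. 1 / v $ s)" .
  qed (simp add: d)
qed

lemma diag_D_diag_mult_nth: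
  fixes D U :: "real ^ 'n ^ 'n"
  shows "(diag v ** D ** diag l ** U) $ p $ r = v $ p * (\<Sum>t\<in>UNIV. D $ p $ t * l $ t * U $ t $ r)"
proof -
  have "(diag v ** D ** diag l ** U) $ p $ r = (\<Sum>t\<in>UNIV. (diag v ** D ** diag l) $ p $ t * U $ t $ r)"
    by (simp add: matrix_matrix_mult_def)
  then show ?thesis by (simp add: mult_diag_nth diag_mult_nth sum_distrib_left mult.assoc)
qed

lemma one_minus_diag_D_diag_mult_nth:
  fixes D U :: "real ^ 'n ^ 'n"
  shows "((mat 1 - c *\<^sub>R (diag v ** D ** diag l)) ** U) $ p $ r
    = U $ p $ r - c * (v $ p * (\<Sum>t\<in>UNIV. D $ p $ t * l $ t * U $ t $ r))"
proof -
  have "((mat 1 - c *\<^sub>R W) ** U) $ p $ r = (mat 1 ** U) $ p $ r - c * (W ** U) $ p $ r" for W :: "real ^ 'n ^ 'n"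
    by (simp add: matrix_matrix_mult_def sum_subtractf left_diff_distrib sum_distrib_left mult.assoc)
  then show ?thesis by (simp only: diag_D_diag_mult_nth matrix_mul_lid)
qed

lemma diag_mult_matrix_inv_nth:
  assumes "\<And>s. l $ s \<noteq> 0"
  shows "(diag v ** matrix_inv (diag l)) $ p $ r = (if p = r then v $ p / l $ p else 0)"
  using assms by (simp add: matrix_inv_diag diag_mult_nth) (simp add: diag_def)

lemma transpose_sym_part: "transpose (sym_part A) = sym_part A"
  by (simp add: sym_part_def transpose_def vec_eq_iff add.commute)

lemma sym_part_nth: "sym_part A $ p $ r = (A $ p $ r + A $ r $ p) / 2"
  by (simp add: sym_part_def transpose_def)

text \<open>The remainder is the symmetric part of the error, whose entries are averages of two entries.\<close>

lemma sym_part_remainder: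
  assumes close: "\<And>p r. \<bar>A $ p $ r - B $ p $ r\<bar> \<le> C" and B: "sym_part B = B'"
  shows "\<exists>R. transpose R = R \<and> sym_part A = B' + R \<and> (\<forall>p r. \<bar>R $ p $ r\<bar> \<le> C)"
proof (intro exI conjI allI)
  show "transpose (sym_part (A - B)) = sym_part (A - B)" by (rule transpose_sym_part)
  show "sym_part A = B' + sym_part (A - B)"
    unfolding B[symmetric] by (simp add: vec_eq_iff sym_part_nth field_simps)
  show "\<bar>sym_part (A - B) $ p $ r\<bar> \<le> C" for p r
    using close[of p r] close[of r p] by (simp add: sym_part_nth abs_le_iff)
qed

lemma sym_part_diag_type:
  assumes "\<And>p r. p \<noteq> r \<Longrightarrow> A $ p $ r = 0"
  shows "sym_part A = A"
proof -
  have "A $ p $ r = A $ r $ p" for p r using assms[of p r] assms[of r p] by (cases "p = r") auto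
  then show ?thesis by (simp add: vec_eq_iff sym_part_nth)
qed

context sk_system
begin

text \<open>The sum of the deviations is cubed at the cost of a power of the number of species, and
  $N^{-3} \le N^{-3/2}$.\<close>

lemma err_le:
  "err \<le> 9 * real CARD('m) ^ 3 * (real N powr (- 3 / 2)
     + (\<Sum>s\<in>UNIV. nu \<beta> h N M g 2 (\<lambda>\<tau>. \<bar>overlap I \<tau> 1 2 $ s - q $ s\<bar> ^ 3)))"
proof -
  interpret sk_cavity D lam q \<beta> h N I M g 1 by (rule some_cavity)
  let ?m = "real CARD('m) ^ 3" and ?n = "real N powr (- 3 / 2)"
  let ?S = "\<Sum>s\<in>UNIV. \<nu> 2 (\<lambda>\<tau>. \<bar>overlap_dev s (\<tau> 1) (\<tau> 2)\<bar> ^ 3)"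
  have m1: "1 \<le> ?m" by (rule one_le_power) (use species_ge_2 in simp)
  have "(1 / real N) ^ 3 = real N powr (- 3)"
    using N_pos by (simp add: powr_minus_divide power_one_over powr_numeral)
  also have "\<dots> \<le> ?n" using N_pos by (intro powr_mono) auto
  finally have n: "(1 / real N) ^ 3 \<le> ?n" .
  have "\<nu> 2 (\<lambda>\<tau>. dev_size (\<tau> 1) (\<tau> 2) ^ 3)
      \<le> \<nu> 2 (\<lambda>\<tau>. 8 * ?m * (\<Sum>s\<in>UNIV. \<bar>overlap_dev s (\<tau> 1) (\<tau> 2)\<bar> ^ 3) + 8 * ?n)"
  proof (rule nu_mono)
    fix \<tau> :: "nat \<Rightarrow> nat \<Rightarrow> real"
    have "dev_size (\<tau> 1) (\<tau> 2) ^ 3 \<le> 8 * ((\<Sum>s\<in>UNIV. \<bar>overlap_dev s (\<tau> 1) (\<tau> 2)\<bar>) ^ 3 + (1 / real N) ^ 3)"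
      unfolding dev_size_def by (intro power3_add_le sum_nonneg) auto
    also have "\<dots> \<le> 8 * (?m * (\<Sum>s\<in>UNIV. \<bar>overlap_dev s (\<tau> 1) (\<tau> 2)\<bar> ^ 3) + ?n)"
      by (intro mult_left_mono add_mono power3_sum_le n) auto
    finally show "dev_size (\<tau> 1) (\<tau> 2) ^ 3
        \<le> 8 * ?m * (\<Sum>s\<in>UNIV. \<bar>overlap_dev s (\<tau> 1) (\<tau> 2)\<bar> ^ 3) + 8 * ?n" by simp
  qed
  also have "\<dots> = 8 * ?m * ?S + 8 * ?n"
    unfolding nu_add nu_cmult nu_sum nu_const ..
  finally have e: "err \<le> 9 * ?n + 8 * ?m * ?S" by (simp add: err_def)
  have S0: "0 \<le> ?S"
  proof (rule sum_nonneg)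
    fix s
    show "0 \<le> \<nu> 2 (\<lambda>\<tau>. \<bar>overlap_dev s (\<tau> 1) (\<tau> 2)\<bar> ^ 3)"
      using nu_mono[of 2 "\<lambda>_. 0" "\<lambda>\<tau>. \<bar>overlap_dev s (\<tau> 1) (\<tau> 2)\<bar> ^ 3"] by (simp add: nu_const)
  qed
  have "9 * ?n \<le> 9 * ?m * ?n" using m1 mult_right_mono[of 1 ?m ?n] by simp
  moreover have "8 * ?m * ?S \<le> 9 * ?m * ?S" using m1 S0 by (intro mult_right_mono) auto
  ultimately have "err \<le> 9 * ?m * (?n + ?S)" using e unfolding distrib_left by linarith
  moreover have "overlap I \<tau> 1 2 $ s - q $ s = overlap_dev s (\<tau> 1) (\<tau> 2)" for \<tau> s
    using overlap_minus_q[of \<tau> 1 2 s] by simp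
  ultimately show ?thesis by simp
qed

lemma overlap_cov_nth:
  "overlap_cov \<beta> h N M g I q 4 (1, 2) (3, 4) $ p $ r = cov0 p r"
  "overlap_cov \<beta> h N M g I q 3 (1, 2) (1, 3) $ p $ r = cov1 p r"
  "overlap_cov \<beta> h N M g I q 2 (1, 2) (1, 2) $ p $ r = cov2 p r"
  unfolding overlap_cov_def cov0_def cov1_def cov2_def overlap_minus_q by simp_all

lemma lin3_abs_le:
  fixes a b c x y z C :: real
  assumes "\<bar>x\<bar> \<le> C" "\<bar>y\<bar> \<le> C" "\<bar>z\<bar> \<le> C"
  shows "\<bar>a * x + b * y + c * z\<bar> \<le> (\<bar>a\<bar> + \<bar>b\<bar> + \<bar>c\<bar>) * C"
proof -
  have "\<bar>a * x + b * y + c * z\<bar> \<le> \<bar>a\<bar> * \<bar>x\<bar> + \<bar>b\<bar> * \<bar>y\<bar> + \<bar>c\<bar> * \<bar>z\<bar>"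
    unfolding abs_mult[symmetric] by linarith
  also have "\<dots> \<le> \<bar>a\<bar> * C + \<bar>b\<bar> * C + \<bar>c\<bar> * C" by (intro add_mono mult_left_mono assms) auto
  finally show ?thesis by (simp only: distrib_right)
qed

text \<open>The coefficient vectors \<open>(1, -2, 1)\<close>, \<open>(3, -4, 1)\<close> and \<open>(-3, 2, 0)\<close> bring the system for
  \<open>cov0\<close>, \<open>cov1\<close>, \<open>cov2\<close> into triangular form: the first two are left eigenvectors of its
  coefficient matrix, with eigenvalues $\gamma$ and $\gamma'$, and the third is a generalised one for $\gamma'$.
  The factor \<open>8\<close> is the largest sum of absolute values of such a vector.\<close>

lemma combined_expansions:
  fixes p r :: 'm
  defines "\<gamma> \<equiv> 1 - 2 * q $ p + tanh_mean 4 p" and "\<gamma>' \<equiv> 1 - 4 * q $ p + 3 * tanh_mean 4 p"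
    and "\<gamma>'' \<equiv> 2 * q $ p + (q $ p)\<^sup>2 - 3 * tanh_mean 4 p"
  defines "d x \<equiv> (if p = r then x / lam $ p / real N else 0)"
  shows "\<bar>(cov0 p r - 2 * cov1 p r + cov2 p r)
      - \<beta>\<^sup>2 * (\<gamma> * (DL_mult cov0 p r - 2 * DL_mult cov1 p r + DL_mult cov2 p r)) - d \<gamma>\<bar> \<le> 8 * (site_const * err)" (is ?A)
    and "\<bar>(3 * cov0 p r - 4 * cov1 p r + cov2 p r)
      - \<beta>\<^sup>2 * (\<gamma>' * (3 * DL_mult cov0 p r - 4 * DL_mult cov1 p r + DL_mult cov2 p r)) - d \<gamma>'\<bar> \<le> 8 * (site_const * err)" (is ?B)
    and "\<bar>(- 3 * cov0 p r + 2 * cov1 p r)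
      - \<beta>\<^sup>2 * (\<gamma>' * (- 3 * DL_mult cov0 p r + 2 * DL_mult cov1 p r))
      - (\<beta>\<^sup>2 * (\<gamma>'' * (3 * DL_mult cov0 p r - 4 * DL_mult cov1 p r + DL_mult cov2 p r)) + d \<gamma>'')\<bar> \<le> 8 * (site_const * err)" (is ?C)
proof -
  let ?x = "cov0 p r - cavity_main p r 3 4" and ?y = "cov1 p r - cavity_main p r 1 3"
    and ?z = "cov2 p r - cavity_main p r 1 2"
  define d0 where "d0 = (if p = r then 1 / lam $ p / real N else 0)"
  have d: "d x = x * d0" for x by (simp add: d_def d0_def)
  have main: "(if r = p then x / (lam $ p * real N) else 0) = x * d0" for x by (simp add: d0_def)
  note x = cov_expansions(3)[of p r] and y = cov_expansions(2)[of p r] and z = cov_expansions(1)[of p r]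
  have se: "0 \<le> site_const * err" using x by linarith
  have "1 * ?x + (- 2) * ?y + 1 * ?z = (cov0 p r - 2 * cov1 p r + cov2 p r)
      - \<beta>\<^sup>2 * (\<gamma> * (DL_mult cov0 p r - 2 * DL_mult cov1 p r + DL_mult cov2 p r)) - d \<gamma>"
    unfolding cavity_main_34 cavity_main_13 cavity_main_12 main d \<gamma>_def by (simp add: algebra_simps)
  then show ?A using lin3_abs_le[OF x y z, of 1 "- 2" 1] se by simp
  have "3 * ?x + (- 4) * ?y + 1 * ?z = (3 * cov0 p r - 4 * cov1 p r + cov2 p r)
      - \<beta>\<^sup>2 * (\<gamma>' * (3 * DL_mult cov0 p r - 4 * DL_mult cov1 p r + DL_mult cov2 p r)) - d \<gamma>'"
    unfolding cavity_main_34 cavity_main_13 cavity_main_12 main d \<gamma>'_def by (simp add: algebra_simps)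
  then show ?B using lin3_abs_le[OF x y z, of 3 "- 4" 1] se by simp
  have "(- 3) * ?x + 2 * ?y + 0 * ?z = (- 3 * cov0 p r + 2 * cov1 p r)
      - \<beta>\<^sup>2 * (\<gamma>' * (- 3 * DL_mult cov0 p r + 2 * DL_mult cov1 p r))
      - (\<beta>\<^sup>2 * (\<gamma>'' * (3 * DL_mult cov0 p r - 4 * DL_mult cov1 p r + DL_mult cov2 p r)) + d \<gamma>'')"
    unfolding cavity_main_34 cavity_main_13 cavity_main_12 main d \<gamma>'_def \<gamma>''_def
    by (simp add: algebra_simps power2_eq_square)
  then show ?C using lin3_abs_le[OF x y z, of "- 3" 2 0] se by simp
qed

lemma site_const_nonneg: "0 \<le> site_const"
  unfolding site_const_def growth_def using lam_inv_ge(1) D_total_nonneg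
  by (intro add_nonneg_nonneg mult_nonneg_nonneg) auto

end

theorem theorem1p11:
  fixes D :: "real ^ 'm ^ 'm" and lam q :: "real ^ 'm" and \<beta> h :: real
  assumes "CARD('m) \<ge> 2"
    and "transpose D = D" and "invertible D" and "D \<noteq> 0" and "\<And>s t. D $ s $ t \<ge> 0"
    and "\<And>s. 0 < lam $ s \<and> lam $ s < 1"
    and "h \<ge> 0 \<and> 0 < \<beta> \<and> \<beta> < beta_0 D lam \<or> h = 0 \<and> 0 < \<beta> \<and> \<beta> < beta_c D lam"
    and "rs_solution \<beta> h D lam q"
  shows
    "let L = diag lam;
         qh = tanh_moment 4 \<beta> h D lam q;
         \<Gamma> = diag (\<chi> s. 1 - 2 * q $ s + qh $ s);
         \<Gamma>' = diag (\<chi> s. 1 - 4 * q $ s + 3 * qh $ s);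
         \<Gamma>'' = diag (\<chi> s. 2 * q $ s + (q $ s)\<^sup>2 - 3 * qh $ s)
     in \<exists>K :: real. \<forall>(N :: nat) (I :: 'm \<Rightarrow> nat set) (M :: 'w measure) g.
       N \<ge> 1 \<and> species_partition lam N I \<and> sk_disorder D N I M g \<longrightarrow>
       (let U0 = overlap_cov \<beta> h N M g I q 4 (1, 2) (3, 4);
            U1 = overlap_cov \<beta> h N M g I q 3 (1, 2) (1, 3);
            U2 = overlap_cov \<beta> h N M g I q 2 (1, 2) (1, 2);
            Uh0 = (-3) *\<^sub>R U0 + 2 *\<^sub>R U1;
            Uh1 = 3 *\<^sub>R U0 - 4 *\<^sub>R U1 + U2;
            Uh2 = U0 - 2 *\<^sub>R U1 + U2
        in \<exists>R0 R1 R2 :: real ^ 'm ^ 'm.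
          transpose R0 = R0 \<and> transpose R1 = R1 \<and> transpose R2 = R2 \<and>
          sym_part ((mat 1 - \<beta>\<^sup>2 *\<^sub>R (\<Gamma> ** D ** L)) ** Uh2)
            = (1 / real N) *\<^sub>R (\<Gamma> ** matrix_inv L) + R2 \<and>
          sym_part ((mat 1 - \<beta>\<^sup>2 *\<^sub>R (\<Gamma>' ** D ** L)) ** Uh1)
            = (1 / real N) *\<^sub>R (\<Gamma>' ** matrix_inv L) + R1 \<and>
          sym_part ((mat 1 - \<beta>\<^sup>2 *\<^sub>R (\<Gamma>' ** D ** L)) ** Uh0)
            = \<beta>\<^sup>2 *\<^sub>R sym_part (\<Gamma>'' ** D ** L ** Uh1)
              + (1 / real N) *\<^sub>R (\<Gamma>'' ** matrix_inv L) + R0 \<and>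
          (\<forall>R\<in>{R0, R1, R2}. \<forall>p r.
             \<bar>R $ p $ r\<bar> \<le> K * (real N powr (- 3 / 2)
               + (\<Sum>s\<in>UNIV. nu \<beta> h N M g 2 (\<lambda>\<tau>. \<bar>overlap I \<tau> 1 2 $ s - q $ s\<bar> ^ 3)))))"
proof -
  define L where "L = diag lam"
  define qh where "qh = tanh_moment 4 \<beta> h D lam q"
  define v where "v = (\<chi> s. 1 - 2 * q $ s + qh $ s)"
  define v' where "v' = (\<chi> s. 1 - 4 * q $ s + 3 * qh $ s)"
  define v'' where "v'' = (\<chi> s. 2 * q $ s + (q $ s)\<^sup>2 - 3 * qh $ s)"
  define K where "K = 8 * sk_system.site_const D lam \<beta> * (9 * real CARD('m) ^ 3)"
  have lam0: "lam $ s \<noteq> 0" for s using assms(6)[of s] by simp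
  have "(let U0 = overlap_cov \<beta> h N M g I q 4 (1, 2) (3, 4);
            U1 = overlap_cov \<beta> h N M g I q 3 (1, 2) (1, 3);
            U2 = overlap_cov \<beta> h N M g I q 2 (1, 2) (1, 2);
            Uh0 = (-3) *\<^sub>R U0 + 2 *\<^sub>R U1;
            Uh1 = 3 *\<^sub>R U0 - 4 *\<^sub>R U1 + U2;
            Uh2 = U0 - 2 *\<^sub>R U1 + U2
        in \<exists>R0 R1 R2 :: real ^ 'm ^ 'm.
          transpose R0 = R0 \<and> transpose R1 = R1 \<and> transpose R2 = R2 \<and>
          sym_part ((mat 1 - \<beta>\<^sup>2 *\<^sub>R (diag v ** D ** L)) ** Uh2)
            = (1 / real N) *\<^sub>R (diag v ** matrix_inv L) + R2 \<and>
          sym_part ((mat 1 - \<beta>\<^sup>2 *\<^sub>R (diag v' ** D ** L)) ** Uh1)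
            = (1 / real N) *\<^sub>R (diag v' ** matrix_inv L) + R1 \<and>
          sym_part ((mat 1 - \<beta>\<^sup>2 *\<^sub>R (diag v' ** D ** L)) ** Uh0)
            = \<beta>\<^sup>2 *\<^sub>R sym_part (diag v'' ** D ** L ** Uh1)
              + (1 / real N) *\<^sub>R (diag v'' ** matrix_inv L) + R0 \<and>
          (\<forall>R\<in>{R0, R1, R2}. \<forall>p r.
             \<bar>R $ p $ r\<bar> \<le> K * (real N powr (- 3 / 2)
               + (\<Sum>s\<in>UNIV. nu \<beta> h N M g 2 (\<lambda>\<tau>. \<bar>overlap I \<tau> 1 2 $ s - q $ s\<bar> ^ 3)))))"
    if hyps: "N \<ge> 1" "species_partition lam N I" "sk_disorder D N I M g"
    for N :: nat and I :: "'m \<Rightarrow> nat set" and M :: "'w measure" and g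
  proof -
    have sym: "D $ s $ t = D $ t $ s" for s t
      using arg_cong[OF assms(2), of "\<lambda>A. A $ t $ s"] by (simp add: transpose_def)
    interpret sk_system D lam q \<beta> h N I M g
      using assms(1,5,6,8) sym hyps by unfold_locales auto
    define U0 where "U0 = overlap_cov \<beta> h N M g I q 4 (1, 2) (3, 4)"
    define U1 where "U1 = overlap_cov \<beta> h N M g I q 3 (1, 2) (1, 3)"
    define U2 where "U2 = overlap_cov \<beta> h N M g I q 2 (1, 2) (1, 2)"
    define Uh0 where "Uh0 = (-3) *\<^sub>R U0 + 2 *\<^sub>R U1"
    define Uh1 where "Uh1 = 3 *\<^sub>R U0 - 4 *\<^sub>R U1 + U2"
    define Uh2 where "Uh2 = U0 - 2 *\<^sub>R U1 + U2"
    define B where "B w = (1 / real N) *\<^sub>R (diag w ** matrix_inv L)" for w :: "real ^ 'm"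
    let ?err = "K * (real N powr (- 3 / 2)
        + (\<Sum>s\<in>UNIV. nu \<beta> h N M g 2 (\<lambda>\<tau>. \<bar>overlap I \<tau> 1 2 $ s - q $ s\<bar> ^ 3)))"
    have le: "8 * (site_const * err) \<le> ?err"
      using mult_left_mono[OF err_le, of "8 * site_const"] site_const_nonneg
      by (simp add: K_def mult.assoc)
    have U: "U0 $ p $ r = cov0 p r" "U1 $ p $ r = cov1 p r" "U2 $ p $ r = cov2 p r" for p r
      unfolding U0_def U1_def U2_def by (rule overlap_cov_nth)+
    have Uh: "Uh0 $ p $ r = - 3 * cov0 p r + 2 * cov1 p r" "Uh1 $ p $ r = 3 * cov0 p r - 4 * cov1 p r + cov2 p r"
      "Uh2 $ p $ r = cov0 p r - 2 * cov1 p r + cov2 p r" for p r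
      by (simp_all add: Uh0_def Uh1_def Uh2_def U)
    have dr: "(\<Sum>t\<in>UNIV. D $ p $ t * lam $ t * Uh0 $ t $ r) = - 3 * DL_mult cov0 p r + 2 * DL_mult cov1 p r"
      "(\<Sum>t\<in>UNIV. D $ p $ t * lam $ t * Uh1 $ t $ r) = 3 * DL_mult cov0 p r - 4 * DL_mult cov1 p r + DL_mult cov2 p r"
      "(\<Sum>t\<in>UNIV. D $ p $ t * lam $ t * Uh2 $ t $ r) = DL_mult cov0 p r - 2 * DL_mult cov1 p r + DL_mult cov2 p r" for p r
      unfolding Uh DL_mult_def by (simp_all add: distrib_left right_diff_distrib sum.distrib sum_subtractf
          sum_distrib_left sum_negf mult_ac)
    have qh: "qh $ p = tanh_mean 4 p" for p unfolding qh_def by (rule tanh_moment_eq)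
    have Bn: "B w $ p $ r = (if p = r then w $ p / lam $ p / real N else 0)" for w p r
      by (simp add: B_def L_def diag_mult_matrix_inv_nth[OF lam0])
    have symB: "sym_part (B w) = B w" for w by (rule sym_part_diag_type) (simp add: Bn)
    let ?A2 = "(mat 1 - \<beta>\<^sup>2 *\<^sub>R (diag v ** D ** L)) ** Uh2"
    let ?A1 = "(mat 1 - \<beta>\<^sup>2 *\<^sub>R (diag v' ** D ** L)) ** Uh1"
    let ?A0 = "(mat 1 - \<beta>\<^sup>2 *\<^sub>R (diag v' ** D ** L)) ** Uh0"
    let ?E = "diag v'' ** D ** L ** Uh1"
    have c2: "\<bar>?A2 $ p $ r - B v $ p $ r\<bar> \<le> ?err" for p r
      using order_trans[OF combined_expansions(1)[of p r] le]
      unfolding L_def one_minus_diag_D_diag_mult_nth dr Bn unfolding Uh by (simp only: v_def vec_lambda_beta qh)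
    have c1: "\<bar>?A1 $ p $ r - B v' $ p $ r\<bar> \<le> ?err" for p r
      using order_trans[OF combined_expansions(2)[of p r] le]
      unfolding L_def one_minus_diag_D_diag_mult_nth dr Bn unfolding Uh by (simp only: v'_def vec_lambda_beta qh)
    have c0: "\<bar>?A0 $ p $ r - (\<beta>\<^sup>2 *\<^sub>R ?E + B v'') $ p $ r\<bar> \<le> ?err" for p r
      using order_trans[OF combined_expansions(3)[of p r] le]
      unfolding L_def one_minus_diag_D_diag_mult_nth vector_add_component vector_scaleR_component
        diag_D_diag_mult_nth dr Bn real_scaleR_def
      unfolding Uh by (simp only: v'_def v''_def vec_lambda_beta qh)
    have symE: "sym_part (\<beta>\<^sup>2 *\<^sub>R ?E + B v'') = \<beta>\<^sup>2 *\<^sub>R sym_part ?E + B v''"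
    proof -
      have "sym_part (\<beta>\<^sup>2 *\<^sub>R ?E + B v'') = \<beta>\<^sup>2 *\<^sub>R sym_part ?E + sym_part (B v'')"
        by (simp add: vec_eq_iff sym_part_nth field_simps)
      then show ?thesis by (simp only: symB)
    qed
    obtain R2 where R2: "transpose R2 = R2" "sym_part ?A2 = B v + R2" "\<forall>p r. \<bar>R2 $ p $ r\<bar> \<le> ?err"
      using sym_part_remainder[OF c2 symB] by blast
    obtain R1 where R1: "transpose R1 = R1" "sym_part ?A1 = B v' + R1" "\<forall>p r. \<bar>R1 $ p $ r\<bar> \<le> ?err"
      using sym_part_remainder[OF c1 symB] by blast
    obtain R0 where R0: "transpose R0 = R0" "sym_part ?A0 = \<beta>\<^sup>2 *\<^sub>R sym_part ?E + B v'' + R0"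
      "\<forall>p r. \<bar>R0 $ p $ r\<bar> \<le> ?err"
      using sym_part_remainder[OF c0 symE] by blast
    have bounds: "\<forall>R\<in>{R0, R1, R2}. \<forall>p r. \<bar>R $ p $ r\<bar> \<le> ?err"
      using R0(3) R1(3) R2(3) by blast
    show ?thesis
      unfolding Let_def U0_def[symmetric] U1_def[symmetric] U2_def[symmetric]
        Uh0_def[symmetric] Uh1_def[symmetric] Uh2_def[symmetric] B_def[symmetric]
      by (rule exI[of _ R0], rule exI[of _ R1], rule exI[of _ R2]) 
        (intro conjI R0(1,2) R1(1,2) R2(1,2) bounds)
  qed
  then show ?thesis
    unfolding Let_def L_def[symmetric] qh_def[symmetric] v_def[symmetric] v'_def[symmetric] v''_def[symmetric]
    by (intro exI[of _ K]) blast
qed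

end
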